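(* Let $h$ be a transcendental entire function with $h(1)\neq 0$ and $h(-1)\neq 0$. For $a\in\mathbb{C}$ put $H_a(z):=\cos z\cdot h(\sin z)+a\sin z$. Then there exists an at most countable set $E\subset\mathbb{C}$ such that for each $a\notin E$: (i) $H_a$ is prime in the entire sense; (ii) $\#\{[z]: H_a'(z)=0\}=\infty$, where $[z]=\{z+2\pi n: n\in\mathbb{Z}\}$; (iii) for every $c\in\mathbb{C}$ and any $z_1,z_2\in\{z\in\mathbb{C}: H_a(z)=c,\ H_a'(z)=0\}$ we have $\cos z_1=\cos z_2$ and $\sin z_1=\sin z_2$; (iv) $H_a'$ has only simple zeros.
   Context: An entire function $F$ is prime in the entire sense if whenever $F=f\circ g$ with $f,g$ entire, either $f$ is linear or $g$ is linear. Here $H_a$ is $2\pi$-periodic and $[z]$ denotes the orbit of $z$ under translation by $2\pi$. *)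

theory Defs
  imports "HOL-Analysis.Analysis" "HOL-Computational_Algebra.Polynomial"
begin

definition entire :: "(complex \<Rightarrow> complex) \<Rightarrow> bool" where
  "entire f \<longleftrightarrow> f holomorphic_on UNIV"

definition transcendental_entire :: "(complex \<Rightarrow> complex) \<Rightarrow> bool" where
  "transcendental_entire f \<longleftrightarrow> entire f \<and> \<not> (\<exists>p. \<forall>z. f z = poly p z)"

definition linear_fun :: "(complex \<Rightarrow> complex) \<Rightarrow> bool" where
  "linear_fun f \<longleftrightarrow> (\<exists>\<alpha> \<beta>. \<alpha> \<noteq> 0 \<and> (\<forall>z. f z = \<alpha> * z + \<beta>))"

definition prime_entire :: "(complex \<Rightarrow> complex) \<Rightarrow> bool" where
  "prime_entire F \<longleftrightarrow>
     (\<forall>f g. entire f \<and> entire g \<and> F = f \<circ> g \<longrightarrow> linear_fun f \<or> linear_fun g)"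

definition orbit2pi :: "complex \<Rightarrow> complex set" where
  "orbit2pi z = {z + 2 * of_real pi * of_int n | n. True}"

definition H :: "(complex \<Rightarrow> complex) \<Rightarrow> complex \<Rightarrow> complex \<Rightarrow> complex" where
  "H h a z = cos z * h (sin z) + a * sin z"

end

theory Submission
  imports Defs "HOL-Complex_Analysis.Complex_Analysis" "HOL-Real_Asymp.Real_Asymp"
    "HOL-Computational_Algebra.Fundamental_Theorem_Algebra"
begin

text \<open>
  Away from \<open>cos z = 0\<close> the critical points of \<open>H h a\<close> are the \<open>a\<close>-points of \<open>\<phi> = N / cos\<close>, where \<open>- N\<close>
  is the derivative of \<open>cos z * h (sin z)\<close>. Simplicity fails only for critical values of \<open>\<phi>\<close>. If
  two local branches of critical points had identical critical values, differentiating in \<open>a\<close> would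
  give equal sines and then equal cosines, so coincidences are isolated. Picard's great theorem in the
  variable \<open>exp (\<plusminus> \<i> * z)\<close> shows that all but one \<open>a\<close> have infinitely many critical orbits, and that all
  but two \<open>a\<close> take every value on infinitely many orbits.

  Let \<open>H h a = f \<circ> g\<close> for generic \<open>a\<close>. A critical point \<open>w\<close> of \<open>f\<close> has all its \<open>g\<close>-preimages in one
  orbit. If \<open>g\<close> has no period in \<open>2\<pi>\<int>\<close> there are at most two of them, because near \<open>w\<close> only two
  branches of \<open>f\<^sup>-\<^sup>1 \<circ> f\<close> exist; if \<open>g\<close> has one, \<open>g\<close> tends to infinity at both ends of the cylinder and large
  values are taken at both ends. Either way Picard leaves \<open>f\<close> at most one critical point, so
  \<open>deriv f w = (w - w0) ^ \<kappa> * exp (\<alpha> w)\<close>. Reflecting at \<open>\<pi>/2\<close>, the relation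
  \<open>H h a z + H h a (\<pi> - z) = 2 * a * sin z\<close> expresses \<open>exp (\<alpha> \<circ> g)\<close> by Wronskians as a quotient of functions
  of much slower growth; this forces \<open>\<alpha> \<circ> g\<close> to be a polynomial, hence \<open>\<alpha>\<close> constant and \<open>f\<close> a shifted
  power, which contradicts the distribution of values.
\<close>

section \<open>Growth of entire functions\<close>

text \<open>The obstacle of the last step is that Borel's trick bounds the real part of
  \<open>\<alpha> \<circ> g\<close> only through \<open>g\<close> and its derivatives, while
  \<open>g\<close> may grow arbitrarily fast and \<open>\<alpha>\<close>, being merely entire,
  admits no pointwise lower bound in terms of its argument. The way out is to bound \<open>g\<close>
  on a smaller disc by a constant times \<open>B * exp (286 * ((R + r) / (R - r)))\<close>, where
  \<open>B\<close> bounds \<open>\<alpha> \<circ> g\<close> on the larger one. After taking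
  logarithms only \<open>ln B\<close> and powers of \<open>r / \<delta>\<close> remain, and the
  maximum modulus at \<open>r\<close> is compared with its own logarithm at
  \<open>r + \<delta>\<close>. Iterating this along radii below \<open>r + 1\<close> leaves only
  polynomial growth.

  The conditions at 1 and -1 concern the zeros of \<open>cos\<close>: there the derivative of
  \<open>H h a\<close> does not depend on \<open>a\<close>, so a critical point at such a place
  would be common to all parameters. Transcendence of \<open>h\<close> enters after descending to
  \<open>s = sin z\<close>: controlled behaviour at an end of the cylinder turns an entire function
  of \<open>s\<close> into a polynomial.\<close>

lemma borel_caratheodory:
  assumes hol: "f holomorphic_on ball 0 R" and Re: "\<And>z. z \<in> ball 0 R \<Longrightarrow> Re (f z) < M"
    and z: "norm z \<le> r" and r: "r < R"
  shows "norm (f z - f 0) \<le> 2 * r / (R - r) * (M - Re (f 0))"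
proof -
  have r0: "0 \<le> r" using z norm_ge_zero order_trans by blast
  have R: "0 < R" using r0 r by simp
  define K where "K = M - Re (f 0)"
  have K: "0 < K" using Re[of 0] R by (simp add: K_def)
  define g where "g = (\<lambda>z. f (of_real R * z) - f 0)"
  \<comment> \<open>The Moebius map \<open>u / (2 * K - u)\<close> takes the half-plane
    \<open>Re u < K\<close> onto the unit disc and fixes 0, so the Schwarz lemma applies to
    \<open>q\<close>.\<close>
  define q where "q = (\<lambda>z. g z / (2 * of_real K - g z))"
  have inb: "of_real R * w \<in> ball 0 R" if "w \<in> ball 0 1" for w :: complex
    using that R by (simp add: norm_mult)
  have holg: "g holomorphic_on ball 0 1"
    unfolding g_def
    using holomorphic_on_compose_gen[OF _ hol, of "\<lambda>z. of_real R * z" "ball 0 1"] inb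
    by (intro holomorphic_intros) (simp add: o_def image_subset_iff holomorphic_intros)
  have Reg: "Re (g w) < K" if "w \<in> ball 0 1" for w
    using Re[OF inb[OF that]] by (simp add: g_def K_def)
  have nz: "2 * of_real K - g w \<noteq> 0" if "w \<in> ball 0 1" for w
    using Reg[OF that] K by (auto simp: complex_eq_iff)
  have lt: "norm (g w) < norm (2 * of_real K - g w)" if "w \<in> ball 0 1" for w
  proof -
    have "(norm (2 * of_real K - g w))\<^sup>2 - (norm (g w))\<^sup>2 = 4 * K * (K - Re (g w))"
      unfolding cmod_power2 by (simp add: power2_eq_square algebra_simps)
    also have "\<dots> > 0" using K Reg[OF that] by simp
    finally show ?thesis by (simp add: power2_less_imp_less)
  qed
  have q1: "norm (q w) < 1" if "norm w < 1" for w
    using lt[of w] nz[of w] that by (simp add: q_def norm_divide)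
  have holq: "q holomorphic_on ball 0 1"
    unfolding q_def using nz by (intro holomorphic_intros holg) auto
  define w where "w = z / of_real R"
  have w1: "norm w < 1" using z r R by (simp add: w_def norm_divide)
  have "norm (q w) \<le> norm w"
    by (rule Schwarz_Lemma(1)[OF holq _ q1 w1]) (simp add: q_def g_def)
  also have "norm w \<le> r / R" using z R by (simp add: w_def norm_divide divide_right_mono)
  finally have qt: "norm (q w) \<le> r / R" .
  have gw: "g w = f z - f 0" using R by (simp add: g_def w_def)
  have "q w * (2 * of_real K - g w) = g w" using nz[of w] w1 by (simp add: q_def)
  then have "norm (g w) = norm (q w) * norm (2 * of_real K - g w)" by (metis norm_mult)
  also have "\<dots> \<le> (r / R) * (2 * K + norm (g w))"
    using qt K r0 R norm_triangle_ineq4[of "2 * of_real K" "g w"] 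
    by (intro mult_mono) (auto simp: norm_mult)
  finally have "norm (g w) \<le> 2 * r / (R - r) * K"
    using R r by (simp add: field_simps)
  then show ?thesis by (simp add: gw K_def)
qed

text \<open>\<open>ln (M / norm (V z))\<close> is a positive harmonic function, so this is Harnack's
  inequality. It comes from Borel-Caratheodory for a logarithm of \<open>V\<close>; the factor is
  \<open>1 + 2 * r / (R - r)\<close>.\<close>

lemma harnack_nonvanishing:
  fixes V :: "complex \<Rightarrow> complex"
  assumes hol: "V holomorphic_on ball 0 R" and nz: "\<And>z. z \<in> ball 0 R \<Longrightarrow> V z \<noteq> 0"
    and lt: "\<And>z. z \<in> ball 0 R \<Longrightarrow> norm (V z) < M"
    and z: "norm z \<le> r" and r: "r < R"
  shows "ln (M / norm (V z)) \<le> (R + r) / (R - r) * ln (M / norm (V 0))"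
proof -
  have r0: "0 \<le> r" using z norm_ge_zero order_trans by blast
  have R: "0 < R" using r0 r by simp
  obtain L where L: "L holomorphic_on ball 0 R" "\<And>z. z \<in> ball 0 R \<Longrightarrow> V z = exp (L z)"
    using contractible_imp_holomorphic_log[OF hol convex_imp_contractible[OF convex_ball] nz] by metis
  have M: "0 < M" using lt[of 0] R by (meson centre_in_ball le_less_trans norm_ge_zero)
  have nV: "ln (M / norm (V w)) = ln M - Re (L w)" if "w \<in> ball 0 R" for w
    using L(2)[OF that] M by (simp add: ln_div)
  have ReL: "Re (L w) < ln M" if "w \<in> ball 0 R" for w
  proof -
    have "exp (Re (L w)) < M" using lt[OF that] L(2)[OF that] by simp
    then show ?thesis using M by (metis exp_less_cancel_iff exp_ln)
  qed
  have "norm (L z - L 0) \<le> 2 * r / (R - r) * (ln M - Re (L 0))"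
    by (rule borel_caratheodory[OF L(1) ReL z r])
  moreover have "Re (L 0) - Re (L z) \<le> norm (L z - L 0)"
    by (metis complex_Re_le_cmod minus_complex.simps(1) norm_minus_commute)
  ultimately have "ln M - Re (L z) \<le> (1 + 2 * r / (R - r)) * (ln M - Re (L 0))"
    by (simp add: algebra_simps)
  also have "1 + 2 * r / (R - r) = (R + r) / (R - r)" using r by (simp add: field_simps)
  finally show ?thesis using nV[of z] nV[of 0] z r R by auto
qed

lemma entire_factor_zero:
  fixes P :: "complex \<Rightarrow> complex"
  assumes hol: "P holomorphic_on UNIV" and b: "P \<beta> \<noteq> 0"
  obtains n P1 where "P1 holomorphic_on UNIV" "P1 \<zeta> \<noteq> 0" "\<And>z. P z = (z - \<zeta>) ^ n * P1 z"
proof (cases "P \<zeta> = 0")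
  case False
  then show ?thesis using that[of P 0] hol by simp
next
  case True
  have nc: "\<not> P constant_on UNIV"
    using True b by (metis UNIV_I constant_on_def)
  obtain g r n where g: "0 < n" "0 < r" "ball \<zeta> r \<subseteq> UNIV" "g holomorphic_on ball \<zeta> r"
    "\<And>w. w \<in> ball \<zeta> r \<Longrightarrow> P w = (w - \<zeta>) ^ n * g w"
    "\<And>w. w \<in> ball \<zeta> r \<Longrightarrow> g w \<noteq> 0"
    by (rule holomorphic_factor_zero_nonconstant[OF hol open_UNIV connected_UNIV UNIV_I True nc])
      (rule that; assumption)
  define P1 where "P1 = (\<lambda>w. if w = \<zeta> then g \<zeta> else P w / (w - \<zeta>) ^ n)"
  have eqg: "P1 w = g w" if "w \<in> ball \<zeta> r" for w
    using g(5)[OF that] by (simp add: P1_def)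
  have "P1 holomorphic_on ball \<zeta> r"
    using holomorphic_transform[OF g(4)] eqg by metis
  moreover have "P1 holomorphic_on - {\<zeta>}"
  proof -
    have "(\<lambda>w. P w / (w - \<zeta>) ^ n) holomorphic_on - {\<zeta>}"
      by (intro holomorphic_intros holomorphic_on_subset[OF hol]) auto
    then show ?thesis by (rule holomorphic_transform) (simp add: P1_def)
  qed
  ultimately have "P1 holomorphic_on ball \<zeta> r \<union> - {\<zeta>}"
    by (intro holomorphic_on_Un) auto
  moreover have "ball \<zeta> r \<union> - {\<zeta>} = UNIV" using g(2) by auto
  ultimately have "P1 holomorphic_on UNIV" by simp
  moreover have "P1 \<zeta> \<noteq> 0" using g(6)[of \<zeta>] g(2) by (simp add: P1_def)
  moreover have "P z = (z - \<zeta>) ^ n * P1 z" for z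
    using True g(1) by (simp add: P1_def)
  ultimately show ?thesis using that by blast
qed

text \<open>The supremum over the compact circle is attained, which is why the strict inequality
  survives inside.\<close>

lemma sphere_bound_imp_ball_bound:
  fixes f :: "complex \<Rightarrow> complex"
  assumes hol: "f holomorphic_on UNIV" and R: "0 < R"
    and bd: "\<And>z. z \<in> sphere 0 R \<Longrightarrow> norm (f z) < M" and z: "z \<in> cball 0 R"
  shows "norm (f z) < M"
proof -
  have "continuous_on (sphere 0 R) (\<lambda>z. norm (f z))"
    by (intro continuous_intros holomorphic_on_imp_continuous_on holomorphic_on_subset[OF hol]) auto
  then obtain w where w: "w \<in> sphere 0 R" "\<And>y. y \<in> sphere 0 R \<Longrightarrow> norm (f y) \<le> norm (f w)"
    using continuous_attains_sup[OF compact_sphere, of 0 R "\<lambda>z. norm (f z)"] R by auto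
  have "norm (f z) \<le> norm (f w)"
  proof (rule maximum_modulus_frontier[where S = "cball 0 R" and f = f])
    show "f holomorphic_on interior (cball 0 R)" "continuous_on (closure (cball 0 R)) f"
      using hol by (auto intro: holomorphic_on_subset holomorphic_on_imp_continuous_on)
  qed (use w z in auto)
  then show ?thesis using bd[OF w(1)] by simp
qed

text \<open>Dividing a zero out of \<open>P\<close> and of \<open>exp A * P\<close> by a Blaschke factor changes neither modulus on
  the circle and only increases \<open>norm (P 0)\<close>; once \<open>P\<close> has no zeros, Harnack's inequality applies.\<close>

lemma Re_bound_of_quotient:
  fixes P A :: "complex \<Rightarrow> complex"
  assumes "P holomorphic_on UNIV" and A: "A holomorphic_on UNIV" and "P 0 \<noteq> 0"
    and "\<And>z. z \<in> sphere 0 R \<Longrightarrow> norm (P z) < M"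
    and "\<And>z. z \<in> sphere 0 R \<Longrightarrow> norm (exp (A z) * P z) < M"
    and z: "norm z \<le> r" and r: "r < R"
  shows "Re (A z) \<le> (R + r) / (R - r) * ln (M / norm (P 0))"
  using assms(1,3-5)
proof (induction "card {z \<in> ball 0 R. P z = 0}" arbitrary: P rule: less_induct)
  case less
  have r0: "0 \<le> r" using z norm_ge_zero order_trans by blast
  have R: "0 < R" using r0 r by simp
  have fin: "finite {z \<in> ball 0 R. P z = 0}"
  proof -
    have "\<not> P constant_on UNIV \<or> (\<forall>z. P z \<noteq> 0)"
      using less.prems(2) by (metis UNIV_I constant_on_def)
    then show ?thesis
    proof
      assume "\<not> P constant_on UNIV"
      then have "finite {z \<in> cball 0 R. P z = 0}"
        by (rule holomorphic_compact_finite_zeros[OF less.prems(1) open_UNIV connected_UNIV compact_cball subset_UNIV])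
      then show ?thesis by (rule rev_finite_subset) auto
    qed auto
  qed
  show ?case
  proof (cases "{z \<in> ball 0 R. P z = 0} = {}")
    case True
    have bP: "norm (P w) < M" if "w \<in> cball 0 R" for w
      by (rule sphere_bound_imp_ball_bound[OF less.prems(1) R less.prems(3) that])
    have bQ: "norm (exp (A w) * P w) < M" if "w \<in> cball 0 R" for w
      by (rule sphere_bound_imp_ball_bound[OF _ R less.prems(4) that])
        (intro holomorphic_intros A less.prems(1))
    have zb: "z \<in> ball 0 R" using z r by simp
    have Pz: "P z \<noteq> 0" using True zb by auto
    have M: "0 < M" using bP[of 0] R by (intro le_less_trans[OF norm_ge_zero]) simp
    \<comment> \<open>The bound on \<open>exp A * P\<close> limits \<open>Re A\<close> wherever
      \<open>P\<close> is not small; Harnack for the zero-free \<open>P\<close> supplies the lower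
      bound on \<open>norm (P z)\<close>.\<close>
    have "exp (Re (A z)) * norm (P z) < M" using bQ[of z] zb by (simp add: norm_mult)
    then have "exp (Re (A z)) < M / norm (P z)" using Pz by (simp add: field_simps)
    then have "Re (A z) < ln (M / norm (P z))"
      using M Pz by (metis exp_less_cancel_iff exp_ln divide_pos_pos zero_less_norm_iff)
    also have "\<dots> \<le> (R + r) / (R - r) * ln (M / norm (P 0))"
      by (rule harnack_nonvanishing[OF _ _ _ z r])
        (use True bP less.prems(1) in \<open>auto intro: holomorphic_on_subset\<close>)
    finally show ?thesis by simp
  next
    case False
    then obtain \<zeta> where \<zeta>: "norm \<zeta> < R" "P \<zeta> = 0" by auto
    obtain n P1 where P1: "P1 holomorphic_on UNIV" "P1 \<zeta> \<noteq> 0" "\<And>z. P z = (z - \<zeta>) ^ n * P1 z"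
      using entire_factor_zero[OF less.prems(1,2)] by metis
    \<comment> \<open>\<open>b\<close> has no zero in the disc, agrees in modulus with
      \<open>w - \<zeta>\<close> on the circle, and \<open>b 0 = R\<close> exceeds
      \<open>norm \<zeta>\<close>.\<close>
    define b where "b = (\<lambda>z. (of_real (R\<^sup>2) - cnj \<zeta> * z) / of_real R)"
    define P2 where "P2 = (\<lambda>z. b z ^ n * P1 z)"
    have nb: "b w \<noteq> 0" if "w \<in> ball 0 R" for w
    proof -
      have "norm (cnj \<zeta> * w) < R * R" 
        using that \<zeta> by (simp add: norm_mult mult_strict_mono')
      moreover have "norm (of_real (R\<^sup>2) :: complex) = R * R" 
        using R by (simp add: power2_eq_square norm_mult)
      ultimately have "of_real (R\<^sup>2) \<noteq> cnj \<zeta> * w" by (metis less_irrefl)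
      then show ?thesis using R by (simp add: b_def)
    qed
    have sph: "norm (b w) = norm (w - \<zeta>)" if "w \<in> sphere 0 R" for w
    proof -
      have nw: "norm w = R" using that by simp
      have "of_real (R\<^sup>2) = cnj w * w" 
        unfolding nw[symmetric] complex_norm_square by (rule mult.commute)
      then have "b w = cnj (w - \<zeta>) * w / of_real R" by (simp add: b_def algebra_simps)
      then have "norm (b w) = norm (cnj (w - \<zeta>)) * norm w / R" 
        using R by (simp only: norm_mult norm_divide norm_of_real abs_of_pos)
      then show ?thesis using nw R by (simp only: complex_mod_cnj) simp
    qed
    have holb: "b holomorphic_on UNIV" unfolding b_def using R by (intro holomorphic_intros) auto
    have holP2: "P2 holomorphic_on UNIV" unfolding P2_def by (intro holomorphic_intros holb P1)
    have P20: "norm (P 0) \<le> norm (P2 0)"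
    proof -
      have "norm (P 0) = norm \<zeta> ^ n * norm (P1 0)" by (simp add: P1(3) norm_mult norm_power)
      also have "\<dots> \<le> R ^ n * norm (P1 0)" using \<zeta> by (intro mult_right_mono power_mono) auto
      also have "\<dots> = norm (P2 0)" using R by (simp add: P2_def b_def norm_mult norm_power power2_eq_square)
      finally show ?thesis .
    qed
    have nP0: "P2 0 \<noteq> 0" using P20 less.prems(2) by auto
    have eqn: "norm (P2 w) = norm (P w)" if "w \<in> sphere 0 R" for w
      using sph[OF that] by (simp add: P2_def P1(3) norm_mult norm_power)
    have "{z \<in> ball 0 R. P2 z = 0} \<subseteq> {z \<in> ball 0 R. P z = 0} - {\<zeta>}"
      using nb P1(2) by (auto simp: P2_def P1(3))
    moreover have "\<dots> \<subset> {z \<in> ball 0 R. P z = 0}" using \<zeta> by auto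
    ultimately have "card {z \<in> ball 0 R. P2 z = 0} < card {z \<in> ball 0 R. P z = 0}"
      using fin by (meson psubset_card_mono subset_psubset_trans)
    then have "Re (A z) \<le> (R + r) / (R - r) * ln (M / norm (P2 0))"
      using less.hyps[OF _ holP2 nP0] eqn less.prems(3,4) by (simp add: norm_mult)
    also have "\<dots> \<le> (R + r) / (R - r) * ln (M / norm (P 0))"
    proof -
      have M: "0 < M" using less.prems(3)[of "of_real R"] R
        by (intro le_less_trans[OF norm_ge_zero]) simp
      have "ln (M / norm (P2 0)) \<le> ln (M / norm (P 0))"
        using M nP0 less.prems(2) P20 by (simp add: frac_le)
      then show ?thesis using r0 r by (intro mult_left_mono) auto
    qed
    finally show ?thesis .
  qed
qed

section \<open>Bounding the inner function of a composition\<close>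

lemma simply_connected_sublevel_component:
  fixes \<alpha> :: "complex \<Rightarrow> complex" and B :: real and p :: complex
  assumes hol: "\<alpha> holomorphic_on UNIV"
  defines "\<Omega> \<equiv> connected_component_set {w. norm (\<alpha> w) < B} p"
  shows "open \<Omega>" "simply_connected \<Omega>"
proof -
  have cont: "continuous_on UNIV \<alpha>" using hol by (rule holomorphic_on_imp_continuous_on)
  have op: "open {w. norm (\<alpha> w) < B}"
    by (intro open_Collect_less continuous_intros cont)
  then show opO: "open \<Omega>" unfolding \<Omega>_def by (rule open_connected_component)
  have "winding_number \<gamma> z = 0"
    if \<gamma>: "path \<gamma>" "path_image \<gamma> \<subseteq> \<Omega>" "pathfinish \<gamma> = pathstart \<gamma>" "z \<notin> \<Omega>" for \<gamma> z
  proof (rule ccontr)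
    assume nz: "winding_number \<gamma> z \<noteq> 0"
    define T where "T = path_image \<gamma>"
    have zT: "z \<notin> T" using \<gamma> by (auto simp: T_def)
    have "z \<notin> outside T"
      using winding_number_zero_in_outside[OF \<gamma>(1,3)] nz by (auto simp: T_def)
    then have zin: "z \<in> inside T" using zT inside_Un_outside by blast
    have cT: "compact T" "connected T" "T \<noteq> {}" 
      using \<gamma>(1) by (auto simp: T_def compact_path_image connected_path_image)
    have bdT: "norm (\<alpha> w) < B" if "w \<in> T" for w
      using that \<gamma>(2) connected_component_subset by (fastforce simp: T_def \<Omega>_def)
    obtain m where m: "m \<in> T" "\<And>y. y \<in> T \<Longrightarrow> norm (\<alpha> y) \<le> norm (\<alpha> m)"
      using continuous_attains_sup[OF cT(1,3), of "\<lambda>w. norm (\<alpha> w)"]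
        continuous_on_norm[OF continuous_on_subset[OF cont subset_UNIV]] by blast
    \<comment> \<open>By the maximum modulus principle, whatever the loop encloses stays in the
      sublevel set. Being connected to the loop, it lies in the same component, so the component has
      no holes.\<close>
    have "norm (\<alpha> w) < B" if "w \<in> inside T" for w
    proof -
      have "norm (\<alpha> w) \<le> norm (\<alpha> m)"
      proof (rule maximum_modulus_frontier[where S = "inside T" and f = \<alpha>])
        show "bounded (inside T)" using cT by (intro bounded_inside compact_imp_bounded)
        show "norm (\<alpha> y) \<le> norm (\<alpha> m)" if "y \<in> frontier (inside T)" for y
          using frontier_inside_subset[OF compact_imp_closed[OF cT(1)]] that m(2) by blast
      qed (use that hol cont in \<open>auto intro: holomorphic_on_subset continuous_on_subset\<close>)
      then show ?thesis using bdT[OF m(1)] by simp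
    qed
    then have sub: "T \<union> inside T \<subseteq> {w. norm (\<alpha> w) < B}" using bdT by auto
    have con: "connected (T \<union> inside T)"
      using connected_with_inside[OF compact_imp_closed[OF cT(1)] cT(2)] .
    have "connected_component {w. norm (\<alpha> w) < B} p m"
      using m(1) \<gamma>(2) by (auto simp: T_def \<Omega>_def)
    moreover have "connected_component {w. norm (\<alpha> w) < B} m z"
      unfolding connected_component_def using con sub m(1) zin by blast
    ultimately have "z \<in> \<Omega>" unfolding \<Omega>_def by (auto intro: connected_component_trans)
    then show False using \<gamma>(4) by simp
  qed
  moreover have "connected \<Omega>" by (simp add: \<Omega>_def)
  ultimately show "simply_connected \<Omega>"
    unfolding simply_connected_eq_winding_number_zero[OF opO] by blast
qed

lemma entire_nonconstant_deriv:
  fixes f :: "complex \<Rightarrow> complex"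
  assumes hol: "f holomorphic_on UNIV" and nc: "\<not> f constant_on UNIV"
  obtains n where "0 < n" "(deriv ^^ n) f p \<noteq> 0"
proof (rule ccontr)
  assume "\<not> thesis"
  then have "\<And>n. 0 < n \<Longrightarrow> (deriv ^^ n) f p = 0" using that by blast
  then have "f w = f p" for w
    by (intro holomorphic_fun_eq_const_on_connected[OF hol]) auto
  then show False using nc by (auto simp: constant_on_def)
qed

text \<open>The component \<open>\<Omega>\<close> of the sublevel set containing the image of \<open>g\<close> is simply connected, so
  \<open>w - w1\<close> has a holomorphic square root on \<open>\<Omega>\<close> for the boundary point \<open>w1\<close> nearest to \<open>g 0\<close>. Its
  values contain a disc of radius comparable to \<open>sqrt \<rho>\<close> by Bloch's theorem, hence omit the opposite
  disc.\<close>

lemma growth_inner_le_growth_composition: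
  fixes \<alpha> g :: "complex \<Rightarrow> complex"
  assumes hola: "\<alpha> holomorphic_on UNIV" and nc: "\<not> \<alpha> constant_on UNIV"
    and holg: "g holomorphic_on UNIV"
  obtains C where "C \<ge> 1"
    "\<And>B r R z. \<lbrakk>1 \<le> B; 0 < r; r < R; \<And>w. w \<in> ball 0 R \<Longrightarrow> norm (\<alpha> (g w)) < B; norm z \<le> r\<rbrakk>
      \<Longrightarrow> norm (g z) \<le> C * B * exp (286 * ((R + r) / (R - r)))"
proof -
  define p where "p = g 0"
  obtain n where n: "0 < n" "(deriv ^^ n) \<alpha> p \<noteq> 0"
    using entire_nonconstant_deriv[OF hola nc] .
  \<comment> \<open>Cauchy's inequality on the circle of radius \<open>\<rho> / 2\<close> about
    \<open>p\<close> gives \<open>\<rho> ^ n \<le> D * B\<close>, so the distance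
    \<open>\<rho>\<close> from \<open>p\<close> to the complement of \<open>\<Omega>\<close> is at
    most linear in \<open>B\<close>.\<close>
  define D where "D = fact n * 2 ^ n / norm ((deriv ^^ n) \<alpha> p)"
  have D: "D > 0" using n by (simp add: D_def)
  define C where "C = 1 + norm p + 10 * (1 + D)"
  have "norm (g z) \<le> C * B * exp (286 * ((R + r) / (R - r)))"
    if B: "1 \<le> B" and r: "0 < r" "r < R" and bd: "\<And>w. w \<in> ball 0 R \<Longrightarrow> norm (\<alpha> (g w)) < B"
      and z: "norm z \<le> r" for B r R z
  proof -
    define U where "U = {w. norm (\<alpha> w) < B}"
    define \<Omega> where "\<Omega> = connected_component_set U p"
    have O: "open \<Omega>" "simply_connected \<Omega>"
      using simply_connected_sublevel_component[OF hola] by (auto simp: \<Omega>_def U_def)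
    have "\<Omega> \<subseteq> U" by (simp add: \<Omega>_def connected_component_subset)
    have gO: "g w \<in> \<Omega>" if "w \<in> ball 0 R" for w
    proof -
      have "connected (g ` ball 0 R)"
        by (intro connected_continuous_image holomorphic_on_imp_continuous_on)
          (auto intro: holomorphic_on_subset[OF holg])
      moreover have "g ` ball 0 R \<subseteq> U" using bd by (auto simp: U_def)
      moreover have "p \<in> g ` ball 0 R" using r by (auto simp: p_def)
      ultimately show ?thesis using that
        unfolding \<Omega>_def mem_Collect_eq connected_component_def by blast
    qed
    have pO: "p \<in> \<Omega>" using gO[of 0] r by (simp add: p_def)
    have "\<Omega> \<noteq> UNIV"
    proof
      assume "\<Omega> = UNIV"
      then have "bounded (range \<alpha>)" using \<open>\<Omega> \<subseteq> U\<close>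
        by (intro boundedI[of _ B]) (auto simp: U_def less_imp_le)
      then have "\<alpha> constant_on UNIV" using Liouville_theorem[OF hola] by (auto simp: constant_on_def)
      then show False using nc by simp
    qed
    then obtain w1 where w1: "w1 \<in> - \<Omega>" "\<And>y. y \<in> - \<Omega> \<Longrightarrow> dist p w1 \<le> dist p y"
      using distance_attains_inf[of "- \<Omega>" p] O(1) by (metis double_complement Compl_empty_eq closed_Compl)
    define \<rho> where "\<rho> = dist p w1"
    have \<rho>: "0 < \<rho>" using w1(1) pO by (auto simp: \<rho>_def)
    have bO: "ball p \<rho> \<subseteq> \<Omega>" using w1(2) by (force simp: \<rho>_def)
    have \<rho>D: "\<rho> \<le> (1 + D) * B"
    proof -
      have "norm ((deriv ^^ n) \<alpha> p) \<le> fact n * B / (\<rho> / 2) ^ n"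
      proof (rule Cauchy_inequality)
        show "norm (\<alpha> x) \<le> B" if "norm (p - x) = \<rho> / 2" for x
        proof -
          have "x \<in> ball p \<rho>" using that \<rho> by (simp add: dist_norm)
          then show ?thesis using bO \<open>\<Omega> \<subseteq> U\<close> by (force simp: U_def)
        qed
      qed (use \<rho> hola in \<open>auto intro: holomorphic_on_subset holomorphic_on_imp_continuous_on\<close>)
      then have "\<rho> ^ n \<le> D * B" using \<rho> n by (simp add: D_def field_simps)
      show ?thesis
      proof (cases "\<rho> \<le> 1")
        case True
        have "1 * 1 \<le> (1 + D) * B" using D B by (intro mult_mono) auto
        with True show ?thesis by linarith
      next
        case False
        have "\<rho> ^ 1 \<le> \<rho> ^ n" using False n by (intro power_increasing) auto
        then have "\<rho> \<le> D * B" using \<open>\<rho> ^ n \<le> D * B\<close> by simp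
        then show ?thesis using B by (simp add: algebra_simps)
      qed
    qed
    have "\<exists>s. s holomorphic_on \<Omega> \<and> (\<forall>z \<in> \<Omega>. z - w1 = (s z)\<^sup>2)"
    proof -
      have "(\<lambda>z. z - w1) holomorphic_on \<Omega>" by (intro holomorphic_intros)
      moreover have "\<forall>z\<in>\<Omega>. z - w1 \<noteq> 0" using w1(1) by auto
      ultimately show ?thesis using O simply_connected_eq_holomorphic_sqrt[OF O(1)] by blast
    qed
    then obtain s where s: "s holomorphic_on \<Omega>" "\<And>z. z \<in> \<Omega> \<Longrightarrow> (s z)\<^sup>2 = z - w1"
      by metis
    have ns: "norm (s w) = sqrt (norm (w - w1))" if "w \<in> \<Omega>" for w
      using s(2)[OF that] by (metis norm_power norm_ge_zero real_sqrt_abs2 real_sqrt_pow2_iff abs_of_nonneg power2_eq_square real_sqrt_unique)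
    have nsp: "norm (s p) = sqrt \<rho>" using ns[OF pO] by (simp add: \<rho>_def dist_norm)
    have ds: "deriv s p = 1 / (2 * s p)"
    proof -
      have fd: "(s has_field_derivative deriv s p) (at p)"
        using holomorphic_derivI[OF s(1) O(1) pO] .
      have "((\<lambda>w. (s w)\<^sup>2) has_field_derivative 2 * s p * deriv s p) (at p)"
        by (rule derivative_eq_intros fd refl | simp)+
      moreover have "((\<lambda>w. (s w)\<^sup>2) has_field_derivative 1) (at p)"
      proof (rule has_field_derivative_transform_within_open[OF _ O(1) pO])
        show "((\<lambda>w. w - w1) has_field_derivative 1) (at p)"
          by (auto intro!: derivative_eq_intros)
      qed (use s(2) in auto)
      ultimately have "2 * s p * deriv s p = 1" by (rule DERIV_unique)
      moreover have "s p \<noteq> 0" using nsp \<rho> by auto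
      ultimately show ?thesis by (simp add: field_simps)
    qed
    \<comment> \<open>Bloch's theorem provides the radius
      \<open>\<rho> * norm (deriv s p) / 12\<close>, and \<open>norm (deriv s p)\<close> is
      \<open>1 / (2 * sqrt \<rho>)\<close>.\<close>
    define r' where "r' = sqrt \<rho> / 24"
    have r': "r' > 0" using \<rho> by (simp add: r'_def)
    obtain b where b: "ball b r' \<subseteq> s ` ball p \<rho>"
    proof (rule Bloch)
      show "s holomorphic_on ball p \<rho>" using s(1) bO by (rule holomorphic_on_subset)
      show "0 < \<rho>" by fact
      show "r' \<le> \<rho> * norm (deriv s p) / 12"
        using \<rho> nsp real_div_sqrt[of \<rho>] by (simp add: ds norm_divide norm_mult r'_def field_simps)
    qed
    have nb: "norm b \<le> 2 * sqrt \<rho>"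
    proof -
      obtain w where w: "w \<in> ball p \<rho>" "b = s w" using b r' by (metis centre_in_ball image_iff subsetD)
      have "norm (w - w1) \<le> dist p w + dist p w1" 
        using dist_triangle3[of w w1 p] by (simp add: dist_norm)
      also have "\<dots> \<le> 4 * \<rho>" using w(1) \<rho> unfolding \<rho>_def mem_ball by linarith
      finally have "sqrt (norm (w - w1)) \<le> sqrt (4 * \<rho>)" by (rule real_sqrt_le_mono)
      also have "\<dots> = 2 * sqrt \<rho>" by (simp add: real_sqrt_mult)
      finally show ?thesis using ns[of w] w bO by auto
    qed
    \<comment> \<open>If \<open>s y = - s w\<close>, squaring gives \<open>y = w\<close>, hence
      \<open>s w = 0\<close> and \<open>w = w1\<close>, a point outside \<open>\<Omega>\<close>. So
      \<open>s\<close> never takes opposite values and avoids the negative of Bloch's disc.\<close>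
    have omit: "r' \<le> norm (s w + b)" if "w \<in> \<Omega>" for w
    proof (rule ccontr)
      assume "\<not> r' \<le> norm (s w + b)"
      then have "- s w \<in> ball b r'" by (simp add: dist_norm norm_minus_commute add.commute)
      then obtain y where y: "y \<in> \<Omega>" "- s w = s y" using b bO by blast
      have "y - w1 = w - w1" using s(2)[OF y(1)] s(2)[OF that] y(2) by (metis power2_minus)
      then have "s w = 0" using y(2) by simp
      then have "w = w1" using s(2)[OF that] by simp
      then show False using that w1(1) by simp
    qed
    \<comment> \<open>\<open>q\<close> is zero-free with modulus at most 1. Harnack bounds it from
      below, that is, \<open>s \<circ> g\<close> from above.\<close>
    define q where "q = (\<lambda>z. of_real r' / (s (g z) + b))"
    have nz: "s (g w) + b \<noteq> 0" if "w \<in> ball 0 R" for w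
      using omit[OF gO[OF that]] r' by auto
    have holq: "q holomorphic_on ball 0 R"
      unfolding q_def using nz
      by (intro holomorphic_intros holomorphic_on_compose_gen[OF _ s(1), unfolded o_def]
           holomorphic_on_subset[OF holg]) (use gO in auto)
    define K where "K = (R + r) / (R - r)"
    have K: "1 \<le> K" using r by (simp add: K_def field_simps)
    have "ln (2 / norm (q z)) \<le> K * ln (2 / norm (q 0))"
      unfolding K_def
    proof (rule harnack_nonvanishing[OF holq _ _ z r(2)])
      show "q w \<noteq> 0" if "w \<in> ball 0 R" for w using nz[OF that] r' by (simp add: q_def)
      show "norm (q w) < 2" if "w \<in> ball 0 R" for w
      proof -
        have "norm (q w) \<le> 1" 
          using omit[OF gO[OF that]] r' nz[OF that] by (simp add: q_def norm_divide)
        then show ?thesis by simp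
      qed
    qed
    also have "\<dots> \<le> K * 143"
    proof (rule mult_left_mono)
      \<comment> \<open>Origin of 286: \<open>3 * sqrt \<rho>\<close> is \<open>72 * r'\<close>, so
        \<open>2 / norm (q 0)\<close> is at most 144, and \<open>ln x \<le> x - 1\<close> leaves
        143. Squaring \<open>s\<close> at the end doubles it.\<close>
      have "norm (s p + b) \<le> 3 * sqrt \<rho>" using norm_triangle_ineq[of "s p" b] nb nsp by simp
      then have "norm (s p + b) \<le> 72 * r'" by (simp add: r'_def)
      then have "2 / norm (q 0) \<le> 144"
        using r' by (simp add: q_def p_def[symmetric] norm_divide field_simps)
      moreover have "0 < 2 / norm (q 0)" using nz[of 0] r r' by (simp add: q_def)
      ultimately show "ln (2 / norm (q 0)) \<le> 143" using ln_le_minus_one[of "2 / norm (q 0)"] by linarith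
    qed (use K in simp)
    finally have lnq: "ln (2 / norm (q z)) \<le> 143 * K" by simp
    have zb: "z \<in> ball 0 R" using z r by simp
    have "0 < 2 / norm (q z)" using nz[OF zb] r' by (simp add: q_def)
    then have "2 / norm (q z) \<le> exp (143 * K)" using lnq by (metis exp_le_cancel_iff exp_ln)
    then have "norm (s (g z) + b) \<le> exp (143 * K) * r' / 2"
      using r' by (simp add: q_def norm_divide field_simps)
    also have "\<dots> \<le> exp (143 * K) * sqrt \<rho>" using \<rho> by (simp add: r'_def)
    finally have "norm (s (g z)) \<le> exp (143 * K) * sqrt \<rho> + 2 * sqrt \<rho>"
      using nb norm_triangle_ineq4[of "s (g z) + b" b] by simp
    also have "\<dots> \<le> 3 * exp (143 * K) * sqrt \<rho>"
    proof -
      have "2 * 1 \<le> 2 * exp (143 * K)" using K by (intro mult_left_mono) auto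
      then have "2 * sqrt \<rho> \<le> 2 * exp (143 * K) * sqrt \<rho>" using \<rho> by (intro mult_right_mono) auto
      then show ?thesis by (simp add: mult_ac)
    qed
    finally have "(norm (s (g z)))\<^sup>2 \<le> (3 * exp (143 * K) * sqrt \<rho>)\<^sup>2" by (intro power_mono) auto
    also have "\<dots> = 9 * exp (286 * K) * \<rho>" 
      using \<rho> by (simp add: power_mult_distrib exp_double[symmetric])
    finally have "norm (g z - w1) \<le> 9 * exp (286 * K) * \<rho>"
      using s(2)[OF gO[OF zb]] by (metis norm_power)
    moreover have "norm w1 \<le> norm p + \<rho>"
      using norm_triangle_ineq2[of w1 p] by (simp add: \<rho>_def dist_norm norm_minus_commute)
    ultimately have "norm (g z) \<le> 9 * exp (286 * K) * \<rho> + (norm p + \<rho>) * 1"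
      using norm_triangle_ineq[of "g z - w1" w1] by simp
    also have "\<dots> \<le> 9 * exp (286 * K) * \<rho> + (norm p + \<rho>) * exp (286 * K)"
      using \<rho> K by (intro add_left_mono mult_left_mono) auto
    also have "\<dots> = (norm p * 1 + 10 * \<rho>) * exp (286 * K)" by (simp add: algebra_simps)
    also have "\<dots> \<le> (norm p * B + 10 * ((1 + D) * B)) * exp (286 * K)"
      using B \<rho>D by (intro mult_right_mono add_mono mult_left_mono) auto
    also have "\<dots> \<le> C * B * exp (286 * K)"
      using B by (intro mult_right_mono) (auto simp: C_def algebra_simps)
    finally show ?thesis by (simp add: K_def)
  qed
  moreover have "C \<ge> 1" using D by (simp add: C_def)
  ultimately show ?thesis using that by blast
qed

text \<open>If the bound failed at a large \<open>r\<close>, the inequality read from right to left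
  would force \<open>B\<close> to grow by factors of 16 along radii that stay below
  \<open>r + 1\<close>, so \<open>B (r + 1)\<close> would exceed every real number.\<close>

lemma polynomial_growth_of_log_inequality:
  fixes B :: "real \<Rightarrow> real"
  assumes mono: "mono B" and B1: "\<And>r. 1 \<le> B r" and C: "1 \<le> C"
    and ineq: "\<And>r \<delta>. \<lbrakk>1 \<le> r; 0 < \<delta>; \<delta> \<le> 1\<rbrakk> \<Longrightarrow> B r \<le> C * (r / \<delta>) ^ 3 * (1 + ln (B (r + \<delta>)))"
  obtains r0 where "\<And>r. r0 \<le> r \<Longrightarrow> B r \<le> 64 * C * r ^ 4"
proof -
  \<comment> \<open>1024 is 16 * 64: for \<open>r \<le> l\<close> this makes
    \<open>exp (l - 1)\<close> dominate \<open>16 * B r\<close>.\<close>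
  have "eventually (\<lambda>l::real. 1024 * C * l ^ 4 \<le> exp (l - 1) \<and> 3 \<le> l) at_top"
    using C by (intro eventually_conj; real_asymp)
  then obtain l0 where l0: "\<And>l. l0 \<le> l \<Longrightarrow> 1024 * C * l ^ 4 \<le> exp (l - 1)" "\<And>l. l0 \<le> l \<Longrightarrow> 3 \<le> l"
    by (auto simp: eventually_at_top_linorder)
  have "B r \<le> 64 * C * r ^ 4" if r: "l0 \<le> r" for r
  proof (rule ccontr)
    assume neg: "\<not> B r \<le> 64 * C * r ^ 4"
    have r3: "3 \<le> r" using l0(2)[OF r] .
    \<comment> \<open>\<open>B r\<close> in units of \<open>64 * C * r ^ 3\<close>, the factor that
      the hypothesis produces along the radii below; the negated claim becomes
      \<open>r \<le> l\<close>.\<close>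
    define l where "l = B r / (64 * C * r ^ 3)"
    have Br: "B r = 64 * C * r ^ 3 * l" using C r3 by (simp add: l_def)
    have lr: "r \<le> l" using neg C r3 by (simp add: l_def field_simps power_numeral_reduce)
    have l3: "3 \<le> l" using lr r3 by simp
    have e: "1024 * C * l ^ 4 \<le> exp (l - 1)" using l0(1) r lr by simp
    \<comment> \<open>The steps \<open>d n\<close> halve, so the cube in the hypothesis costs only
      \<open>8 ^ n\<close>, which the inductive growth \<open>16 ^ n\<close> beats by
      \<open>2 ^ n\<close>.\<close>
    define R where "R = (\<lambda>n::nat. r + (1 - 1 / 2 ^ n))"
    define d where "d = (\<lambda>n::nat. 1 / 2 ^ Suc n :: real)"
    have R: "r \<le> R n" "R n \<le> r + 1" "R n \<le> 2 * r" "R (Suc n) = R n + d n" for n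
    proof -
      have "1 - 1 / 2 ^ n \<le> (1::real)" by simp
      then show "R n \<le> 2 * r" using r3 unfolding R_def by linarith
    qed (use r3 in \<open>auto simp: R_def d_def field_simps\<close>)
    have grow: "16 ^ n * B r \<le> B (R n)" for n
    proof (induction n)
      case 0
      then show ?case by (simp add: R_def)
    next
      case (Suc n)
      have d: "0 < d n" "d n \<le> 1" 
        using one_le_power[of "2::real" "Suc n"] by (auto simp: d_def divide_le_eq)
      have "16 ^ n * B r \<le> C * (R n / d n) ^ 3 * (1 + ln (B (R (Suc n))))"
        using Suc ineq[of "R n" "d n"] R(1,4)[of n] r3 d by simp
      also have "\<dots> \<le> C * (2 * r / d n) ^ 3 * (1 + ln (B (R (Suc n))))"
        using C R(1,3)[of n] d r3 ln_ge_zero[OF B1]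
        by (intro mult_right_mono mult_left_mono power_mono divide_right_mono) auto
      also have "\<dots> = 64 * C * r ^ 3 * 8 ^ n * (1 + ln (B (R (Suc n))))"
        by (simp add: d_def power_mult_distrib power3_eq_cube flip: power_mult_distrib)
      finally have "(64 * C * r ^ 3) * (16 ^ n * l) \<le> (64 * C * r ^ 3) * (8 ^ n * (1 + ln (B (R (Suc n)))))"
        by (simp add: Br algebra_simps)
      then have "16 ^ n * l \<le> 8 ^ n * (1 + ln (B (R (Suc n))))"
        using C r3 by (subst (asm) mult_le_cancel_left_pos) auto
      moreover have "(16::real) ^ n = 8 ^ n * 2 ^ n" by (simp flip: power_mult_distrib)
      ultimately have "2 ^ n * l \<le> 1 + ln (B (R (Suc n)))" by (simp add: mult.assoc)
      moreover have "(1 + real n) * l \<le> 2 ^ n * l"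
        using l3 Bernoulli_inequality[of 1 n] by (intro mult_right_mono) auto
      moreover have "real n * 3 \<le> real n * l" using l3 by (intro mult_left_mono) auto
      ultimately have "(l - 1) + real n * 3 \<le> ln (B (R (Suc n)))" by (simp add: algebra_simps)
      then have "exp ((l - 1) + real n * 3) \<le> B (R (Suc n))"
        using B1[of "R (Suc n)"] by (metis exp_le_cancel_iff exp_ln less_le_trans zero_less_one)
      moreover have "exp (l - 1) * 16 ^ n \<le> exp ((l - 1) + real n * 3)"
      proof -
        have "(2::real) \<le> exp (3/4)"
          using exp_lower_Taylor_quadratic[of "3/4"] by (simp add: power2_eq_square)
        then have "(2::real) ^ 4 \<le> exp (3/4) ^ 4" by (intro power_mono) auto
        then have "(16::real) \<le> exp 3" by (simp flip: exp_of_nat_mult)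
        then have "(16::real) ^ n \<le> exp 3 ^ n" by (intro power_mono) auto
        then show ?thesis by (simp add: exp_add exp_of_nat_mult[symmetric])
      qed
      moreover have "16 ^ Suc n * B r \<le> exp (l - 1) * 16 ^ n"
      proof -
        have "16 * B r \<le> 1024 * C * (l ^ 3 * l)"
          unfolding Br using C r3 lr by (auto intro!: mult_mono power_mono)
        also have "\<dots> \<le> exp (l - 1)" using e by (simp add: power_numeral_reduce mult.assoc)
        finally show ?thesis by simp
      qed
      ultimately show ?case by linarith
    qed
    have "16 ^ n \<le> B (r + 1)" for n
    proof -
      have "16 ^ n * 1 \<le> 16 ^ n * B r" using B1 by (intro mult_left_mono) auto
      also have "\<dots> \<le> B (r + 1)" using grow[of n] monoD[OF mono R(2)[of n]] by linarith
      finally show ?thesis by simp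
    qed
    moreover obtain n where "B (r + 1) < 16 ^ n" using real_arch_pow[of 16 "B (r + 1)"] by auto
    ultimately show False by (meson not_le)
  qed
  then show ?thesis by (rule that)
qed

section \<open>Borel's trick for an exponential equation\<close>

lemma norm_sin_cos_le:
  fixes z :: complex
  shows "norm (sin z) \<le> exp (norm z)" "norm (cos z) \<le> exp (norm z)"
proof -
  have *: "norm (exp (\<i> * z)) \<le> exp (norm z)" "norm (exp (- (\<i> * z))) \<le> exp (norm z)"
    using norm_exp[of "\<i> * z"] norm_exp[of "- (\<i> * z)"] by (simp_all add: norm_mult)
  have "norm (exp (\<i> * z) - exp (- (\<i> * z))) \<le> 2 * exp (norm z)"
    using norm_triangle_ineq4[of "exp (\<i> * z)" "exp (- (\<i> * z))"] * by linarith
  then show "norm (sin z) \<le> exp (norm z)" by (simp add: sin_exp_eq norm_divide norm_mult)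
  have "norm (exp (\<i> * z) + exp (- (\<i> * z))) \<le> 2 * exp (norm z)"
    using norm_triangle_ineq[of "exp (\<i> * z)" "exp (- (\<i> * z))"] * by linarith
  then show "norm (cos z) \<le> exp (norm z)" by (simp add: cos_exp_eq norm_divide)
qed

lemma norm_deriv_le:
  fixes f :: "complex \<Rightarrow> complex"
  assumes "f holomorphic_on UNIV" "0 < \<eta>" "\<And>w. w \<in> cball 0 (s + \<eta>) \<Longrightarrow> norm (f w) \<le> M"
    and "z \<in> cball 0 s"
  shows "norm (deriv f z) \<le> M / \<eta>"
proof -
  have "norm (f x) \<le> M" if "norm (z - x) = \<eta>" for x
  proof -
    have "norm x \<le> norm z + norm (z - x)" by (metis norm_minus_commute norm_triangle_sub)
    then show ?thesis using assms that by simp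
  qed
  then have "norm ((deriv ^^ 1) f z) \<le> fact 1 * M / \<eta> ^ 1"
    using assms by (intro Cauchy_inequality)
      (auto intro: holomorphic_on_subset holomorphic_on_imp_continuous_on)
  then show ?thesis by simp
qed

text \<open>Borel's trick: with \<open>E = k * exp A\<close> and \<open>E2 = - E (- z)\<close> the Wronskian of \<open>E\<close> and \<open>E2\<close> equals that of
  \<open>E\<close> and \<open>E + E2 = b * sin\<close>. Cancelling \<open>exp A\<close> leaves \<open>exp (A (- z)) * S2 = S1\<close> with \<open>S1\<close>, \<open>S2\<close>
  differential polynomials in \<open>k\<close>, \<open>A\<close> and \<open>sin\<close>.\<close>

lemma polynomial_of_exponential_equation:
  fixes g \<alpha> :: "complex \<Rightarrow> complex" and w0 b :: complex and \<kappa> :: nat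
  assumes holg: "g holomorphic_on UNIV" and hola: "\<alpha> holomorphic_on UNIV"
    and nc: "\<not> \<alpha> constant_on UNIV"
  defines "A \<equiv> \<lambda>z. \<alpha> (g z)" and "k \<equiv> \<lambda>z. (g z - w0) ^ \<kappa> * deriv g z"
  assumes b: "b \<noteq> 0" and eq: "\<And>z. k z * exp (A z) - k (- z) * exp (A (- z)) = b * sin z"
    and notsin: "\<not> (\<exists>c. \<forall>z. k z * exp (A z) = c * sin z)"
  obtains p where "\<And>z. \<alpha> (g z) = poly p z"
proof -
  have holA: "A holomorphic_on UNIV"
    unfolding A_def using holomorphic_on_compose_gen[OF holg hola] by (simp add: o_def)
  have holk: "k holomorphic_on UNIV"
    unfolding k_def by (intro holomorphic_intros holg holomorphic_deriv) auto
  define k2 where "k2 = (\<lambda>z. - k (- z))"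
  define A2 where "A2 = (\<lambda>z. A (- z))"
  have minus: "(\<lambda>z. f (- z)) holomorphic_on UNIV" if "f holomorphic_on UNIV" for f :: "complex \<Rightarrow> complex"
    using holomorphic_on_compose_gen[OF _ that, of uminus UNIV] by (simp add: o_def holomorphic_intros)
  have holA2: "A2 holomorphic_on UNIV" unfolding A2_def by (rule minus[OF holA])
  have holk2: "k2 holomorphic_on UNIV" unfolding k2_def by (intro holomorphic_intros minus[OF holk])
  have hold: "deriv f holomorphic_on UNIV" if "f holomorphic_on UNIV" for f :: "complex \<Rightarrow> complex"
    using that by (intro holomorphic_deriv) auto
  have D: "(f has_field_derivative deriv f z) (at z)" if "f holomorphic_on UNIV" for f :: "complex \<Rightarrow> complex" and z
    using that by (intro holomorphic_derivI) auto
  define E where "E = (\<lambda>z. k z * exp (A z))"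
  define E' where "E' = (\<lambda>z. (deriv k z + deriv A z * k z) * exp (A z))"
  have dE: "(E has_field_derivative E' z) (at z)" for z
    unfolding E_def E'_def
    by (rule derivative_eq_intros D[OF holk] D[OF holA] refl | simp add: algebra_simps)+
  define E2 where "E2 = (\<lambda>z. k2 z * exp (A2 z))"
  define E2' where "E2' = (\<lambda>z. (deriv k2 z + deriv A2 z * k2 z) * exp (A2 z))"
  have dE2: "(E2 has_field_derivative E2' z) (at z)" for z
    unfolding E2_def E2'_def
    by (rule derivative_eq_intros D[OF holk2] D[OF holA2] refl | simp add: algebra_simps)+
  have sum: "E z + E2 z = b * sin z" for z
    using eq[of z] by (simp add: E_def E2_def k2_def A2_def)
  have sum': "E' z + E2' z = b * cos z" for z
  proof -
    have "((\<lambda>z. E z + E2 z) has_field_derivative E' z + E2' z) (at z)"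
      by (intro DERIV_add dE dE2)
    moreover have "((\<lambda>z. E z + E2 z) has_field_derivative b * cos z) (at z)"
      unfolding sum by (auto intro!: derivative_eq_intros)
    ultimately show ?thesis by (rule DERIV_unique)
  qed
  define S1 where "S1 = (\<lambda>z. k z * (b * cos z) - (deriv k z + deriv A z * k z) * (b * sin z))"
  define S2 where "S2 = (\<lambda>z. k z * (deriv k2 z + deriv A2 z * k2 z) - (deriv k z + deriv A z * k z) * k2 z)"
  have W1: "E z * (b * cos z) - E' z * (b * sin z) = exp (A z) * S1 z" for z
    by (simp add: E_def E'_def S1_def algebra_simps)
  have W2: "E z * (b * cos z) - E' z * (b * sin z) = exp (A z) * (exp (A2 z) * S2 z)" for z
    unfolding sum[symmetric] sum'[symmetric]
    by (simp add: E_def E'_def E2_def E2'_def S2_def algebra_simps)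
  have rel: "exp (A2 z) * S2 z = S1 z" for z using W1[of z] W2[of z] by simp
  have holS1: "S1 holomorphic_on UNIV"
    unfolding S1_def by (intro holomorphic_intros hold holk holA)
  have holS2: "S2 holomorphic_on UNIV"
    unfolding S2_def by (intro holomorphic_intros hold holk holA holk2 holA2)
  \<comment> \<open>Otherwise the Wronskian of \<open>E\<close> and \<open>sin\<close> would vanish
    identically and \<open>E\<close> would be a multiple of \<open>sin\<close>, which
    \<open>notsin\<close> forbids.\<close>
  have "\<exists>\<beta>. S2 \<beta> \<noteq> 0"
  proof (rule ccontr)
    assume "\<not> (\<exists>\<beta>. S2 \<beta> \<noteq> 0)"
    then have W0: "b * (E z * cos z - E' z * sin z) = 0" for z using W2[of z] by (simp add: algebra_simps)
    have holE: "E holomorphic_on UNIV" unfolding E_def by (intro holomorphic_intros holk holA)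
    have "\<exists>c. \<forall>z. E z = c * sin z"
    proof -
      \<comment> \<open>A disc free of zeros of \<open>sin\<close>, where \<open>E / sin\<close> can
        be differentiated; the identity theorem then spreads the relation to the plane.\<close>
      define U where "U = ball (of_real (pi / 2) :: complex) 1"
      have sn: "sin z \<noteq> 0" if "z \<in> U" for z
      proof
        assume "sin z = 0"
        then obtain n :: int where n: "z = of_real (of_int n * pi)" by (auto simp: sin_eq_0)
        have "dist (of_real (pi / 2) :: complex) z = \<bar>pi / 2 - of_int n * pi\<bar>"
          unfolding n dist_norm of_real_diff[symmetric] norm_of_real ..
        also have "pi / 2 - of_int n * pi = pi / 2 * (1 - 2 * of_int n)" by (simp add: algebra_simps)
        also have "\<bar>\<dots>\<bar> = pi / 2 * \<bar>of_int (1 - 2 * n)\<bar>" by (simp add: abs_mult)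
        finally have "pi / 2 * of_int \<bar>1 - 2 * n\<bar> < 1" using that by (simp add: U_def)
        moreover have "1 \<le> \<bar>1 - 2 * n\<bar>" by presburger
        then have "pi / 2 * 1 \<le> pi / 2 * of_int \<bar>1 - 2 * n\<bar>" by (intro mult_left_mono) auto
        ultimately show False using pi_gt3 by linarith
      qed
      have "((\<lambda>z. E z / sin z) has_field_derivative 0) (at z within U)" if "z \<in> U" for z
      proof -
        have "((\<lambda>z. E z / sin z) has_field_derivative (E' z * sin z - E z * cos z) / (sin z * sin z)) (at z)"
          by (rule derivative_eq_intros dE refl sn[OF that] | simp)+
        moreover have "E' z * sin z - E z * cos z = 0" using W0[of z] b by simp
        ultimately show ?thesis by (simp add: has_field_derivative_at_within)
      qed
      then obtain c where c: "\<And>z. z \<in> U \<Longrightarrow> E z / sin z = c"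
        using has_field_derivative_zero_constant[of U "\<lambda>z. E z / sin z"] by (auto simp: U_def)
      have "E z - c * sin z = 0" for z
      proof (rule analytic_continuation_open[of U UNIV "\<lambda>z. E z - c * sin z" "\<lambda>_. 0"])
        show "(\<lambda>z. E z - c * sin z) holomorphic_on UNIV" by (intro holomorphic_intros holE)
        show "E z - c * sin z = 0" if "z \<in> U" for z using c[OF that] sn[OF that] by (simp add: field_simps)
      qed (auto simp: U_def)
      then show ?thesis by auto
    qed
    then show False using notsin by (simp add: E_def)
  qed
  then obtain \<beta> where "S2 \<beta> \<noteq> 0" by blast
  \<comment> \<open>Splitting off the zero at 0 supplies the \<open>P 0 \<noteq> 0\<close> that
    \<open>Re_bound_of_quotient\<close> asks for; on circles of radius at least 1 the factor
    \<open>z ^ n\<close> only helps.\<close>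
  then obtain n P where P: "P holomorphic_on UNIV" "P 0 \<noteq> 0" "\<And>z. S2 z = z ^ n * P z"
    using entire_factor_zero[OF holS2, of \<beta> 0] by (metis diff_zero)
  obtain C where C: "C \<ge> 1"
    "\<And>B r R z. \<lbrakk>1 \<le> B; 0 < r; r < R; \<And>w. w \<in> ball 0 R \<Longrightarrow> norm (A w) < B; norm z \<le> r\<rbrakk>
      \<Longrightarrow> norm (g z) \<le> C * B * exp (286 * ((R + r) / (R - r)))"
    unfolding A_def using growth_inner_le_growth_composition[OF hola nc holg] by blast
  \<comment> \<open>These constants are read off from the estimates below: \<open>q\<close> is the
    exponent in \<open>M\<close>, and 3146 is 286 * 11, where 11 stems from
    \<open>2 * t + 9 \<le> 11 * t\<close>.\<close>
  define K0 where "K0 = C + norm b + norm w0 + 2"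
  define q where "q = real (4 * \<kappa> + 9)"
  define K2 where "K2 = 3 * norm (A 0) + 2 + 10 * (q * (ln K0 + 1 + 3146) + \<bar>ln (norm (P 0))\<bar>)"
  have K0: "2 \<le> K0" using C(1) by (simp add: K0_def)
  have K2: "0 \<le> K2" using K0 by (simp add: K2_def q_def)
  have main: "norm (A z) \<le> 125 * K2 * (r / \<delta>) ^ 3 * (1 + ln X)"
    if r: "1 \<le> r" and \<delta>: "0 < \<delta>" "\<delta> \<le> 1" and X: "1 \<le> X"
      and AX: "\<And>w. w \<in> cball 0 (r + \<delta>) \<Longrightarrow> norm (A w) < X" and z: "z \<in> cball 0 r"
    for r \<delta> X z
  proof -
    \<comment> \<open>Five shells of width \<open>\<eta>\<close>: \<open>A\<close> is controlled out
      to \<open>r + 5 * \<eta>\<close>, \<open>g\<close> to \<open>r + 4 * \<eta>\<close>,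
      \<open>k\<close> (which contains \<open>deriv g\<close>) to \<open>r + 3 * \<eta>\<close>,
      \<open>S1\<close> and \<open>S2\<close> to \<open>r + 2 * \<eta>\<close>, \<open>Re A\<close>
      to \<open>r + \<eta>\<close>, and \<open>norm A\<close> to \<open>r\<close>.\<close>
    define \<eta> where "\<eta> = \<delta> / 5"
    define t where "t = r / \<eta>"
    \<comment> \<open>A common unit: \<open>g\<close>, \<open>X\<close>, \<open>1 / \<eta>\<close>
      and the constants are at most \<open>N\<close>, everything else at most a power of
      \<open>N\<close>. Hence the final logarithm is linear in \<open>ln X\<close> and
      \<open>t\<close>.\<close>
    define N where "N = K0 * X * exp (3146 * t)"
    have \<eta>: "0 < \<eta>" "\<eta> \<le> 1/5" "5 * \<eta> = \<delta>" using \<delta> by (auto simp: \<eta>_def)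
    have t: "1 \<le> t" "r = t * \<eta>" "1 / \<eta> \<le> t" "r \<le> t"
      using \<eta> r mult_left_mono[of \<eta> 1 r] by (auto simp: t_def field_simps)
    have NI: "c * x * exp y \<le> N" if "0 \<le> c" "c \<le> K0" "0 \<le> x" "x \<le> X" "y \<le> 3146 * t" for c x y
      unfolding N_def using that X K0 by (intro mult_mono) auto
    have N: "2 \<le> N" "norm b \<le> N" "norm w0 \<le> N" "X \<le> N"
      using NI[of 2 1 0] NI[of "norm b" 1 0] NI[of "norm w0" 1 0] NI[of 1 X 0] K0 X t C(1)
      by (auto simp: K0_def)
    have N1: "1 / \<eta> \<le> N"
      using NI[of 1 1 t] K0 X t(1,3) exp_ge_add_one_self[of t] by linarith
    have gN: "norm (g w) \<le> N" if "w \<in> cball 0 (r + 4 * \<eta>)" for w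
    proof -
      have "norm (g w) \<le> C * X * exp (286 * ((r + 5 * \<eta> + (r + 4 * \<eta>)) / (r + 5 * \<eta> - (r + 4 * \<eta>))))"
        by (rule C(2)) (use X r \<eta> AX that in auto)
      also have "\<dots> \<le> N"
      proof (rule NI)
        have "(r + 5 * \<eta> + (r + 4 * \<eta>)) / (r + 5 * \<eta> - (r + 4 * \<eta>)) = 2 * t + 9"
          using \<eta>(1) by (simp add: t_def field_simps)
        then show "286 * ((r + 5 * \<eta> + (r + 4 * \<eta>)) / (r + 5 * \<eta> - (r + 4 * \<eta>))) \<le> 3146 * t"
          using t by simp
      qed (use C X in \<open>auto simp: K0_def\<close>)
      finally show ?thesis .
    qed
    define Z where "Z = N ^ (2 * \<kappa> + 2)"
    have Z0: "0 \<le> Z" using N by (simp add: Z_def)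
    have divN: "u / \<eta> \<le> u * N" if "0 \<le> u" for u
      using mult_left_mono[OF N1 that] by simp
    have kZ: "norm (k w) \<le> Z" if "w \<in> cball 0 (r + 3 * \<eta>)" for w
    proof -
      have "norm (deriv g w) \<le> N / \<eta>"
        by (rule norm_deriv_le[OF holg \<eta>(1) _ that]) (rule gN, simp)
      also have "\<dots> \<le> N * N" using divN N by simp
      finally have 1: "norm (deriv g w) \<le> N * N" .
      have "norm (g w - w0) \<le> norm (g w) + norm w0" by (rule norm_triangle_ineq4)
      also have "\<dots> \<le> N + N" using gN[of w] N that \<eta> by (intro add_mono) auto
      also have "\<dots> \<le> N * N" using mult_right_mono[of 2 N N] N by simp
      finally have "norm (g w - w0) ^ \<kappa> \<le> (N * N) ^ \<kappa>" by (rule power_mono) simp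
      then have "norm (k w) \<le> (N * N) ^ \<kappa> * (N * N)"
        unfolding k_def norm_mult norm_power using 1 N by (intro mult_mono) auto
      also have "\<dots> = Z" by (simp add: Z_def power_mult_distrib power_add power_mult power2_eq_square)
      finally show ?thesis .
    qed
    have k2Z: "norm (k2 w) \<le> Z" if "w \<in> cball 0 (r + 3 * \<eta>)" for w
      using kZ[of "- w"] that by (simp add: k2_def)
    have dk: "norm (deriv f w) \<le> Z * N"
      if "f holomorphic_on UNIV" "\<And>w. w \<in> cball 0 (r + 3 * \<eta>) \<Longrightarrow> norm (f w) \<le> Z" "w \<in> cball 0 (r + 2 * \<eta>)" for f w
    proof -
      have "norm (deriv f w) \<le> Z / \<eta>"
        by (rule norm_deriv_le[OF that(1) \<eta>(1) _ that(3)]) (rule that(2), simp)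
      also have "\<dots> \<le> Z * N" using divN Z0 by simp
      finally show ?thesis .
    qed
    have dA: "norm (deriv f w) \<le> N * N"
      if "f holomorphic_on UNIV" "\<And>w. w \<in> cball 0 (r + \<delta>) \<Longrightarrow> norm (f w) < X" "w \<in> cball 0 (r + 2 * \<eta>)" for f w
    proof -
      have "norm (deriv f w) \<le> X / \<eta>"
        by (rule norm_deriv_le[OF that(1) \<eta>(1) _ that(3)]) (rule less_imp_le, rule that(2), use \<eta> in simp)
      also have "\<dots> \<le> X * N" using divN X by simp
      also have "\<dots> \<le> N * N" using N by (intro mult_right_mono) auto
      finally show ?thesis .
    qed
    have sc: "norm (b * sin w) \<le> N * N" "norm (b * cos w) \<le> N * N" if "w \<in> cball 0 (r + 2 * \<eta>)" for w
    proof -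
      have "norm w \<le> 2 * t" using that t \<eta> r by simp
      then have "exp (norm w) \<le> N" using NI[of 1 1 "norm w"] K0 X t(1) by simp
      then show "norm (b * sin w) \<le> N * N" "norm (b * cos w) \<le> N * N"
        unfolding norm_mult using norm_sin_cos_le[of w] N by (auto intro!: mult_mono)
    qed
    have A2X: "norm (A2 w) < X" if "w \<in> cball 0 (r + \<delta>)" for w
      using AX[of "- w"] that by (simp add: A2_def)
    have comb: "norm (deriv u w + deriv v w * u w) \<le> Z * N * N * 2"
      if "norm (deriv u w) \<le> Z * N" "norm (deriv v w) \<le> N * N" "norm (u w) \<le> Z" for u v :: "complex \<Rightarrow> complex" and w
    proof -
      have "norm (deriv v w * u w) \<le> N * N * Z" unfolding norm_mult using that N by (intro mult_mono) auto
      moreover have "Z * N * 1 \<le> Z * N * N" using Z0 N by (intro mult_left_mono) auto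
      ultimately show ?thesis 
        using norm_triangle_ineq[of "deriv u w" "deriv v w * u w"] that(1) by (simp add: mult_ac)
    qed
    \<comment> \<open>The count for \<open>S2\<close> decides: two factors \<open>Z\<close>, two
      more powers of \<open>N\<close> from the derivatives, and \<open>N ^ 3\<close> to absorb the
      factor 4 strictly.\<close>
    define M where "M = N ^ (4 * \<kappa> + 9)"
    have S1M: "norm (S1 w) < M" and S2M: "norm (S2 w) < M" if w: "w \<in> cball 0 (r + 2 * \<eta>)" for w
    proof -
      have w3: "w \<in> cball 0 (r + 3 * \<eta>)" using w \<eta> by simp
      have c1: "norm (deriv k w + deriv A w * k w) \<le> Z * N * N * 2"
        by (intro comb dk[OF holk kZ w] dA[OF holA AX w] kZ w3)
      have c2: "norm (deriv k2 w + deriv A2 w * k2 w) \<le> Z * N * N * 2"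
        by (intro comb dk[OF holk2 k2Z w] dA[OF holA2 A2X w] k2Z w3)
      have N1': "1 \<le> N" using N by simp
      have Z1: "1 \<le> Z" unfolding Z_def using N1' by (rule one_le_power)
      have "norm (S1 w) \<le> Z * (N * N) + (Z * N * N * 2) * (N * N)"
        unfolding S1_def using norm_triangle_ineq4 kZ[OF w3] sc[OF w] c1 Z0 N
        by (intro order_trans[OF norm_triangle_ineq4] add_mono; unfold norm_mult[of "k w"] norm_mult[of "_ + _"]) 
          (auto intro!: mult_mono)
      also have "\<dots> \<le> Z * N ^ 4 + Z * N ^ 4 * 2"
      proof -
        have "1 * 1 \<le> N * N" using N1' by (intro mult_mono) auto
        then have "Z * (N * N) * 1 \<le> Z * (N * N) * (N * N)" using Z0 N by (intro mult_left_mono) auto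
        then show ?thesis by (simp add: power4_eq_xxxx mult_ac)
      qed
      also have "\<dots> = Z * N ^ 4 * 3" by simp
      also have "\<dots> < Z * N ^ 4 * N ^ 2"
      proof (rule mult_strict_left_mono)
        have "2 ^ 2 \<le> N ^ 2" using N by (intro power_mono) auto
        then show "3 < N ^ 2" by simp
      qed (use Z1 N in simp)
      also have "\<dots> = N ^ ((2 * \<kappa> + 2) + 4 + 2)" by (simp only: Z_def power_add)
      also have "\<dots> \<le> M" unfolding M_def using N1' by (intro power_increasing) auto
      finally show "norm (S1 w) < M" .
      have "norm (S2 w) \<le> Z * (Z * N * N * 2) + (Z * N * N * 2) * Z"
        unfolding S2_def using kZ[OF w3] k2Z[OF w3] c1 c2 Z0 N
        by (intro order_trans[OF norm_triangle_ineq4] add_mono; unfold norm_mult[of "k w"] norm_mult[of "_ + _"]) 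
          (auto intro!: mult_mono)
      also have "\<dots> = (Z * Z) * (N ^ 2) * 4" by (simp add: power2_eq_square)
      also have "\<dots> < (Z * Z) * (N ^ 2) * N ^ 3"
      proof (rule mult_strict_left_mono)
        have "2 ^ 3 \<le> N ^ 3" using N by (intro power_mono) auto
        then show "4 < N ^ 3" by simp
      qed (use Z1 N in simp)
      also have "\<dots> = N ^ ((2 * \<kappa> + 2) + (2 * \<kappa> + 2) + 2 + 3)" by (simp only: Z_def power_add)
      also have "\<dots> = M" unfolding M_def by (rule arg_cong[where f = "\<lambda>n. N ^ n"]) simp
      finally show "norm (S2 w) < M" .
    qed
    have N0: "0 < N" using N by simp
    have M0: "0 < M" using N0 by (simp add: M_def)
    have Re: "Re (A w) \<le> 5 * t * ln (M / norm (P 0))" if "w \<in> cball 0 (r + \<eta>)" for w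
    proof -
      \<comment> \<open>\<open>A2 (- w)\<close> is \<open>A w\<close>, so an estimate for the
        reflected function serves \<open>A\<close>. The two required bounds on the circle come from
        \<open>S2\<close> for \<open>P\<close> and from \<open>S1\<close> for
        \<open>exp A2 * P\<close>.\<close>
      have R1: "Re (A2 (- w)) \<le> (r + 2 * \<eta> + (r + \<eta>)) / (r + 2 * \<eta> - (r + \<eta>)) * ln (M / norm (P 0))"
      proof (rule Re_bound_of_quotient[OF P(1) holA2 P(2)])
        fix y :: complex assume y: "y \<in> sphere 0 (r + 2 * \<eta>)"
        have y1: "1 \<le> norm y ^ n" using y r \<eta> by (intro one_le_power) simp
        have yc: "y \<in> cball 0 (r + 2 * \<eta>)" using y by simp
        have le: "u \<le> norm y ^ n * u" if "0 \<le> u" for u using mult_right_mono[OF y1 that] by simp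
        have "norm (P y) \<le> norm (S2 y)" using le[of "norm (P y)"] by (simp add: P(3) norm_mult norm_power)
        then show "norm (P y) < M" using S2M[OF yc] by simp
        have "norm (exp (A2 y) * P y) \<le> norm (S1 y)"
          using le[of "norm (exp (A2 y) * P y)"] 
          by (simp add: P(3) norm_mult norm_power mult_ac flip: rel)
        then show "norm (exp (A2 y) * P y) < M" using S1M[OF yc] by simp
      qed (use that \<eta> in auto)
      have Keq: "(r + 2 * \<eta> + (r + \<eta>)) / (r + 2 * \<eta> - (r + \<eta>)) = 2 * t + 3"
        using \<eta>(1) by (simp add: t_def field_simps)
      have "0 \<le> ln (M / norm (P 0))"
      proof -
        have "norm (P 0) < M"
        proof (rule sphere_bound_imp_ball_bound[OF P(1), of "r + 2 * \<eta>"])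
          fix y :: complex assume y: "y \<in> sphere 0 (r + 2 * \<eta>)"
          have y1: "1 \<le> norm y ^ n" using y r \<eta> by (intro one_le_power) simp
          have "norm (P y) \<le> norm (S2 y)"
            using mult_right_mono[OF y1, of "norm (P y)"] by (simp add: P(3) norm_mult norm_power)
          then show "norm (P y) < M" using S2M[of y] y by simp
        qed (use r \<eta> in auto)
        then show ?thesis using P(2) by simp
      qed
      then have R3: "(2 * t + 3) * ln (M / norm (P 0)) \<le> 5 * t * ln (M / norm (P 0))"
        using t by (intro mult_right_mono) auto
      show ?thesis using order_trans[OF R1[unfolded Keq] R3] by (simp add: A2_def)
    qed
    define \<Lambda> where "\<Lambda> = q * (ln K0 + ln X + 3146 * t) + \<bar>ln (norm (P 0))\<bar>"
    have lnM: "ln (M / norm (P 0)) \<le> \<Lambda>"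
    proof -
      have "ln M = q * ln N" using N0 by (simp add: M_def q_def ln_realpow)
      also have "ln N = ln K0 + ln X + 3146 * t" using K0 X by (simp add: N_def ln_mult)
      finally show ?thesis using M0 P(2) by (simp add: ln_div \<Lambda>_def)
    qed
    have L: "\<Lambda> \<le> t * (1 + ln X) * (q * (ln K0 + 1 + 3146) + \<bar>ln (norm (P 0))\<bar>)"
    proof -
      have lX: "0 \<le> ln X" "0 \<le> ln K0" using X K0 by auto
      have u: "1 \<le> t * (1 + ln X)" "ln X \<le> t * (1 + ln X)" "t \<le> t * (1 + ln X)"
        using t lX mult_mono[of 1 t 1 "1 + ln X"] mult_mono[of 1 t "ln X" "1 + ln X"] mult_left_mono[of 1 "1 + ln X" t]
        by auto
      have "ln K0 + ln X + 3146 * t \<le> t * (1 + ln X) * (ln K0 + 1 + 3146)"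
        using u mult_right_mono[OF u(1) lX(2)] by (simp add: algebra_simps)
      then have "q * (ln K0 + ln X + 3146 * t) \<le> q * (t * (1 + ln X) * (ln K0 + 1 + 3146))"
        by (intro mult_left_mono) (simp_all add: q_def)
      moreover have "\<bar>ln (norm (P 0))\<bar> \<le> t * (1 + ln X) * \<bar>ln (norm (P 0))\<bar>"
        using mult_right_mono[OF u(1), of "\<bar>ln (norm (P 0))\<bar>"] by simp
      ultimately show ?thesis by (simp add: \<Lambda>_def algebra_simps)
    qed
    \<comment> \<open>Passing from \<open>Re A\<close> to \<open>norm A\<close> costs one factor
      \<open>t\<close>; the others in the cube are in \<open>5 * t\<close> and in the bound for
      \<open>\<Lambda>\<close>.\<close>
    have "norm (A z - A 0) \<le> 2 * r / (r + \<eta> - r) * (5 * t * \<Lambda> + 1 - Re (A 0))"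
    proof (rule borel_caratheodory)
      show "Re (A w) < 5 * t * \<Lambda> + 1" if "w \<in> ball 0 (r + \<eta>)" for w
      proof -
        have "Re (A w) \<le> 5 * t * ln (M / norm (P 0))" using Re[of w] that by simp
        also have "\<dots> \<le> 5 * t * \<Lambda>" using lnM t by (intro mult_left_mono) auto
        finally show ?thesis by simp
      qed
    qed (use z \<eta> holA in \<open>auto intro: holomorphic_on_subset\<close>)
    also have "\<dots> = 2 * t * (5 * t * \<Lambda> + 1 - Re (A 0))" by (simp add: t_def)
    also have "\<dots> \<le> 2 * t * (5 * t * \<Lambda> + 1 + norm (A 0))"
      using t abs_Re_le_cmod[of "A 0"] by (intro mult_left_mono) auto
    finally have "norm (A z) \<le> norm (A 0) + 2 * t * (5 * t * \<Lambda> + 1 + norm (A 0))"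
      using norm_triangle_ineq2[of "A z" "A 0"] by linarith
    also have "\<dots> = norm (A 0) * 1 + t * (2 * norm (A 0) + 2) + t * t * (10 * \<Lambda>)" by (simp add: algebra_simps)
    also have "\<dots> \<le> norm (A 0) * (t ^ 3 * (1 + ln X)) + (t ^ 3 * (1 + ln X)) * (2 * norm (A 0) + 2)
        + t * t * (10 * (t * (1 + ln X) * (q * (ln K0 + 1 + 3146) + \<bar>ln (norm (P 0))\<bar>)))"
    proof -
      have lX: "0 \<le> ln X" using X by simp
      have "t ^ 1 \<le> t ^ 3" using t by (intro power_increasing) auto
      then have "t * 1 \<le> t ^ 3 * (1 + ln X)" using t lX by (intro mult_mono) auto
      then show ?thesis using t L by (intro add_mono mult_left_mono mult_right_mono) auto
    qed
    also have "\<dots> = K2 * t ^ 3 * (1 + ln X)" by (simp add: K2_def algebra_simps power3_eq_cube)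
    also have "t ^ 3 = 125 * (r / \<delta>) ^ 3" by (simp add: t_def \<eta>_def power_divide power_mult_distrib)
    finally show ?thesis by (simp add: mult_ac)
  qed
  \<comment> \<open>\<open>max r 0\<close> makes \<open>B\<close> monotone on all reals; the summand
    2 gives the strict bound on \<open>A\<close> and keeps \<open>B\<close> above 1.\<close>
  define B where "B = (\<lambda>r. 2 + (SUP z\<in>cball 0 (max r 0). norm (A z)))"
  have bdd: "bdd_above ((\<lambda>z. norm (A z)) ` cball 0 s)" for s
    by (intro bounded_imp_bdd_above compact_imp_bounded compact_continuous_image continuous_intros)
      (auto intro: holomorphic_on_imp_continuous_on holomorphic_on_subset[OF holA])
  have le: "norm (A z) \<le> B r - 2" if "norm z \<le> r" for z r
    unfolding B_def using that by (auto intro!: cSUP_upper bdd)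
  have B2: "2 \<le> B r" for r
  proof -
    have "norm (A 0) \<le> (SUP z\<in>cball 0 (max r 0). norm (A z))" by (intro cSUP_upper bdd) auto
    then show ?thesis unfolding B_def using norm_ge_zero[of "A 0"] by linarith
  qed
  have mono: "mono B"
    unfolding B_def by (intro monoI add_left_mono cSUP_subset_mono bdd) auto
  have B_ineq: "B r \<le> (2 + 125 * K2) * (r / \<delta>) ^ 3 * (1 + ln (B (r + \<delta>)))"
    if r: "1 \<le> r" "0 < \<delta>" "\<delta> \<le> 1" for r \<delta>
  proof -
    have X: "1 \<le> B (r + \<delta>)" using B2[of "r + \<delta>"] by simp
    have "norm (A z) \<le> 125 * K2 * (r / \<delta>) ^ 3 * (1 + ln (B (r + \<delta>)))" if "z \<in> cball 0 r" for z
    proof (rule main[OF r X _ that])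
      show "norm (A w) < B (r + \<delta>)" if "w \<in> cball 0 (r + \<delta>)" for w
        using le[of w "r + \<delta>"] that by simp
    qed
    then have "(SUP z\<in>cball 0 (max r 0). norm (A z)) \<le> 125 * K2 * (r / \<delta>) ^ 3 * (1 + ln (B (r + \<delta>)))"
      using r by (intro cSUP_least) auto
    moreover have "1 * 1 \<le> (r / \<delta>) ^ 3 * (1 + ln (B (r + \<delta>)))"
      using r X by (intro mult_mono one_le_power) (auto simp: field_simps)
    ultimately show ?thesis by (simp add: B_def algebra_simps)
  qed
  have B1: "1 \<le> B r" for r using B2[of r] by simp
  have "1 \<le> 2 + 125 * K2" using K2 by simp
  then obtain r0 where r0: "\<And>r. r0 \<le> r \<Longrightarrow> B r \<le> 64 * (2 + 125 * K2) * r ^ 4"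
    using polynomial_growth_of_log_inequality[OF mono B1 _ B_ineq] by meson
  have "norm (A z) \<le> 64 * (2 + 125 * K2) * norm z ^ 4" if "r0 \<le> norm z" for z
    using r0[OF that] le[of z "norm z"] by simp
  then have A_sum: "A z = (\<Sum>j\<le>4. (deriv ^^ j) A 0 / fact j * z ^ j)" for z
    by (rule Liouville_polynomial[OF holA])
  have "\<alpha> (g z) = poly (\<Sum>j\<le>4. monom ((deriv ^^ j) A 0 / fact j) j) z" for z
  proof -
    have "\<alpha> (g z) = A z" by (simp add: A_def)
    also note A_sum
    also have "(\<Sum>j\<le>4. (deriv ^^ j) A 0 / fact j * z ^ j) = poly (\<Sum>j\<le>4. monom ((deriv ^^ j) A 0 / fact j) j) z"
      by (simp only: poly_sum poly_monom)
    finally show ?thesis .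
  qed
  then show ?thesis by (rule that)
qed

section \<open>Picard theorems and periodic functions\<close>

text \<open>Inversion moves infinity to 0, and subtracting \<open>a\<close> makes 0 one of the
  omitted values, the normalized situation of the great Picard theorem.\<close>

lemma picard_at_infinity:
  fixes f :: "complex \<Rightarrow> complex"
  assumes hol: "f holomorphic_on {z. R < norm z}" and ab: "a \<noteq> b"
    and omit: "\<And>z. R < norm z \<Longrightarrow> f z \<noteq> a \<and> f z \<noteq> b"
  shows "(\<exists>l. (f \<longlongrightarrow> l) at_infinity) \<or> filterlim f at_infinity at_infinity"
proof -
  define R' where "R' = max R 1"
  define k where "k = (\<lambda>z. f z - a)"
  have inb: "R < norm (inverse x)" if "x \<in> ball 0 (1 / R') - {0}" for x :: complex
  proof -
    have x: "norm x < 1 / R'" "0 < norm x" using that by auto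
    have "0 < R'" by (simp add: R'_def)
    then have "R' < 1 / norm x" using x by (simp add: less_divide_eq mult.commute)
    moreover have "R \<le> R'" by (simp add: R'_def)
    ultimately show ?thesis by (simp add: norm_inverse inverse_eq_divide norm_divide)
  qed
  have "k \<circ> inverse holomorphic_on ball 0 (1 / R') - {0}"
  proof (rule holomorphic_on_compose)
    show "inverse holomorphic_on ball 0 (1 / R') - {0::complex}" by (intro holomorphic_intros) auto
    show "k holomorphic_on inverse ` (ball 0 (1 / R') - {0})"
      unfolding k_def by (intro holomorphic_intros holomorphic_on_subset[OF hol]) (use inb in auto)
  qed
  then obtain l where "((k \<circ> inverse) \<longlongrightarrow> l) (at 0) \<or> ((inverse \<circ> (k \<circ> inverse)) \<longlongrightarrow> l) (at 0)"
  proof (rule great_Picard[rotated 3])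
    show "0 \<in> ball 0 (1 / R')" by (simp add: R'_def)
    show "0 \<noteq> b - a" using ab by simp
    show "(k \<circ> inverse) w \<noteq> 0 \<and> (k \<circ> inverse) w \<noteq> b - a" if "w \<in> ball 0 (1 / R') - {0}" for w
      using omit[OF inb[OF that]] by (simp add: k_def)
  qed auto
  then consider (1) "(k \<longlongrightarrow> l) at_infinity" | (2) "((inverse \<circ> k) \<longlongrightarrow> l) at_infinity"
    by (auto simp: lim_at_infinity_0 o_assoc)
  then show ?thesis
  proof cases
    case 1
    then have "((\<lambda>z. k z + a) \<longlongrightarrow> l + a) at_infinity" by (intro tendsto_intros)
    then show ?thesis by (auto simp: k_def)
  next
    case 2
    have knz: "eventually (\<lambda>z. k z \<noteq> 0) at_infinity"
      unfolding eventually_at_infinity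
    proof (intro exI[of _ "R + 1"] allI impI)
      fix x :: complex assume "R + 1 \<le> norm x"
      then show "k x \<noteq> 0" using omit[of x] by (simp add: k_def)
    qed
    show ?thesis
    proof (cases "l = 0")
      case True
      have "filterlim (\<lambda>z. inverse (k z)) (at 0) at_infinity"
        using 2 True knz by (auto simp: filterlim_at o_def elim: eventually_mono)
      then have "filterlim k at_infinity at_infinity" by (simp add: filterlim_inverse_at_iff)
      then have "filterlim (\<lambda>z. a + k z) at_infinity at_infinity"
        by (intro tendsto_add_filterlim_at_infinity[OF tendsto_const])
      then show ?thesis by (simp add: k_def)
    next
      case False
      have "((\<lambda>z. inverse (inverse (k z)) + a) \<longlongrightarrow> inverse l + a) at_infinity"
        using 2 False by (intro tendsto_intros) (auto simp: o_def)
      then show ?thesis by (auto simp: k_def)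
    qed
  qed
qed

lemma poly_sum_monom: "(\<Sum>i\<le>n. a i * z ^ i) = poly (\<Sum>i\<le>n. monom (a i) i) z"
  for z :: "'a::comm_semiring_1"
  by (simp add: poly_sum poly_monom)

lemma entire_tendsto_infinity_imp_poly:
  assumes hol: "f holomorphic_on UNIV" and lim: "filterlim f at_infinity at_infinity"
  shows "\<exists>p. \<forall>z. f z = poly p z"
proof -
  have "((inverse \<circ> f) \<longlongrightarrow> 0) at_infinity"
    unfolding o_def using filterlim_compose[OF tendsto_inverse_0 lim] .
  then obtain a n where "\<And>z. f z = (\<Sum>i\<le>n. a i * z ^ i)" using pole_at_infinity[OF hol] by metis
  then show ?thesis unfolding poly_sum_monom by blast
qed

lemma entire_polynomial_growth_imp_poly:
  assumes hol: "f holomorphic_on UNIV" and bd: "\<And>z. A \<le> norm z \<Longrightarrow> norm (f z) \<le> B * norm z ^ n"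
  shows "\<exists>p. \<forall>z. f z = poly p z"
  using Liouville_polynomial[OF hol bd] unfolding poly_sum_monom by blast

lemma entire_tendsto_imp_constant:
  assumes "f holomorphic_on UNIV" and "(f \<longlongrightarrow> l) at_infinity"
  shows "f z = (l :: complex)"
  using Liouville_weak[OF assms] .

lemma entire_two_values_finite_imp_poly:
  assumes hol: "f holomorphic_on UNIV" and "a \<noteq> b" "finite {z. f z = a}" "finite {z. f z = b}"
  shows "\<exists>p. \<forall>z. f z = poly p z"
proof -
  have "bounded ({z. f z = a} \<union> {z. f z = b})" using assms by (intro finite_imp_bounded) auto
  then obtain R where R: "\<And>z. z \<in> {z. f z = a} \<union> {z. f z = b} \<Longrightarrow> norm z \<le> R" by (meson bounded_iff)
  have "(\<exists>l. (f \<longlongrightarrow> l) at_infinity) \<or> filterlim f at_infinity at_infinity"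
  proof (rule picard_at_infinity[OF _ \<open>a \<noteq> b\<close>])
    show "f holomorphic_on {z. R < norm z}" using hol by (rule holomorphic_on_subset) auto
    show "f z \<noteq> a \<and> f z \<noteq> b" if "R < norm z" for z using R[of z] that by auto
  qed
  then show ?thesis
  proof
    assume "\<exists>l. (f \<longlongrightarrow> l) at_infinity"
    then obtain l where "(f \<longlongrightarrow> l) at_infinity" by blast
    then have "f z = poly [:l:] z" for z using entire_tendsto_imp_constant[OF hol] by simp
    then show ?thesis by blast
  qed (rule entire_tendsto_infinity_imp_poly[OF hol])
qed

section \<open>Periodic functions, orbits and \<open>sin\<close> as a coordinate\<close>

lemma periodic_int_multiple:
  fixes g :: "complex \<Rightarrow> 'a"
  assumes "\<And>z. g (z + \<tau>) = g z"
  shows "g (z + of_int n * \<tau>) = g z"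
proof (induction n rule: int_induct[where k = 0])
  case (step1 i)
  then show ?case using assms[of "z + of_int i * \<tau>"] by (simp add: algebra_simps)
next
  case (step2 i)
  then show ?case using assms[of "z + of_int (i - 1) * \<tau>"] by (simp add: algebra_simps)
qed auto

text \<open>\<open>v = exp (z / \<omega>)\<close> is a coordinate on the cylinder belonging to the
  period. Allowing complex \<open>\<omega>\<close> lets its argument decide which end of the
  cylinder goes to infinity.\<close>

lemma holomorphic_periodic_lift:
  fixes g :: "complex \<Rightarrow> complex"
  assumes hol: "g holomorphic_on UNIV" and per: "\<And>z. g (z + 2 * of_real pi * \<i> * \<omega>) = g z"
  shows "(\<lambda>v. g (\<omega> * Ln v)) holomorphic_on - {0}"
    and "\<omega> \<noteq> 0 \<Longrightarrow> g (\<omega> * Ln (exp (z / \<omega>))) = g z"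
proof -
  have eq: "g (\<omega> * x) = g (\<omega> * y)" if e: "exp x = exp y" for x y
  proof -
    obtain n :: int where "x = y + of_real (of_int (2 * n) * pi) * \<i>"
      using e unfolding exp_eq by blast
    then have n: "x = y + of_int (2 * n) * of_real pi * \<i>" by simp
    have "\<omega> * x = \<omega> * y + of_int n * (2 * of_real pi * \<i> * \<omega>)" by (simp add: n algebra_simps)
    then show ?thesis using periodic_int_multiple[of g, OF per] by metis
  qed
  show "(\<lambda>v. g (\<omega> * Ln v)) holomorphic_on - {0}"
  proof (rule analytic_imp_holomorphic, unfold analytic_on_def, intro ballI)
    fix v0 :: complex assume v0: "v0 \<in> - {0}"
    \<comment> \<open>A branch of the logarithm without a cut near \<open>v0\<close>; it differs
      from \<open>Ln v\<close> by a multiple of \<open>2 * pi * \<i>\<close>, which the periodicity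
      of \<open>g\<close> hides.\<close>
    have "(\<lambda>v. g (\<omega> * (Ln (v / v0) + Ln v0))) holomorphic_on ball v0 (norm v0)"
    proof -
      have "v / v0 \<notin> \<real>\<^sub>\<le>\<^sub>0" if "v \<in> ball v0 (norm v0)" for v
      proof -
        have "norm (v0 * (1 - v / v0)) < norm v0" using that v0 by (simp add: dist_norm algebra_simps)
        then have "norm (1 - v / v0) < 1" using v0 by (simp add: norm_mult)
        then have "0 < Re (v / v0)"
          using abs_Re_le_cmod[of "1 - v / v0"] by simp
        then show ?thesis using complex_nonpos_Reals_iff by fastforce
      qed
      then show ?thesis
        using v0 by (intro holomorphic_on_compose_gen[OF _ hol, unfolded o_def] holomorphic_intros) auto
    qed
    then have "(\<lambda>v. g (\<omega> * Ln v)) holomorphic_on ball v0 (norm v0)"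
    proof (rule holomorphic_transform)
      fix v assume "v \<in> ball v0 (norm v0)"
      then have "v \<noteq> 0" by auto
      then show "g (\<omega> * (Ln (v / v0) + Ln v0)) = g (\<omega> * Ln v)"
        using v0 by (intro eq) (simp add: exp_add)
    qed
    then show "\<exists>\<epsilon>>0. (\<lambda>v. g (\<omega> * Ln v)) holomorphic_on ball v0 \<epsilon>"
      using v0 by (intro exI[of _ "norm v0"]) auto
  qed
  show "g (\<omega> * Ln (exp (z / \<omega>))) = g z" if "\<omega> \<noteq> 0"
    using eq[of "Ln (exp (z / \<omega>))" "z / \<omega>"] that by simp
qed

lemma sin_cos_eq_imp_orbit:
  fixes z w :: complex
  assumes "sin z = sin w" "cos z = cos w"
  obtains n :: int where "z = w + 2 * of_real pi * of_int n"
proof -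
  have "exp (\<i> * z) = exp (\<i> * w)" using assms by (simp add: exp_Euler)
  then obtain n :: int where "\<i> * z = \<i> * w + of_real (of_int (2 * n) * pi) * \<i>" 
    unfolding exp_eq by blast
  then have "\<i> * z = \<i> * (w + 2 * of_real pi * of_int n)" by (simp add: algebra_simps)
  then have "z = w + 2 * of_real pi * of_int n" by simp
  then show ?thesis by (rule that)
qed

lemma sin_cos_plus_orbit [simp]:
  fixes z :: complex
  shows "sin (z + 2 * of_real pi * of_int n) = sin z" "cos (z + 2 * of_real pi * of_int n) = cos z"
proof -
  have "sin (2 * of_real pi) = (0::complex)" "cos (2 * of_real pi) = (1::complex)"
    using sin_of_real[of "2 * pi"] cos_of_real[of "2 * pi"] by simp_all
  then have "sin (x + 2 * of_real pi) = sin x" "cos (x + 2 * of_real pi) = cos x" for x :: complex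
    by (simp_all add: sin_add cos_add)
  then show "sin (z + 2 * of_real pi * of_int n) = sin z" "cos (z + 2 * of_real pi * of_int n) = cos z"
    using periodic_int_multiple[of sin "2 * of_real pi" z n] periodic_int_multiple[of cos "2 * of_real pi" z n]
    by (simp_all add: mult_ac)
qed

lemma orbit2pi_Im: "w \<in> orbit2pi z \<Longrightarrow> Im w = Im z"
  by (auto simp: orbit2pi_def)

lemma orbit2pi_self: "z \<in> orbit2pi z"
  unfolding orbit2pi_def by (auto intro: exI[of _ 0])

lemma orbit2pi_eqI:
  assumes "sin z = sin w" "cos z = cos w"
  shows "orbit2pi z = orbit2pi w"
proof -
  obtain n :: int where n: "z = w + 2 * of_real pi * of_int n" using sin_cos_eq_imp_orbit[OF assms] .
  have 1: "z + 2 * of_real pi * of_int m = w + 2 * of_real pi * of_int (m + n)" for m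
    by (simp add: n algebra_simps)
  have 2: "w + 2 * of_real pi * of_int m = z + 2 * of_real pi * of_int (m - n)" for m
    by (simp add: n algebra_simps)
  show ?thesis unfolding orbit2pi_def using 1 2 by (auto; metis)
qed

text \<open>The imaginary part is constant along an orbit, so it can be read off from any
  representative.\<close>

lemma finite_orbits_imp_bounded_Im:
  assumes "finite (orbit2pi ` S)"
  obtains K where "0 \<le> K" "\<And>z. z \<in> S \<Longrightarrow> \<bar>Im z\<bar> \<le> K"
proof -
  define F where "F = (\<lambda>Y. \<bar>Im (SOME w. w \<in> Y)\<bar>) ` orbit2pi ` S"
  have "finite F" using assms by (simp add: F_def)
  have "\<bar>Im z\<bar> \<in> F" if "z \<in> S" for z
  proof -
    have "(SOME w. w \<in> orbit2pi z) \<in> orbit2pi z" using orbit2pi_self by (rule someI)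
    then show ?thesis using orbit2pi_Im that unfolding F_def by (metis image_eqI)
  qed
  then have "\<bar>Im z\<bar> \<le> Max (insert 0 F)" if "z \<in> S" for z using \<open>finite F\<close> that by simp
  moreover have "0 \<le> Max (insert 0 F)" using \<open>finite F\<close> by simp
  ultimately show ?thesis using that by blast
qed

text \<open>Each orbit in the strip meets a compact rectangle of width \<open>2 * pi\<close>, where
  a function that is not identically zero has finitely many zeros.\<close>

lemma finite_zeros_imp_finite_orbits:
  fixes f :: "complex \<Rightarrow> complex"
  assumes hol: "f holomorphic_on UNIV" and nz: "f \<beta> \<noteq> 0"
    and per: "\<And>z n. f (z + 2 * of_real pi * of_int n) = f z"
  shows "finite (orbit2pi ` {z. f z = 0 \<and> \<bar>Im z\<bar> \<le> K})"
proof -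
  have "finite {z \<in> cbox (Complex 0 (- K)) (Complex (2 * pi) K). f z = 0}"
  proof (cases "f constant_on UNIV")
    case True
    then have "f z \<noteq> 0" for z using nz by (metis UNIV_I constant_on_def)
    then show ?thesis by simp
  next
    case False
    then show ?thesis
      by (rule holomorphic_compact_finite_zeros[OF hol open_UNIV connected_UNIV compact_cbox subset_UNIV])
  qed
  moreover have "orbit2pi ` {z. f z = 0 \<and> \<bar>Im z\<bar> \<le> K} \<subseteq> orbit2pi ` {z \<in> cbox (Complex 0 (- K)) (Complex (2 * pi) K). f z = 0}"
  proof
    fix X assume "X \<in> orbit2pi ` {z. f z = 0 \<and> \<bar>Im z\<bar> \<le> K}"
    then obtain z where z: "f z = 0" "\<bar>Im z\<bar> \<le> K" "X = orbit2pi z" by blast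
    define n where "n = \<lfloor>Re z / (2 * pi)\<rfloor>"
    define w where "w = z + 2 * of_real pi * of_int (- n)"
    have "of_int n \<le> Re z / (2 * pi)" "Re z / (2 * pi) < of_int n + 1"
      unfolding n_def by linarith+
    then have "of_int n * (2 * pi) \<le> Re z" "Re z < (of_int n + 1) * (2 * pi)"
      by (simp_all add: le_divide_eq divide_less_eq)
    then have "w \<in> cbox (Complex 0 (- K)) (Complex (2 * pi) K)"
      using z(2) by (auto simp: w_def in_cbox_complex_iff algebra_simps)
    moreover have "f w = 0" using per[of z "- n"] z(1) by (simp only: w_def)
    moreover have "orbit2pi w = X" unfolding z(3) w_def by (intro orbit2pi_eqI sin_cos_plus_orbit)
    ultimately show "X \<in> orbit2pi ` {z \<in> cbox (Complex 0 (- K)) (Complex (2 * pi) K). f z = 0}" by blast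
  qed
  ultimately show ?thesis by (meson finite_imageI finite_subset)
qed

text \<open>\<open>Arcsin s\<close> and its reflection \<open>pi - Arcsin s\<close> have opposite
  imaginary parts.\<close>

lemma sin_preimages:
  fixes s :: complex
  shows "\<exists>z. sin z = s \<and> 0 \<le> Im z" "\<exists>z. sin z = s \<and> Im z \<le> 0"
proof -
  have 1: "sin (Arcsin s) = s" "sin (of_real pi - Arcsin s) = s"
    by (simp_all add: sin_diff)
  have 2: "Im (of_real pi - Arcsin s) = - Im (Arcsin s)" by simp
  show "\<exists>z. sin z = s \<and> 0 \<le> Im z" "\<exists>z. sin z = s \<and> Im z \<le> 0"
    using 1 2 by (metis neg_le_0_iff_le neg_0_le_iff_le linear)+
qed

lemma norm_sin_le_exp_Im: "norm (sin z) \<le> exp \<bar>Im z\<bar>" for z :: complex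
proof -
  have "norm (exp (\<i> * z) - exp (- (\<i> * z))) \<le> exp (- Im z) + exp (Im z)"
    using norm_triangle_ineq4[of "exp (\<i> * z)" "exp (- (\<i> * z))"] by simp
  also have "\<dots> \<le> 2 * exp \<bar>Im z\<bar>" by (auto simp: abs_if)
  finally show ?thesis by (simp add: sin_exp_eq norm_divide norm_mult)
qed

lemma norm_cos_bounds:
  fixes z :: complex
  assumes "1 \<le> norm (sin z)"
  shows "norm (sin z) - 1 \<le> norm (cos z)" "norm (cos z) \<le> norm (sin z) + 1"
proof -
  have sq: "(norm (cos z))\<^sup>2 = norm (1 - (sin z)\<^sup>2)"
    by (metis cos_squared_eq norm_power)
  have "(norm (sin z) - 1)\<^sup>2 \<le> (norm (sin z))\<^sup>2 - 1"
    using assms by (simp add: power2_eq_square algebra_simps)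
  also have "\<dots> \<le> (norm (cos z))\<^sup>2"
    unfolding sq using norm_triangle_ineq2[of "(sin z)\<^sup>2" 1] by (simp add: norm_power norm_minus_commute)
  finally show "norm (sin z) - 1 \<le> norm (cos z)" by (rule power2_le_imp_le) simp
  have "(norm (cos z))\<^sup>2 \<le> 1 + (norm (sin z))\<^sup>2"
    unfolding sq using norm_triangle_ineq4[of 1 "(sin z)\<^sup>2"] by (simp add: norm_power)
  also have "\<dots> \<le> (norm (sin z) + 1)\<^sup>2" by (simp add: power2_eq_square algebra_simps)
  finally show "norm (cos z) \<le> norm (sin z) + 1" by (rule power2_le_imp_le) simp
qed

lemma orbit2pi_finite_zero_set:
  assumes "finite (orbit2pi ` S)" and "\<And>z w. z \<in> S \<Longrightarrow> sin w = sin z \<Longrightarrow> cos w = cos z \<Longrightarrow> w \<in> S"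
  shows "finite (sin ` S)"
proof -
  have "sin ` S \<subseteq> (\<lambda>Y. sin (SOME w. w \<in> Y)) ` orbit2pi ` S"
  proof
    fix s assume "s \<in> sin ` S"
    then obtain z where z: "z \<in> S" "s = sin z" by blast
    have "(SOME w. w \<in> orbit2pi z) \<in> orbit2pi z" using orbit2pi_self by (rule someI)
    then have "sin (SOME w. w \<in> orbit2pi z) = sin z" by (auto simp: orbit2pi_def)
    then show "s \<in> (\<lambda>Y. sin (SOME w. w \<in> Y)) ` orbit2pi ` S" using z by force
  qed
  then show ?thesis using assms(1) by (meson finite_imageI finite_subset)
qed

section \<open>Exceptional parameters\<close>

locale entire_data =
  fixes h :: "complex \<Rightarrow> complex"
  assumes hol: "h holomorphic_on UNIV" and transc: "\<not> (\<exists>p. \<forall>z. h z = poly p z)"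
    and h1: "h 1 \<noteq> 0" and hm1: "h (-1) \<noteq> 0"
begin

lemma holH: "H h a holomorphic_on UNIV"
  unfolding H_def by (intro holomorphic_intros holomorphic_on_compose_gen[OF _ hol, unfolded o_def]) auto

definition N :: "complex \<Rightarrow> complex" where
  "N z = sin z * h (sin z) - (cos z)\<^sup>2 * deriv h (sin z)"

lemma hol_dh: "deriv h holomorphic_on UNIV"
  by (intro holomorphic_deriv hol) auto

lemma holN: "N holomorphic_on UNIV"
  unfolding N_def
  by (intro holomorphic_intros holomorphic_on_compose_gen[OF _ hol, unfolded o_def]
      holomorphic_on_compose_gen[OF _ hol_dh, unfolded o_def]) auto

lemma dh: "(h has_field_derivative deriv h z) (at z)"
  using hol by (intro holomorphic_derivI) auto

lemma dN: "(N has_field_derivative deriv N z) (at z)"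
  using holN by (intro holomorphic_derivI) auto

lemma H_deriv: "(H h a has_field_derivative a * cos z - N z) (at z)"
proof -
  have "((\<lambda>z. h (sin z)) has_field_derivative deriv h (sin z) * cos z) (at z)"
    using DERIV_chain2[OF dh DERIV_sin] .
  then show ?thesis unfolding H_def N_def
    by (auto intro!: derivative_eq_intros simp: algebra_simps power2_eq_square)
qed

lemma deriv_H: "deriv (H h a) z = a * cos z - N z"
  using H_deriv by (rule DERIV_imp_deriv)

lemma deriv2_H: "deriv (deriv (H h a)) z = - a * sin z - deriv N z"
proof -
  have "deriv (H h a) = (\<lambda>z. a * cos z - N z)" using deriv_H by blast
  moreover have "((\<lambda>z. a * cos z - N z) has_field_derivative - a * sin z - deriv N z) (at z)"
    by (auto intro!: derivative_eq_intros dN)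
  ultimately show ?thesis by (metis DERIV_imp_deriv)
qed

text \<open>At a zero of \<open>cos\<close> the sine is 1 or -1 and \<open>N z\<close> reduces to
  \<open>sin z * h (sin z)\<close>.\<close>

lemma N_nonzero_if_cos_zero:
  assumes "cos z = 0" shows "N z \<noteq> 0"
proof -
  have "(sin z)\<^sup>2 = 1" using assms by (metis add.right_neutral power_zero_numeral sin_cos_squared_add)
  then have "sin z = 1 \<or> sin z = - 1" by (simp add: power2_eq_1_iff)
  then show ?thesis using h1 hm1 assms by (auto simp: N_def)
qed

lemma critical_iff: "deriv (H h a) z = 0 \<longleftrightarrow> cos z \<noteq> 0 \<and> N z / cos z = a"
proof (cases "cos z = 0")
  case True
  then show ?thesis using N_nonzero_if_cos_zero[of z] by (simp add: deriv_H)
next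
  case False
  then show ?thesis by (auto simp: deriv_H divide_eq_eq)
qed

text \<open>The numerator of the derivative of \<open>N / cos\<close> over the denominator
  \<open>(cos z)\<^sup>2\<close>.\<close>

definition \<Psi> :: "complex \<Rightarrow> complex" where "\<Psi> z = deriv N z * cos z + N z * sin z"

text \<open>The critical values of \<open>N / cos\<close>. Division by zero contributes nothing:
  where \<open>cos z = 0\<close>, \<open>\<Psi> z\<close> is \<open>N z * sin z\<close>, which is
  nonzero.\<close>

definition E1 :: "complex set" where "E1 = (\<lambda>z. N z / cos z) ` {z. \<Psi> z = 0}"

lemma countable_E1: "countable E1"
proof -
  have hol\<Psi>: "\<Psi> holomorphic_on UNIV"
    unfolding \<Psi>_def by (intro holomorphic_intros holN holomorphic_deriv) auto
  have "\<Psi> (of_real (pi / 2)) = h 1"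
    using cos_of_real[of "pi / 2"] sin_of_real[of "pi / 2"] by (simp add: \<Psi>_def N_def)
  moreover have "\<Psi> \<beta> = 0" if "\<Psi> constant_on UNIV" "\<Psi> z = 0" for \<beta> z
    using that by (auto simp: constant_on_def)
  ultimately have "countable {z \<in> UNIV. \<Psi> z = 0}"
  proof (cases "\<Psi> constant_on UNIV")
    case True
    then have "{z. \<Psi> z = 0} = {}" using h1 \<open>\<Psi> (of_real (pi / 2)) = h 1\<close> by (auto simp: constant_on_def)
    then show ?thesis by simp
  next
    case False
    then show ?thesis by (intro holomorphic_countable_zeros hol\<Psi>) auto
  qed
  then show ?thesis by (simp add: E1_def)
qed

text \<open>Substituting \<open>N z = a * cos z\<close> turns \<open>\<Psi> z\<close> into
  \<open>- cos z\<close> times the second derivative of \<open>H h a\<close>.\<close>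

lemma simple_critical:
  assumes "a \<notin> E1" "deriv (H h a) z = 0"
  shows "deriv (deriv (H h a)) z \<noteq> 0" "\<Psi> z \<noteq> 0"
proof -
  have c: "cos z \<noteq> 0" "N z / cos z = a" using assms(2) critical_iff by auto
  then show P: "\<Psi> z \<noteq> 0" using assms(1) by (auto simp: E1_def)
  have "\<Psi> z = (deriv N z + a * sin z) * cos z" using c by (auto simp: \<Psi>_def field_simps)
  then have "deriv N z + a * sin z \<noteq> 0" using P by auto
  moreover have "deriv (deriv (H h a)) z = - (deriv N z + a * sin z)" by (simp add: deriv2_H)
  ultimately show "deriv (deriv (H h a)) z \<noteq> 0" by (metis neg_equal_0_iff_equal)
qed

end

section \<open>Coincidences of critical values\<close>

context entire_data
begin

abbreviation \<phi> :: "complex \<Rightarrow> complex" where "\<phi> z \<equiv> N z / cos z"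

text \<open>The last conclusion is what transfers isolation in the parameter back to isolation of
  points: near \<open>x\<close> every \<open>z\<close> is recovered from its parameter
  \<open>\<phi> z\<close>.\<close>

lemma \<phi>_local_inverse:
  assumes x: "cos x \<noteq> 0" "\<Psi> x \<noteq> 0"
  obtains \<psi> \<epsilon> where "0 < \<epsilon>" "\<psi> holomorphic_on ball (\<phi> x) \<epsilon>"
    "\<And>a. a \<in> ball (\<phi> x) \<epsilon> \<Longrightarrow> cos (\<psi> a) \<noteq> 0 \<and> \<phi> (\<psi> a) = a"
    "\<And>\<delta>. 0 < \<delta> \<Longrightarrow> \<exists>U. open U \<and> x \<in> U \<and> (\<forall>z\<in>U. \<phi> z \<in> ball (\<phi> x) \<delta> \<and> \<psi> (\<phi> z) = z)"
proof -
  define S where "S = {z::complex. cos z \<noteq> 0}"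
  have S: "open S" "x \<in> S"
    unfolding S_def using x by (auto intro!: open_Collect_neq continuous_intros)
  have hol\<phi>: "(\<lambda>z. \<phi> z) holomorphic_on S"
    by (intro holomorphic_intros holomorphic_on_subset[OF holN]) (auto simp: S_def)
  have "((\<lambda>z. \<phi> z) has_field_derivative \<Psi> x / (cos x)\<^sup>2) (at x)"
    using x by (auto intro!: derivative_eq_intros dN simp: \<Psi>_def power2_eq_square)
  then have "deriv (\<lambda>z. \<phi> z) x \<noteq> 0" using x DERIV_imp_deriv by fastforce
  then obtain r where r: "r > 0" "ball x r \<subseteq> S" "open ((\<lambda>z. \<phi> z) ` ball x r)" "inj_on (\<lambda>z. \<phi> z) (ball x r)"
    using has_complex_derivative_locally_invertible[OF hol\<phi> S(2,1)] by metis
  have hb: "(\<lambda>z. \<phi> z) holomorphic_on ball x r" using hol\<phi> r(2) by (rule holomorphic_on_subset)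
  obtain \<psi> where \<psi>: "\<psi> holomorphic_on (\<lambda>z. \<phi> z) ` ball x r" "\<And>z. z \<in> ball x r \<Longrightarrow> \<psi> (\<phi> z) = z"
    using holomorphic_has_inverse[OF hb open_ball r(4)] by metis
  have "\<phi> x \<in> (\<lambda>z. \<phi> z) ` ball x r" using r(1) by auto
  then obtain \<epsilon> where \<epsilon>: "0 < \<epsilon>" "ball (\<phi> x) \<epsilon> \<subseteq> (\<lambda>z. \<phi> z) ` ball x r"
    using r(3) openE by blast
  show ?thesis
  proof
    show "0 < \<epsilon>" by fact
    show "\<psi> holomorphic_on ball (\<phi> x) \<epsilon>" using \<psi>(1) \<epsilon>(2) by (rule holomorphic_on_subset)
    show "cos (\<psi> a) \<noteq> 0 \<and> \<phi> (\<psi> a) = a" if "a \<in> ball (\<phi> x) \<epsilon>" for a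
    proof -
      obtain z where z: "z \<in> ball x r" "a = \<phi> z" using \<epsilon>(2) \<open>a \<in> ball (\<phi> x) \<epsilon>\<close> by blast
      then show ?thesis using \<psi>(2)[OF z(1)] r(2) by (auto simp: S_def)
    qed
    fix \<delta> :: real assume d: "0 < \<delta>"
    define U where "U = ball x r \<inter> (\<lambda>z. \<phi> z) -` ball (\<phi> x) \<delta>"
    have "open U" unfolding U_def
      by (intro continuous_open_preimage holomorphic_on_imp_continuous_on hb) auto
    moreover have "x \<in> U" using r(1) d by (simp add: U_def)
    moreover have "\<forall>z\<in>U. \<phi> z \<in> ball (\<phi> x) \<delta> \<and> \<psi> (\<phi> z) = z" using \<psi>(2) by (auto simp: U_def)
    ultimately show "\<exists>U. open U \<and> x \<in> U \<and> (\<forall>z\<in>U. \<phi> z \<in> ball (\<phi> x) \<delta> \<and> \<psi> (\<phi> z) = z)" by blast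
  qed
qed

text \<open>Envelope identity: along a branch \<open>\<psi>\<close> of critical points, the \<open>a\<close>-derivative of the critical
  value \<open>H h a (\<psi> a)\<close> only sees the explicit dependence on \<open>a\<close>.\<close>

lemma critical_value_deriv:
  assumes "\<psi> holomorphic_on ball b \<epsilon>" "a \<in> ball b \<epsilon>" "cos (\<psi> a) \<noteq> 0" "\<phi> (\<psi> a) = a"
  shows "((\<lambda>a. H h a (\<psi> a)) has_field_derivative sin (\<psi> a)) (at a)"
proof -
  have d\<psi>: "(\<psi> has_field_derivative deriv \<psi> a) (at a)"
    using assms(1,2) by (intro holomorphic_derivI) auto
  have "((\<lambda>a. H h 0 (\<psi> a)) has_field_derivative (0 * cos (\<psi> a) - N (\<psi> a)) * deriv \<psi> a) (at a)"
    using DERIV_chain2[OF H_deriv d\<psi>] .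
  then have "((\<lambda>a. H h 0 (\<psi> a) + a * sin (\<psi> a)) has_field_derivative 
      (0 * cos (\<psi> a) - N (\<psi> a)) * deriv \<psi> a + (a * (cos (\<psi> a) * deriv \<psi> a) + 1 * sin (\<psi> a))) (at a)"
    by (intro DERIV_add) (auto intro!: derivative_eq_intros d\<psi>)
  moreover have "(0 * cos (\<psi> a) - N (\<psi> a)) * deriv \<psi> a + (a * (cos (\<psi> a) * deriv \<psi> a) + 1 * sin (\<psi> a)) = sin (\<psi> a)"
    using assms(3,4) by (simp add: field_simps)
  moreover have "(\<lambda>a. H h 0 (\<psi> a) + a * sin (\<psi> a)) = (\<lambda>a. H h a (\<psi> a))" by (simp add: H_def)
  ultimately show ?thesis by (simp only:)
qed

text \<open>Critical points of one \<open>H h a\<close>, with \<open>a\<close> encoded as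
  \<open>\<phi> x\<close>, that share a critical value but not an orbit. The conditions on
  \<open>\<Psi>\<close> let both continue as holomorphic branches in \<open>a\<close>.\<close>

definition bad_pairs :: "(complex \<times> complex) set" where
  "bad_pairs = {(x, y). cos x \<noteq> 0 \<and> cos y \<noteq> 0 \<and> \<Psi> x \<noteq> 0 \<and> \<Psi> y \<noteq> 0 \<and> \<phi> x = \<phi> y \<and>
     H h (\<phi> x) x = H h (\<phi> x) y \<and> \<not> (cos x = cos y \<and> sin x = sin y)}"

lemma bad_pairs_isolated:
  assumes "p \<in> bad_pairs"
  obtains U where "open U" "p \<in> U" "U \<inter> bad_pairs \<subseteq> {p}"
proof -
  obtain x y where p: "p = (x, y)" by (cases p)
  have xy: "cos x \<noteq> 0" "cos y \<noteq> 0" "\<Psi> x \<noteq> 0" "\<Psi> y \<noteq> 0" "\<phi> y = \<phi> x"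
    "H h (\<phi> x) x = H h (\<phi> x) y" "\<not> (cos x = cos y \<and> sin x = sin y)"
    using assms by (auto simp: bad_pairs_def p)
  define b where "b = \<phi> x"
  obtain \<psi>1 \<epsilon>1 where 1: "0 < \<epsilon>1" "\<psi>1 holomorphic_on ball b \<epsilon>1"
    "\<And>a. a \<in> ball b \<epsilon>1 \<Longrightarrow> cos (\<psi>1 a) \<noteq> 0 \<and> \<phi> (\<psi>1 a) = a"
    "\<And>\<delta>. 0 < \<delta> \<Longrightarrow> \<exists>U. open U \<and> x \<in> U \<and> (\<forall>z\<in>U. \<phi> z \<in> ball b \<delta> \<and> \<psi>1 (\<phi> z) = z)"
    using \<phi>_local_inverse[OF xy(1,3)] unfolding b_def by metis
  obtain \<psi>2 \<epsilon>2 where 2: "0 < \<epsilon>2" "\<psi>2 holomorphic_on ball b \<epsilon>2"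
    "\<And>a. a \<in> ball b \<epsilon>2 \<Longrightarrow> cos (\<psi>2 a) \<noteq> 0 \<and> \<phi> (\<psi>2 a) = a"
    "\<And>\<delta>. 0 < \<delta> \<Longrightarrow> \<exists>U. open U \<and> y \<in> U \<and> (\<forall>z\<in>U. \<phi> z \<in> ball b \<delta> \<and> \<psi>2 (\<phi> z) = z)"
    using \<phi>_local_inverse[OF xy(2,4)] unfolding b_def xy(5) by metis
  define \<epsilon> where "\<epsilon> = min \<epsilon>1 \<epsilon>2"
  have \<epsilon>: "0 < \<epsilon>" "ball b \<epsilon> \<subseteq> ball b \<epsilon>1" "ball b \<epsilon> \<subseteq> ball b \<epsilon>2" using 1(1) 2(1) by (auto simp: \<epsilon>_def)
  have h12: "\<psi>1 holomorphic_on ball b \<epsilon>" "\<psi>2 holomorphic_on ball b \<epsilon>"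
    using holomorphic_on_subset[OF 1(2) \<epsilon>(2)] holomorphic_on_subset[OF 2(2) \<epsilon>(3)] by auto
  have \<psi>b: "\<psi>1 b = x" "\<psi>2 b = y"
    using 1(4)[of 1] 2(4)[of 1] xy(5) by (auto simp: b_def)
  \<comment> \<open>The gap between the critical values of the two branches: either \<open>b\<close>
    is an isolated zero of it, or the coincidence persists for all nearby parameters.\<close>
  define d where "d = (\<lambda>a. H h a (\<psi>1 a) - H h a (\<psi>2 a))"
  have dd: "(d has_field_derivative sin (\<psi>1 a) - sin (\<psi>2 a)) (at a)" if a: "a \<in> ball b \<epsilon>" for a
    unfolding d_def using 1(3)[of a] 2(3)[of a] \<epsilon> a
    by (intro DERIV_diff critical_value_deriv[OF h12(1) a] critical_value_deriv[OF h12(2) a]) auto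
  have hold: "d holomorphic_on ball b \<epsilon>"
    using dd by (meson field_differentiable_at_within field_differentiable_def holomorphic_on_def)
  have db: "d b = 0" using xy(6) by (simp add: d_def \<psi>b flip: b_def)
  show ?thesis
  proof (cases "\<exists>\<beta>\<in>ball b \<epsilon>. d \<beta> \<noteq> 0")
    case True
    then obtain \<beta> where \<beta>: "\<beta> \<in> ball b \<epsilon>" "d \<beta> \<noteq> 0" by blast
    obtain r where r: "0 < r" "ball b r \<subseteq> ball b \<epsilon>" "\<And>z. z \<in> ball b r - {b} \<Longrightarrow> d z \<noteq> 0"
      using isolated_zeros[OF hold open_ball connected_ball _ db \<beta>] \<epsilon>(1) by (metis centre_in_ball)
    obtain U1 where U1: "open U1" "x \<in> U1" "\<And>z. z \<in> U1 \<Longrightarrow> \<phi> z \<in> ball b r \<and> \<psi>1 (\<phi> z) = z"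
      using 1(4)[OF r(1)] by blast
    obtain U2 where U2: "open U2" "y \<in> U2" "\<And>z. z \<in> U2 \<Longrightarrow> \<phi> z \<in> ball b r \<and> \<psi>2 (\<phi> z) = z"
      using 2(4)[OF r(1)] by blast
    have "(u, v) = p" if uv: "(u, v) \<in> (U1 \<times> U2) \<inter> bad_pairs" for u v
    proof -
      define a where "a = \<phi> u"
      have a: "a = \<phi> v" "H h a u = H h a v" "a \<in> ball b r" "\<psi>1 a = u" "\<psi>2 a = v"
        using uv U1(3)[of u] U2(3)[of v] by (auto simp: bad_pairs_def a_def)
      then have "d a = 0" by (simp add: d_def)
      then have "a = b" using r(3)[of a] a(3) by blast
      then show ?thesis using a \<psi>b p by simp
    qed
    moreover have "open (U1 \<times> U2)" "p \<in> U1 \<times> U2" using U1 U2 p by (auto intro: open_Times)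
    ultimately show ?thesis using that[of "U1 \<times> U2"] by fast
  next
    case False
    then have d0: "\<And>a. a \<in> ball b \<epsilon> \<Longrightarrow> d a = 0" by blast
    have sin_eq: "sin (\<psi>1 a) = sin (\<psi>2 a)" if a: "a \<in> ball b \<epsilon>" for a
    proof -
      have "(d has_field_derivative 0) (at a)"
        by (rule has_field_derivative_transform_within_open[OF DERIV_const[of 0] open_ball a]) (simp add: d0)
      then have "sin (\<psi>1 a) - sin (\<psi>2 a) = 0" by (rule DERIV_unique[OF dd[OF a]])
      then show ?thesis by simp
    qed
    have "cos x \<noteq> cos y" using xy(7) sin_eq[of b] \<epsilon>(1) \<psi>b by auto
    \<comment> \<open>With equal sines, \<open>d a = 0\<close> reads
      \<open>c a * h (sin (\<psi>1 a)) = 0\<close>. Since the cosines differ near \<open>b\<close>,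
      \<open>h \<circ> sin\<close> vanishes on an open set, against
      \<open>h 1 \<noteq> 0\<close>.\<close>
    define c where "c = (\<lambda>a. cos (\<psi>1 a) - cos (\<psi>2 a))"
    have "continuous_on (ball b \<epsilon>) c"
      unfolding c_def by (intro continuous_intros holomorphic_on_imp_continuous_on h12)
    then have "isCont c b" using \<epsilon>(1) by (simp add: continuous_on_eq_continuous_at)
    moreover have "c b \<noteq> 0" using \<open>cos x \<noteq> cos y\<close> by (simp add: c_def \<psi>b)
    ultimately obtain \<delta>0 where \<delta>0: "\<delta>0 > 0" "\<And>a. dist b a < \<delta>0 \<Longrightarrow> c a \<noteq> 0"
      using continuous_at_avoid[of b c 0] by blast
    define \<delta> where "\<delta> = min \<epsilon> \<delta>0"
    have hz: "h (sin (\<psi>1 a)) = 0" if a: "a \<in> ball b \<delta>" for a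
    proof -
      have ab: "a \<in> ball b \<epsilon>" "c a \<noteq> 0" using a \<delta>0 by (auto simp: \<delta>_def)
      have "c a * h (sin (\<psi>1 a)) = 0" 
        using d0[OF ab(1)] sin_eq[OF ab(1)] by (simp add: d_def H_def c_def algebra_simps)
      then show ?thesis using ab(2) by simp
    qed
    obtain U where U: "open U" "x \<in> U" "\<And>z. z \<in> U \<Longrightarrow> \<phi> z \<in> ball b \<delta> \<and> \<psi>1 (\<phi> z) = z"
      using 1(4)[of \<delta>] \<epsilon>(1) \<delta>0(1) by (auto simp: \<delta>_def)
    have "h (sin z) = 0" for z
    proof (rule analytic_continuation_open[of U UNIV "\<lambda>z. h (sin z)" "\<lambda>_. 0"])
      show "(\<lambda>z. h (sin z)) holomorphic_on UNIV"
        by (intro holomorphic_on_compose_gen[OF _ hol, unfolded o_def] holomorphic_intros) auto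
      show "h (sin z) = 0" if "z \<in> U" for z using hz[of "\<phi> z"] U(3)[OF that] by simp
    qed (use U in auto)
    then have "h (sin (of_real (pi / 2))) = 0" .
    then show ?thesis using h1 sin_of_real[of "pi / 2"] by simp
  qed
qed

definition E2 :: "complex set" where "E2 = (\<lambda>p. \<phi> (fst p)) ` bad_pairs"

text \<open>A set of isolated points in a second countable space is countable, by Lindelof's
  covering theorem.\<close>

lemma countable_E2: "countable E2"
proof -
  define G where "G = {U. open U \<and> (\<exists>p. U \<inter> bad_pairs \<subseteq> {p})}"
  obtain G' where G': "G' \<subseteq> G" "countable G'" "\<Union>G' = \<Union>G"
    using Lindelof[of G] by (auto simp: G_def)
  have "bad_pairs \<subseteq> (\<Union>U\<in>G'. U \<inter> bad_pairs)"
  proof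
    fix p assume p: "p \<in> bad_pairs"
    obtain U where "open U" "p \<in> U" "U \<inter> bad_pairs \<subseteq> {p}" using bad_pairs_isolated[OF p] .
    then have "U \<in> G" "p \<in> U" unfolding G_def by blast+
    then have "p \<in> \<Union>G" by blast
    then show "p \<in> (\<Union>U\<in>G'. U \<inter> bad_pairs)" using G'(3) p by auto
  qed
  moreover have "countable (U \<inter> bad_pairs)" if "U \<in> G'" for U
  proof -
    have "U \<in> G" using that G'(1) by blast
    then obtain p where "U \<inter> bad_pairs \<subseteq> {p}" unfolding G_def by blast
    then show ?thesis using countable_subset countable_insert countable_empty by metis
  qed
  ultimately have "countable bad_pairs"
    using G'(2) by (meson countable_UN countable_subset)
  then show ?thesis by (simp add: E2_def)
qed

lemma critical_points_same_value:
  assumes "a \<notin> E1" "a \<notin> E2" "deriv (H h a) z = 0" "deriv (H h a) w = 0" "H h a z = H h a w"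
  shows "cos z = cos w" "sin z = sin w"
proof -
  have "\<Psi> z \<noteq> 0" "\<Psi> w \<noteq> 0" using simple_critical assms by auto
  moreover have "cos z \<noteq> 0" "\<phi> z = a" "cos w \<noteq> 0" "\<phi> w = a" using assms critical_iff by auto
  ultimately have "\<not> (cos z = cos w \<and> sin z = sin w) \<Longrightarrow> (z, w) \<in> bad_pairs"
    using assms(5) by (auto simp: bad_pairs_def)
  moreover have "(z, w) \<notin> bad_pairs" using assms(2) \<open>\<phi> z = a\<close> by (force simp: E2_def)
  ultimately show "cos z = cos w" "sin z = sin w" by blast+
qed

end

section \<open>Polynomials and limits along sections of \<open>sin\<close>\<close>

lemma poly_growth:
  fixes p :: "complex poly"
  obtains C n where "0 \<le> C" "\<And>z. 1 \<le> norm z \<Longrightarrow> norm (poly p z) \<le> C * norm z ^ n"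
proof -
  have "\<exists>C n. 0 \<le> C \<and> (\<forall>z. 1 \<le> norm z \<longrightarrow> norm (poly p z) \<le> C * norm z ^ n)"
  proof (induction p)
    case 0
    then show ?case by (intro exI[of _ 0]) auto
  next
    case (pCons a p)
    then obtain C n where C: "0 \<le> C" "\<And>z. 1 \<le> norm z \<Longrightarrow> norm (poly p z) \<le> C * norm z ^ n" by blast
    have "norm (poly (pCons a p) z) \<le> (norm a + C) * norm z ^ Suc n" if z: "1 \<le> norm z" for z
    proof -
      have "norm (poly (pCons a p) z) \<le> norm a * 1 + norm z * (C * norm z ^ n)"
        using norm_triangle_ineq[of a "z * poly p z"] mult_left_mono[OF C(2)[OF z], of "norm z"]
        by (simp add: norm_mult)
      also have "norm a * 1 \<le> norm a * norm z ^ Suc n"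
        using one_le_power[OF z, of "Suc n"] by (intro mult_left_mono) auto
      finally show ?thesis by (simp add: algebra_simps)
    qed
    then show ?case using C(1) by (intro exI[of _ "norm a + C"] exI[of _ "Suc n"]) auto
  qed
  then show ?thesis using that by blast
qed

lemma filterlim_poly_at_infinity:
  fixes p :: "complex poly"
  assumes "degree p > 0"
  shows "filterlim (poly p) at_infinity at_infinity"
proof -
  obtain a q where p: "p = pCons a q" by (cases p)
  have "q \<noteq> 0" using assms p by auto
  show ?thesis
    unfolding filterlim_at_infinity[OF order_refl] eventually_at_infinity p
    using poly_infinity[OF \<open>q \<noteq> 0\<close>] by blast
qed

lemma has_fps_expansion_poly: "poly p has_fps_expansion fps_of_poly p" for p :: "complex poly"
proof (induction p)
  case 0
  then show ?case by (simp add: fps_expansion_intros)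
next
  case (pCons a p)
  have "(\<lambda>z. a + poly p z * z) has_fps_expansion fps_const a + fps_of_poly p * fps_X"
    by (intro fps_expansion_intros pCons)
  then show ?case by (simp add: fps_of_poly_pCons mult.commute)
qed

lemma sin_section:
  obtains zs :: "complex \<Rightarrow> complex" where "\<And>s. sin (zs s) = s" "\<And>s. 0 \<le> Im (zs s)"
    "filterlim (\<lambda>s. exp (- \<i> * zs s)) at_infinity at_infinity"
proof -
  obtain zs :: "complex \<Rightarrow> complex" where zs: "\<And>s. sin (zs s) = s" "\<And>s. 0 \<le> Im (zs s)"
    using sin_preimages(1) by metis
  have "norm s \<le> norm (exp (- \<i> * zs s))" for s
    using norm_sin_le_exp_Im[of "zs s"] zs[of s] by simp
  then have "filterlim (\<lambda>s. exp (- \<i> * zs s)) at_infinity at_infinity"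
    unfolding filterlim_at_infinity[OF order_refl] eventually_at_infinity using order_trans by blast
  then show ?thesis using that zs by blast
qed

lemma sin_section_lower:
  obtains zs :: "complex \<Rightarrow> complex" where "\<And>s. sin (zs s) = s" "\<And>s. Im (zs s) \<le> 0"
    "filterlim (\<lambda>s. exp (\<i> * zs s)) at_infinity at_infinity"
proof -
  obtain zs :: "complex \<Rightarrow> complex" where zs: "\<And>s. sin (zs s) = s" "\<And>s. Im (zs s) \<le> 0"
    using sin_preimages(2) by metis
  have "norm s \<le> norm (exp (\<i> * zs s))" for s
    using norm_sin_le_exp_Im[of "zs s"] zs[of s] by simp
  then have "filterlim (\<lambda>s. exp (\<i> * zs s)) at_infinity at_infinity"
    unfolding filterlim_at_infinity[OF order_refl] eventually_at_infinity using order_trans by blast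
  then show ?thesis using that zs by blast
qed

lemma filterlim_cos_section:
  fixes zs :: "complex \<Rightarrow> complex"
  assumes "\<And>s. sin (zs s) = s"
  shows "filterlim (\<lambda>s. cos (zs s)) at_infinity at_infinity"
proof -
  have "r \<le> norm (cos (zs s))" if "\<bar>r\<bar> + 1 \<le> norm s" for r s 
  proof -
    have "1 \<le> norm (sin (zs s))" unfolding assms using that by linarith
    then show ?thesis using norm_cos_bounds(1)[of "zs s"] that unfolding assms by linarith
  qed
  then show ?thesis
    unfolding filterlim_at_infinity[OF order_refl] eventually_at_infinity by blast
qed

section \<open>Parameters with finitely many critical orbits or preimage orbits\<close>

context entire_data
begin

text \<open>If \<open>H h a\<close> stayed bounded along the section, \<open>cos * h s\<close> would
  be of order \<open>s\<close>; as \<open>norm (cos (zs s))\<close> is at least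
  \<open>norm s / 2\<close>, \<open>h\<close> would be bounded near infinity and hence a
  polynomial.\<close>

lemma H_no_limit:
  assumes zs: "\<And>s. sin (zs s) = s"
  shows "\<not> ((\<lambda>s. H h a (zs s)) \<longlongrightarrow> l) at_infinity"
proof
  assume "((\<lambda>s. H h a (zs s)) \<longlongrightarrow> l) at_infinity"
  then have "eventually (\<lambda>s. dist (H h a (zs s)) l < 1) at_infinity" by (rule tendstoD) simp
  then obtain R where R: "\<And>s. R \<le> norm s \<Longrightarrow> dist (H h a (zs s)) l < 1"
    by (auto simp: eventually_at_infinity)
  define M where "M = norm l + 1"
  have "norm (h s) \<le> 2 * (M + norm a) * norm s ^ 0" if s: "max R 2 \<le> norm s" for s
  proof -
    have HM: "norm (H h a (zs s)) \<le> M"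
      using R[of s] s norm_triangle_sub[of "H h a (zs s)" l] by (simp add: M_def dist_norm)
    have c: "norm s - 1 \<le> norm (cos (zs s))" using norm_cos_bounds(1)[of "zs s"] zs s by simp
    have "cos (zs s) * h s = H h a (zs s) - a * s" by (simp add: H_def zs)
    then have "norm (cos (zs s)) * norm (h s) = norm (H h a (zs s) - a * s)" by (metis norm_mult)
    also have "\<dots> \<le> M * 1 + norm a * norm s"
      using norm_triangle_ineq4[of "H h a (zs s)" "a * s"] HM by (simp add: norm_mult)
    also have "\<dots> \<le> M * norm s + norm a * norm s"
      using s by (intro add_mono mult_left_mono) (auto simp: M_def)
    finally have "norm (cos (zs s)) * norm (h s) \<le> (M + norm a) * norm s" by (simp add: algebra_simps)
    moreover have "(norm s / 2) * norm (h s) \<le> norm (cos (zs s)) * norm (h s)"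
      using c s by (intro mult_right_mono) auto
    ultimately have "norm s * norm (h s) \<le> norm s * (2 * (M + norm a))" by (simp add: algebra_simps)
    moreover have "0 < norm s" using s by auto
    ultimately show ?thesis by simp
  qed
  then show False using entire_polynomial_growth_imp_poly[OF hol] transc by blast
qed

text \<open>On power series the equation reads \<open>(n + 2) F (n + 2) = (n + 1) F n\<close> for large \<open>n\<close>, which keeps
  \<open>n * norm (F n)\<close> from decreasing along each parity class.\<close>

lemma not_poly_of_ode:
  assumes eq: "\<And>s. s * h s - (1 - s\<^sup>2) * deriv h s = poly p s"
  shows False
proof -
  define F where "F = (\<lambda>n. (deriv ^^ n) h 0 / fact n)"
  have Fexp: "h has_fps_expansion Abs_fps F"
  proof -
    have "h analytic_on {0}" using hol by (auto simp: analytic_on_holomorphic)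
    then have "h has_fps_expansion fps_expansion h 0" by (rule analytic_at_imp_has_fps_expansion_0)
    then show ?thesis by (simp add: fps_expansion_def F_def)
  qed
  have "(\<lambda>s. s * h s - (1 - s\<^sup>2) * deriv h s) has_fps_expansion
      fps_X * Abs_fps F - (1 - fps_X\<^sup>2) * fps_deriv (Abs_fps F)"
    by (intro fps_expansion_intros Fexp)
  then have "fps_X * Abs_fps F - (1 - fps_X\<^sup>2) * fps_deriv (Abs_fps F) = fps_of_poly p"
    unfolding eq using fps_expansion_unique_complex has_fps_expansion_poly by blast
  then have nth: "fps_nth (fps_X * Abs_fps F - (1 - fps_X\<^sup>2) * fps_deriv (Abs_fps F)) n = coeff p n" for n
    by simp
  have rec: "of_nat (n + 2) * F (n + 2) = of_nat (n + 1) * F n" if n: "1 \<le> n" "degree p \<le> n" for n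
  proof -
    have "fps_nth ((1 - fps_X\<^sup>2) * fps_deriv (Abs_fps F)) (n + 1) = of_nat (n + 2) * F (n + 2) - of_nat n * F n"
    proof -
      obtain m where "n = Suc m" using n by (cases n) auto
      then show ?thesis by (simp add: ring_distribs fps_X_power_mult_nth)
    qed
    then have "F n - (of_nat (n + 2) * F (n + 2) - of_nat n * F n) = coeff p (n + 1)"
      using nth[of "n + 1"] by simp
    also have "coeff p (n + 1) = 0" using n by (simp add: coeff_eq_0)
    finally show ?thesis by (simp add: algebra_simps)
  qed
  \<comment> \<open>This is where entirety is felt: the Taylor series of \<open>deriv h\<close>
    converges even at 1, a singular point of the equation, whose homogeneous solutions are multiples
    of \<open>(1 - s\<^sup>2)\<close> to the power -1/2.\<close>
  have lim: "(\<lambda>n. of_nat n * F n) \<longlonglongrightarrow> 0"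
  proof -
    have "(\<lambda>n. (deriv ^^ n) (deriv h) 0 / fact n * (1 - 0) ^ n) sums deriv h 1"
      by (rule holomorphic_power_series[of _ _ 2]) (auto intro: holomorphic_on_subset[OF hol_dh])
    moreover have "(deriv ^^ n) (deriv h) 0 / fact n * (1 - 0) ^ n = of_nat (Suc n) * F (Suc n)" for n
      by (simp add: F_def funpow_Suc_right del: funpow.simps of_nat_Suc)
    ultimately have "summable (\<lambda>n. of_nat (Suc n) * F (Suc n))" by (simp add: sums_iff)
    then have "(\<lambda>n. of_nat (Suc n) * F (Suc n)) \<longlonglongrightarrow> 0" by (rule summable_LIMSEQ_zero)
    then show ?thesis by (rule LIMSEQ_imp_Suc)
  qed
  have F0: "F n = 0" if n: "1 \<le> n" "degree p \<le> n" for n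
  proof -
    have mono: "real n * norm (F n) \<le> real (n + 2 * j) * norm (F (n + 2 * j))" for j
    proof (induction j)
      case (Suc j)
      have "real (n + 2 * j) * norm (F (n + 2 * j)) \<le> real (n + 2 * j + 1) * norm (F (n + 2 * j))"
        by (intro mult_right_mono) auto
      also have "\<dots> = norm (of_nat (n + 2 * j + 1) * F (n + 2 * j))" by (simp only: norm_mult norm_of_nat)
      also have "\<dots> = norm (of_nat (n + 2 * j + 2) * F (n + 2 * j + 2))"
        using rec[of "n + 2 * j"] n by simp
      also have "\<dots> = real (n + 2 * Suc j) * norm (F (n + 2 * Suc j))"
        by (simp only: norm_mult norm_of_nat mult_Suc_right add.assoc add.commute[of 2])
      finally show ?case using Suc by linarith
    qed simp
    have "(\<lambda>n. norm (of_nat n * F n)) \<longlonglongrightarrow> 0" using tendsto_norm_zero[OF lim] .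
    moreover have "strict_mono (\<lambda>j. n + 2 * j)" by (auto simp: strict_mono_def)
    ultimately have "(\<lambda>j. real (n + 2 * j) * norm (F (n + 2 * j))) \<longlonglongrightarrow> 0"
      using LIMSEQ_subseq_LIMSEQ[of "\<lambda>n. norm (of_nat n * F n)" 0 "\<lambda>j. n + 2 * j"]
      by (simp add: o_def norm_mult del: of_nat_add)
    then have "real n * norm (F n) \<le> 0" using mono by (intro LIMSEQ_le_const) auto
    then show ?thesis using n by (simp add: mult_le_0_iff)
  qed
  have "h z = (\<Sum>j\<le>degree p. F j * z ^ j)" for z
  proof -
    have "(\<lambda>n. F n * (z - 0) ^ n) sums h z"
      unfolding F_def
      by (rule holomorphic_power_series[of _ _ "norm z + 1"]) (auto intro: holomorphic_on_subset[OF hol])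
    moreover have "(\<lambda>n. F n * (z - 0) ^ n) sums (\<Sum>j\<le>degree p. F j * (z - 0) ^ j)"
      by (rule sums_finite) (use F0 in auto)
    ultimately show ?thesis using sums_unique2 by fastforce
  qed
  then show False using transc unfolding poly_sum_monom by blast
qed

text \<open>High in the upper half-plane \<open>\<phi>\<close> would omit both \<open>a\<close> and
  \<open>b\<close>, so Picard gives it a finite or infinite limit at that end; either makes
  \<open>\<phi> * cos\<close>, an entire function of \<open>sin z\<close>, a polynomial.\<close>

lemma unique_finite_critical_orbits:
  assumes "finite (orbit2pi ` {z. deriv (H h a) z = 0})" "finite (orbit2pi ` {z. deriv (H h b) z = 0})"
  shows "a = b"
proof (rule ccontr)
  assume ab: "a \<noteq> b"
  obtain Ka where Ka: "0 \<le> Ka" "\<And>z. z \<in> {z. deriv (H h a) z = 0} \<Longrightarrow> \<bar>Im z\<bar> \<le> Ka"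
    by (rule finite_orbits_imp_bounded_Im[OF assms(1)]) (rule that; assumption)
  obtain Kb where Kb: "0 \<le> Kb" "\<And>z. z \<in> {z. deriv (H h b) z = 0} \<Longrightarrow> \<bar>Im z\<bar> \<le> Kb"
    by (rule finite_orbits_imp_bounded_Im[OF assms(2)]) (rule that; assumption)
  have K: "0 \<le> Ka" "\<And>z. deriv (H h a) z = 0 \<Longrightarrow> \<bar>Im z\<bar> \<le> Ka"
      "0 \<le> Kb" "\<And>z. deriv (H h b) z = 0 \<Longrightarrow> \<bar>Im z\<bar> \<le> Kb"
    using Ka Kb by simp_all
  define R where "R = exp (Ka + Kb)"
  have R1: "1 \<le> R" using K by (simp add: R_def)
  \<comment> \<open>\<open>S\<close> and \<open>C\<close> are \<open>sin\<close> and
    \<open>cos\<close> in the coordinate \<open>\<zeta> = exp (- \<i> * z)\<close>, for which the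
    upper end of the cylinder is at infinity.\<close>
  define S where "S = (\<lambda>\<zeta>::complex. (inverse \<zeta> - \<zeta>) / (2 * \<i>))"
  define C where "C = (\<lambda>\<zeta>::complex. (inverse \<zeta> + \<zeta>) / 2)"
  define \<Phi> where "\<Phi> = (\<lambda>\<zeta>. (S \<zeta> * h (S \<zeta>) - (C \<zeta>)\<^sup>2 * deriv h (S \<zeta>)) / C \<zeta>)"
  have SC: "S (exp (- \<i> * z)) = sin z" "C (exp (- \<i> * z)) = cos z" for z
    by (simp_all add: S_def C_def sin_exp_eq cos_exp_eq exp_minus)
  have \<Phi>\<phi>: "\<Phi> (exp (- \<i> * z)) = \<phi> z" for z by (simp only: \<Phi>_def SC N_def)
  have Cnz: "C \<zeta> \<noteq> 0" if "R < norm \<zeta>" for \<zeta>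
  proof
    assume "C \<zeta> = 0"
    then have "inverse \<zeta> = - \<zeta>" by (simp add: C_def add_eq_0_iff2)
    then have eq: "norm (inverse \<zeta>) = norm \<zeta>" by simp
    have "\<zeta> \<noteq> 0" using that R1 by auto
    then have "1 = norm (inverse \<zeta> * \<zeta>)" by simp
    also have "\<dots> = norm \<zeta> * norm \<zeta>" unfolding norm_mult eq ..
    finally have "1 = norm \<zeta> * norm \<zeta>" .
    moreover have "1 * 1 < norm \<zeta> * norm \<zeta>" using that R1 by (intro mult_strict_mono) auto
    ultimately show False by simp
  qed
  have "(\<exists>l. (\<Phi> \<longlongrightarrow> l) at_infinity) \<or> filterlim \<Phi> at_infinity at_infinity"
  proof (rule picard_at_infinity[OF _ ab])
    have nz: "\<zeta> \<noteq> 0" if "R < norm \<zeta>" for \<zeta> :: complex using that R1 by auto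
    have "S holomorphic_on {\<zeta>. R < norm \<zeta>}" "C holomorphic_on {\<zeta>. R < norm \<zeta>}"
      unfolding S_def C_def using nz by (auto intro!: holomorphic_intros)
    then show "\<Phi> holomorphic_on {\<zeta>. R < norm \<zeta>}"
      unfolding \<Phi>_def using Cnz
      by (intro holomorphic_intros holomorphic_on_compose_gen[OF _ hol, unfolded o_def]
          holomorphic_on_compose_gen[OF _ hol_dh, unfolded o_def]) auto
    fix \<zeta> :: complex assume \<zeta>: "R < norm \<zeta>"
    define z where "z = \<i> * Ln \<zeta>"
    have e: "exp (- \<i> * z) = \<zeta>" using nz[OF \<zeta>] by (simp add: z_def)
    have "exp (Ka + Kb) < exp (Im z)" using \<zeta> nz[OF \<zeta>] by (simp add: R_def z_def)
    then have "Ka + Kb < Im z" by simp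
    moreover have "cos z \<noteq> 0" using Cnz[OF \<zeta>] SC(2)[of z] e by simp
    ultimately have "\<phi> z \<noteq> a" "\<phi> z \<noteq> b" using K critical_iff[of a z] critical_iff[of b z] by force+
    then show "\<Phi> \<zeta> \<noteq> a \<and> \<Phi> \<zeta> \<noteq> b" using \<Phi>\<phi>[of z] e by simp
  qed
  moreover obtain zs :: "complex \<Rightarrow> complex" where zs: "\<And>s. sin (zs s) = s" "\<And>s. 0 \<le> Im (zs s)"
    "filterlim (\<lambda>s. exp (- \<i> * zs s)) at_infinity at_infinity" using sin_section by blast
  ultimately consider l where "((\<lambda>s. \<phi> (zs s)) \<longlongrightarrow> l) at_infinity" 
    | "filterlim (\<lambda>s. \<phi> (zs s)) at_infinity at_infinity"
    using filterlim_compose[OF _ zs(3), of \<Phi>] unfolding \<Phi>\<phi> by metis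
  note lims = this
  \<comment> \<open>\<open>N z\<close> as a function of \<open>s = sin z\<close>, entire because
    only the square of \<open>cos\<close> occurs in it.\<close>
  define k where "k = (\<lambda>s. s * h s - (1 - s\<^sup>2) * deriv h s)"
  have cosnz: "cos (zs s) \<noteq> 0" if "1 < norm s" for s
    using norm_cos_bounds(1)[of "zs s"] zs(1)[of s] that by auto
  have k\<phi>: "k s = \<phi> (zs s) * cos (zs s)" if "1 < norm s" for s
    using cosnz[OF that] by (simp add: k_def N_def zs(1) cos_squared_eq)
  have holk: "k holomorphic_on UNIV" unfolding k_def by (intro holomorphic_intros hol hol_dh)
  have "\<exists>p. \<forall>s. k s = poly p s"
  proof (rule lims)
    fix l assume "((\<lambda>s. \<phi> (zs s)) \<longlongrightarrow> l) at_infinity"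
    then have "eventually (\<lambda>s. dist (\<phi> (zs s)) l < 1) at_infinity" by (rule tendstoD) simp
    then obtain Q where Q: "\<And>s. Q \<le> norm s \<Longrightarrow> dist (\<phi> (zs s)) l < 1"
      by (auto simp: eventually_at_infinity)
    have "norm (k s) \<le> 2 * (norm l + 1) * norm s ^ 1" if s: "max Q 2 \<le> norm s" for s
    proof -
      have "norm (\<phi> (zs s)) \<le> norm l + 1"
        using Q[of s] s norm_triangle_sub[of "\<phi> (zs s)" l] by (simp add: dist_norm)
      moreover have "norm (cos (zs s)) \<le> 2 * norm s"
        using norm_cos_bounds(2)[of "zs s"] zs(1)[of s] s by simp
      ultimately have "norm (\<phi> (zs s)) * norm (cos (zs s)) \<le> (norm l + 1) * (2 * norm s)"
        by (intro mult_mono) auto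
      moreover have "norm (k s) = norm (\<phi> (zs s)) * norm (cos (zs s))"
      proof -
        have "1 < norm s" using s by simp
        then show ?thesis unfolding k\<phi>[OF \<open>1 < norm s\<close>] by (intro norm_mult)
      qed
      ultimately show ?thesis by (simp add: algebra_simps)
    qed
    then show ?thesis by (rule entire_polynomial_growth_imp_poly[OF holk])
  next
    assume inf: "filterlim (\<lambda>s. \<phi> (zs s)) at_infinity at_infinity"
    have lim: "filterlim (\<lambda>s. \<phi> (zs s) * cos (zs s)) at_infinity at_infinity"
      by (rule filterlim_at_infinity_times[OF inf filterlim_cos_section[OF zs(1)]])
    have ev: "eventually (\<lambda>s. \<phi> (zs s) * cos (zs s) = k s) at_infinity"
      unfolding eventually_at_infinity using k\<phi> by (intro exI[of _ 2]) auto
    have "filterlim k at_infinity at_infinity"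
      using lim unfolding filterlim_cong[OF refl refl ev] .
    then show ?thesis by (rule entire_tendsto_infinity_imp_poly[OF holk])
  qed
  then show False using not_poly_of_ode unfolding k_def by blast
qed

text \<open>\<open>(a * s - B)\<^sup>2 - (1 - s\<^sup>2) * (h s)\<^sup>2\<close> is the product of \<open>H h a - B\<close> over the two points above
  \<open>s = sin z\<close>; for two parameters these products differ by a polynomial.\<close>

lemma finite_value_orbits_parameters:
  assumes "finite (orbit2pi ` {z. H h a z = A})" "finite (orbit2pi ` {z. H h b z = B})"
  shows "a\<^sup>2 = b\<^sup>2"
proof (rule ccontr)
  assume ab: "a\<^sup>2 \<noteq> b\<^sup>2"
  define P where "P = (\<lambda>a B s. (a * s - B)\<^sup>2 - (1 - s\<^sup>2) * (h s)\<^sup>2)"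
  have holP: "P a B holomorphic_on UNIV" for a B unfolding P_def by (intro holomorphic_intros hol)
  have fin: "finite {s. P a B s = 0}" if "finite (orbit2pi ` {z. H h a z = B})" for a B
  proof -
    have "{s. P a B s = 0} \<subseteq> sin ` {z. H h a z = B}"
    proof
      fix s assume "s \<in> {s. P a B s = 0}"
      then have Ps: "P a B s = 0" by simp
      obtain z where z: "sin z = s" using sin_preimages(1) by blast
      have "(1 - s\<^sup>2) = (cos z)\<^sup>2" by (simp add: z cos_squared_eq)
      then have "(a * s - B)\<^sup>2 = (cos z * h s)\<^sup>2" using Ps by (simp add: P_def power_mult_distrib)
      then have "a * s - B = cos z * h s \<or> a * s - B = - (cos z * h s)" by (simp add: power2_eq_iff)
      then show "s \<in> sin ` {z. H h a z = B}"
      proof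
        \<comment> \<open>The wrong sign of the cosine is repaired by the reflected point
          \<open>pi - z\<close>, which has the same sine.\<close>
        assume "a * s - B = cos z * h s"
        then have "H h a (of_real pi - z) = B" 
          by (simp add: H_def sin_diff cos_diff z algebra_simps)
        moreover have "sin (of_real pi - z) = s" by (simp add: sin_diff z)
        ultimately show ?thesis by (metis (mono_tags, lifting) imageI mem_Collect_eq)
      next
        assume "a * s - B = - (cos z * h s)"
        then have "H h a z = B" by (simp add: H_def z algebra_simps)
        then show ?thesis using z by blast
      qed
    qed
    moreover have "finite (sin ` {z. H h a z = B})"
      by (rule orbit2pi_finite_zero_set[OF that]) (simp add: H_def)
    ultimately show ?thesis by (rule finite_subset)
  qed
  \<comment> \<open>The terms with \<open>h\<close> cancel in the difference; the leading
    coefficient \<open>a\<^sup>2 - b\<^sup>2\<close> is nonzero.\<close>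
  define p where "p = [:A\<^sup>2 - B\<^sup>2, - 2 * (a * A - b * B), a\<^sup>2 - b\<^sup>2:]"
  have p: "P a A s - P b B s = poly p s" for s
    by (simp add: P_def p_def power2_eq_square algebra_simps)
  have deg: "degree p = 2" "p \<noteq> 0" using ab by (auto simp: p_def)
  have "bounded ({s. P a A s = 0} \<union> {s. P b B s = 0} \<union> {s. poly p s = 0})"
    using fin[OF assms(1)] fin[OF assms(2)] poly_roots_finite[OF deg(2)] by (intro finite_imp_bounded) auto
  then obtain R where R: "\<And>s. s \<in> {s. P a A s = 0} \<union> {s. P b B s = 0} \<union> {s. poly p s = 0} \<Longrightarrow> norm s \<le> R"
    by (meson bounded_iff)
  have nz: "P a A s \<noteq> 0" "P b B s \<noteq> 0" "poly p s \<noteq> 0" if "R < norm s" for s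
    using R[of s] that by auto
  \<comment> \<open>Dividing by \<open>p\<close> makes the omitted values constant:
    \<open>Y s = 0\<close> means \<open>P a A s = 0\<close>, and \<open>Y s = 1\<close> means
    \<open>P b B s = 0\<close>.\<close>
  define Y where "Y = (\<lambda>s. P a A s / poly p s)"
  have PY: "P a A s = Y s * poly p s" if "R < norm s" for s using nz[OF that] by (simp add: Y_def)
  have "(\<exists>l. (Y \<longlongrightarrow> l) at_infinity) \<or> filterlim Y at_infinity at_infinity"
  proof (rule picard_at_infinity)
    show "Y holomorphic_on {s. R < norm s}"
      unfolding Y_def using nz by (intro holomorphic_intros holomorphic_on_subset[OF holP]) auto
    show "0 \<noteq> (1::complex)" by simp
    show "Y s \<noteq> 0 \<and> Y s \<noteq> 1" if "R < norm s" for s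
      using nz[OF that] p[of s] by (auto simp: Y_def)
  qed
  then have "\<exists>q. \<forall>s. P a A s = poly q s"
  proof
    assume "\<exists>l. (Y \<longlongrightarrow> l) at_infinity"
    then obtain l where "(Y \<longlongrightarrow> l) at_infinity" by blast
    then have "eventually (\<lambda>s. dist (Y s) l < 1) at_infinity" by (rule tendstoD) simp
    then obtain Q where Q: "\<And>s. Q \<le> norm s \<Longrightarrow> dist (Y s) l < 1" by (auto simp: eventually_at_infinity)
    obtain C n where C: "0 \<le> C" "\<And>z. 1 \<le> norm z \<Longrightarrow> norm (poly p z) \<le> C * norm z ^ n" 
      by (rule poly_growth[of p]) (rule that; assumption)
    have "norm (P a A s) \<le> ((norm l + 1) * C) * norm s ^ n" if s: "max (max Q 1) (R + 1) \<le> norm s" for s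
    proof -
      have "norm (Y s) \<le> norm l + 1"
        using Q[of s] s norm_triangle_sub[of "Y s" l] by (simp add: dist_norm)
      then have "norm (Y s) * norm (poly p s) \<le> (norm l + 1) * (C * norm s ^ n)"
        using C(2)[of s] s by (intro mult_mono) auto
      then show ?thesis using PY[of s] s by (simp add: norm_mult mult.assoc)
    qed
    then show ?thesis by (rule entire_polynomial_growth_imp_poly[OF holP])
  next
    assume inf: "filterlim Y at_infinity at_infinity"
    have lim: "filterlim (\<lambda>s. Y s * poly p s) at_infinity at_infinity"
      using deg by (intro filterlim_at_infinity_times[OF inf] filterlim_poly_at_infinity) simp
    have ev: "eventually (\<lambda>s. Y s * poly p s = P a A s) at_infinity"
      unfolding eventually_at_infinity using PY by (intro exI[of _ "R + 1"]) auto
    have "filterlim (P a A) at_infinity at_infinity"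
      using lim unfolding filterlim_cong[OF refl refl ev] .
    then show ?thesis by (rule entire_tendsto_infinity_imp_poly[OF holP])
  qed
  then obtain q where q: "\<And>s. P a A s = poly q s" by blast
  obtain C n where C: "0 \<le> C" "\<And>z. 1 \<le> norm z \<Longrightarrow> norm (poly ([:-A, a:]\<^sup>2 - q) z) \<le> C * norm z ^ n"
    by (rule poly_growth[of "[:-A, a:]\<^sup>2 - q"]) (rule that; assumption)
  have "norm (h s) \<le> (1 + C) * norm s ^ n" if s: "2 \<le> norm s" for s
  proof -
    have "(1 - s\<^sup>2) * (h s)\<^sup>2 = poly ([:-A, a:]\<^sup>2 - q) s"
      using q[of s] by (simp add: P_def algebra_simps)
    then have "norm (1 - s\<^sup>2) * (norm (h s))\<^sup>2 \<le> C * norm s ^ n"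
      using C(2)[of s] s by (simp flip: norm_mult norm_power)
    moreover have "1 \<le> norm (1 - s\<^sup>2)"
    proof -
      have "2 * 2 \<le> norm s * norm s" using s by (intro mult_mono) auto
      then show ?thesis using norm_triangle_ineq2[of "s\<^sup>2" 1] 
        by (simp add: norm_power power2_eq_square norm_mult norm_minus_commute)
    qed
    then have "1 * (norm (h s))\<^sup>2 \<le> norm (1 - s\<^sup>2) * (norm (h s))\<^sup>2" by (intro mult_right_mono) auto
    moreover have "C * norm s ^ n \<le> (1 + C)\<^sup>2 * (norm s ^ n)\<^sup>2"
    proof (intro mult_mono)
      show "C \<le> (1 + C)\<^sup>2" using C(1) by (simp add: power2_eq_square algebra_simps)
      have "1 \<le> norm s ^ n" using s by (intro one_le_power) simp
      then show "norm s ^ n \<le> (norm s ^ n)\<^sup>2" using mult_left_mono[of 1 "norm s ^ n" "norm s ^ n"] 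
        by (simp add: power2_eq_square)
    qed (use C(1) in auto)
    ultimately have "(norm (h s))\<^sup>2 \<le> ((1 + C) * norm s ^ n)\<^sup>2" by (simp add: power_mult_distrib)
    then show ?thesis by (rule power2_le_imp_le) (use C(1) in simp)
  qed
  then show False using entire_polynomial_growth_imp_poly[OF hol] transc by blast
qed

end

section \<open>Factorizations for generic parameters\<close>

text \<open>\<open>1 / f (1 / x)\<close> extends holomorphically by 0 at 0. The open mapping theorem
  gives the first claim, isolated zeros of its derivative the second.\<close>

lemma pole_at_infinity_local:
  fixes f :: "complex \<Rightarrow> complex"
  assumes hol: "f holomorphic_on {z. R < norm z}" and inf: "filterlim f at_infinity at_infinity"
  shows "\<exists>M. \<forall>w. M \<le> norm w \<longrightarrow> (\<exists>z. Q < norm z \<and> f z = w)"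
    and "\<exists>Q. \<forall>z. Q < norm z \<longrightarrow> deriv f z \<noteq> 0"
proof -
  have "eventually (\<lambda>z. 1 \<le> norm (f z)) at_infinity"
    using inf unfolding filterlim_at_infinity[OF order_refl] by auto
  then obtain b where b: "\<And>z. b \<le> norm z \<Longrightarrow> 1 \<le> norm (f z)" by (auto simp: eventually_at_infinity)
  define S where "S = max (max b R) (max Q 1)"
  define \<rho> where "\<rho> = 1 / S"
  have S: "0 < S" "1 \<le> S" "b \<le> S" "R \<le> S" "Q \<le> S" by (auto simp: S_def)
  have \<rho>: "0 < \<rho>" using S by (simp add: \<rho>_def)
  define m where "m = (\<lambda>x. if x = 0 then 0 else inverse (f (inverse x)))"
  have large: "S < norm (inverse x)" if "x \<in> ball 0 \<rho> - {0}" for x :: complex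
  proof -
    have x: "norm x < 1 / S" "0 < norm x" using that by (auto simp: \<rho>_def)
    then have "S < 1 / norm x" using S(1) by (simp add: less_divide_eq mult.commute)
    then show ?thesis by (simp add: norm_inverse inverse_eq_divide norm_divide)
  qed
  have fnz: "f z \<noteq> 0" if "S < norm z" for z using b[of z] that S by auto
  have mnz: "m x \<noteq> 0" if "x \<in> ball 0 \<rho> - {0}" for x
    using fnz[OF large[OF that]] that by (simp add: m_def)
  have "f \<circ> inverse holomorphic_on ball 0 \<rho> - {0}"
  proof (rule holomorphic_on_compose)
    show "inverse holomorphic_on ball 0 \<rho> - {0::complex}" by (intro holomorphic_intros) auto
    have "inverse ` (ball 0 \<rho> - {0}) \<subseteq> {z::complex. R < norm z}"
    proof (intro image_subsetI CollectI)
      fix x :: complex assume "x \<in> ball 0 \<rho> - {0}"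
      from large[OF this] S(4) show "R < norm (inverse x)" by linarith
    qed
    then show "f holomorphic_on inverse ` (ball 0 \<rho> - {0})" by (rule holomorphic_on_subset[OF hol])
  qed
  then have "(\<lambda>x. f (inverse x)) holomorphic_on ball 0 \<rho> - {0}" by (simp add: o_def)
  then have "(\<lambda>x. inverse (f (inverse x))) holomorphic_on ball 0 \<rho> - {0}"
    by (rule holomorphic_on_inverse) (use fnz large in blast)
  then have holm0: "m holomorphic_on ball 0 \<rho> - {0}"
    by (rule holomorphic_transform) (simp add: m_def)
  have "(m \<longlongrightarrow> 0) (at 0)"
  proof -
    have "((\<lambda>z. inverse (f z)) \<longlongrightarrow> 0) at_infinity" using filterlim_compose[OF tendsto_inverse_0 inf] .
    then have "((\<lambda>x. inverse (f (inverse x))) \<longlongrightarrow> 0) (at 0)" by (simp add: lim_at_infinity_0 o_def)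
    then show ?thesis by (rule Lim_transform_eventually) (auto simp: m_def eventually_at intro!: exI[of _ 1])
  qed
  then have "isCont m 0" by (simp add: isCont_def m_def)
  then have "continuous_on (ball 0 \<rho>) m"
    using continuous_on_eq_continuous_at[OF open_delete[OF open_ball], THEN iffD1, OF holomorphic_on_imp_continuous_on[OF holm0]]
    unfolding continuous_on_eq_continuous_at[OF open_ball] by (metis Diff_iff singletonD)
  then have holm: "m holomorphic_on ball 0 \<rho>"
    by (rule no_isolated_singularity[OF _ holm0]) auto
  have x0: "of_real (\<rho> / 2) \<in> ball 0 \<rho> - {0::complex}" using \<rho> by (auto simp del: of_real_divide)
  have m0: "m 0 = 0" by (simp add: m_def)
  have mnc: "\<not> m constant_on ball 0 \<rho>"
    using mnz[OF x0] m0 x0 \<rho> unfolding constant_on_def by (metis DiffD1 centre_in_ball)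
  have "open (m ` ball 0 \<rho>)"
    by (rule open_mapping_thm[OF holm open_ball connected_ball open_ball subset_refl mnc])
  moreover have "0 \<in> m ` ball 0 \<rho>" using m0 \<rho> by force
  ultimately obtain \<eta> where \<eta>: "0 < \<eta>" "ball 0 \<eta> \<subseteq> m ` ball 0 \<rho>" using openE by blast
  have "\<exists>z. Q < norm z \<and> f z = w" if w: "2 / \<eta> \<le> norm w" for w
  proof -
    have wpos: "0 < norm w" using w \<eta>(1) by (meson divide_pos_pos less_le_trans zero_less_numeral)
    have "norm (inverse w) = 1 / norm w" by (simp add: norm_inverse inverse_eq_divide norm_divide)
    also have "\<dots> < \<eta>" using w \<eta>(1) wpos by (simp add: field_simps)
    finally obtain x where x: "x \<in> ball 0 \<rho>" "inverse w = m x" using \<eta>(2) by auto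
    then have "x \<noteq> 0" using m0 wpos by auto
    then have "f (inverse x) = w" using x(2) by (simp add: m_def)
    moreover have "Q < norm (inverse x)" using large[of x] x(1) \<open>x \<noteq> 0\<close> S(5) by simp
    ultimately show ?thesis by blast
  qed
  then show "\<exists>M. \<forall>w. M \<le> norm w \<longrightarrow> (\<exists>z. Q < norm z \<and> f z = w)" by blast
  have holdm: "deriv m holomorphic_on ball 0 \<rho>" by (intro holomorphic_deriv holm) auto
  obtain \<beta> where \<beta>: "\<beta> \<in> ball 0 \<rho>" "deriv m \<beta> \<noteq> 0"
  proof (rule ccontr)
    assume "\<not> thesis"
    then have "\<And>x. x \<in> ball 0 \<rho> \<Longrightarrow> (m has_field_derivative 0) (at x within ball 0 \<rho>)"
      using holomorphic_derivI[OF holm open_ball] that by (metis has_field_derivative_at_within)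
    then have "m constant_on ball 0 \<rho>"
      using has_field_derivative_zero_constant[of "ball 0 \<rho>" m] unfolding constant_on_def by auto
    then show False using mnc by simp
  qed
  have c0: "0 \<in> ball 0 \<rho>" using \<rho> by simp
  obtain r where r: "0 < r" "\<And>x. x \<in> ball 0 r - {0} \<Longrightarrow> deriv m x \<noteq> 0"
  proof (cases "deriv m 0 = 0")
    case True
    have "\<exists>r>0. \<forall>z\<in>ball 0 r - {0}. deriv m z \<noteq> 0"
      by (rule isolated_zeros[OF holdm open_ball connected_ball c0 True \<beta>]) blast
    then obtain r where r: "0 < r" "\<And>z. z \<in> ball 0 r - {0} \<Longrightarrow> deriv m z \<noteq> 0" by blast
    then show ?thesis using that[of r] by blast
  next
    case False
    have "isCont (deriv m) 0"
      using holomorphic_on_imp_continuous_on[OF holdm] \<rho> by (simp add: continuous_on_eq_continuous_at)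
    then obtain e where "0 < e" "\<And>y. dist 0 y < e \<Longrightarrow> deriv m y \<noteq> 0"
      using continuous_at_avoid[of 0 "deriv m" 0] False by blast
    then show ?thesis using that[of e] by auto
  qed
  have "deriv f z \<noteq> 0" if z: "max S (1 / r) < norm z" for z
  proof
    assume "deriv f z = 0"
    have znz: "z \<noteq> 0" using z S by auto
    have df: "(f has_field_derivative deriv f z) (at z)"
    proof (rule holomorphic_derivI[OF hol])
      show "open {z::complex. R < norm z}" by (intro open_Collect_less continuous_intros)
    qed (use z S in auto)
    define x where "x = inverse z"
    have xr: "x \<in> ball 0 r - {0}"
    proof -
      have "1 / r < norm z" using z by simp
      then have "1 / norm z < r" using r(1) znz by (simp add: field_simps)
      then show ?thesis using znz by (simp add: x_def norm_inverse inverse_eq_divide norm_divide)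
    qed
    have "((\<lambda>x. inverse (f (inverse x))) has_field_derivative 0) (at x)"
    proof -
      have 1: "((\<lambda>x. f (inverse x)) has_field_derivative deriv f z * - (inverse x ^ Suc (Suc 0))) (at x)"
        using xr DERIV_chain2[OF _ DERIV_inverse, of f "deriv f z" x UNIV] df by (simp add: x_def)
      show ?thesis
        using DERIV_inverse_fun[OF 1] fnz[of z] z \<open>deriv f z = 0\<close> by (simp add: x_def)
    qed
    then have "(m has_field_derivative 0) (at x)"
      by (rule has_field_derivative_transform_within_open[of _ _ _ "- {0}"]) (use xr in \<open>auto simp: m_def\<close>)
    then show False using r(2)[OF xr] DERIV_imp_deriv by blast
  qed
  then show "\<exists>Q. \<forall>z. Q < norm z \<longrightarrow> deriv f z \<noteq> 0" by blast
qed

lemma holomorphic_square_eq: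
  fixes p q :: "complex \<Rightarrow> complex"
  assumes "p holomorphic_on ball z r" "q holomorphic_on ball z r"
    and sq: "\<And>x. x \<in> ball z r \<Longrightarrow> (p x)\<^sup>2 = (q x)\<^sup>2"
  shows "(\<forall>x\<in>ball z r. p x = q x) \<or> (\<forall>x\<in>ball z r. p x = - q x)"
proof (rule disjCI)
  assume "\<not> (\<forall>x\<in>ball z r. p x = - q x)"
  then obtain \<beta> where \<beta>: "\<beta> \<in> ball z r" "p \<beta> + q \<beta> \<noteq> 0" by (auto simp: add_eq_0_iff2)
  define U where "U = ball z r \<inter> (\<lambda>x. p x + q x) -` (- {0})"
  have "open U"
    unfolding U_def by (intro continuous_open_preimage continuous_intros holomorphic_on_imp_continuous_on assms) auto
  moreover have "\<beta> \<in> U" using \<beta> by (simp add: U_def)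
  moreover have "p x = q x" if "x \<in> U" for x
  proof -
    have "(p x + q x) * (p x - q x) = 0" using sq[of x] that by (simp add: U_def algebra_simps power2_eq_square)
    then show ?thesis using that by (simp add: U_def)
  qed
  moreover have "U \<subseteq> ball z r" by (simp add: U_def)
  ultimately show "\<forall>x\<in>ball z r. p x = q x"
    using analytic_continuation_open[of U "ball z r" p q, OF _ _ _ _ _ assms(1,2)] open_ball connected_ball by blast
qed

lemma not_card_le_2:
  assumes "\<not> (finite S \<and> card S \<le> 2)"
  obtains x y z where "x \<in> S" "y \<in> S" "z \<in> S" "x \<noteq> y" "x \<noteq> z" "y \<noteq> z"
proof -
  obtain T where "T \<subseteq> S" "card T = 3"
  proof (cases "finite S")
    case True
    then have "3 \<le> card S" using assms by simp
    then show ?thesis using that obtain_subset_with_card_n by metis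
  next
    case False
    then show ?thesis using that infinite_arbitrarily_large by metis
  qed
  then show ?thesis using that by (auto simp: card_3_iff)
qed

text \<open>A transcendental \<open>g\<close> takes all values but at most one infinitely often, and
  each such value \<open>v\<close> forces \<open>p\<close> to be the constant
  \<open>\<alpha> v\<close>; then \<open>\<alpha>\<close> is constant off one point.\<close>

lemma entire_composition_poly:
  assumes hola: "\<alpha> holomorphic_on UNIV" and holg: "g holomorphic_on UNIV"
    and nc: "\<not> \<alpha> constant_on UNIV" and eq: "\<And>z. \<alpha> (g z) = poly p z"
  shows "\<exists>q. \<forall>z. g z = poly q z"
proof (rule ccontr)
  assume np: "\<not> (\<exists>q. \<forall>z. g z = poly q z)"
  have inf: "infinite {z. g z = v} \<or> infinite {z. g z = w}" if "v \<noteq> w" for v w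
    using entire_two_values_finite_imp_poly[OF holg that] np by blast
  have const: "p = [:\<alpha> v:]" if "infinite {z. g z = v}" for v
  proof (rule ccontr)
    assume "p \<noteq> [:\<alpha> v:]"
    then have "finite {z. poly (p - [:\<alpha> v:]) z = 0}" by (intro poly_roots_finite) simp
    moreover have "{z. g z = v} \<subseteq> {z. poly (p - [:\<alpha> v:]) z = 0}" by (auto simp flip: eq)
    ultimately show False using that finite_subset by blast
  qed
  obtain u where u: "infinite {z. g z = u}" using inf[of 0 1] by auto
  define V where "V = {v. infinite {z. g z = v}}"
  have "\<alpha> v = \<alpha> u" if "v \<in> V" for v using const[of v] const[OF u] that by (simp add: V_def)
  moreover have "\<exists>v0. - {v0} \<subseteq> V"
  proof (cases "V = UNIV")
    case False
    then obtain v0 where "v0 \<notin> V" by blast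
    then have "- {v0} \<subseteq> V" using inf[of v0] by (auto simp: V_def)
    then show ?thesis by blast
  qed auto
  ultimately obtain v0 where v0: "\<And>v. v \<in> - {v0} \<Longrightarrow> \<alpha> v = \<alpha> u" by blast
  have "\<alpha> v = \<alpha> u" for v
  proof (rule analytic_continuation_open[of "- {v0}" UNIV \<alpha> "\<lambda>_. \<alpha> u"])
    have "v0 + 1 \<in> - {v0}" by simp
    then show "- {v0} \<noteq> {}" by blast
  qed (use hola v0 in auto)
  then show False using nc by (auto simp: constant_on_def)
qed

lemma card_roots_simple:
  fixes p :: "complex poly"
  assumes "p \<noteq> 0" and "\<And>z. poly p z = 0 \<Longrightarrow> poly (pderiv p) z \<noteq> 0"
  shows "card {z. poly p z = 0} = degree p"
proof -
  have sf: "rsquarefree p" using assms(2) by (auto simp: rsquarefree_roots)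
  have "degree p = size (proots p)" by (simp add: size_proots_complex)
  also have "\<dots> = (\<Sum>z\<in>set_mset (proots p). count (proots p) z)" by (rule size_multiset_overloaded_eq)
  also have "\<dots> = (\<Sum>z\<in>{z. poly p z = 0}. 1)"
  proof (rule sum.cong)
    show "set_mset (proots p) = {z. poly p z = 0}" using assms(1) by simp
    show "count (proots p) z = 1" if "z \<in> {z. poly p z = 0}" for z
    proof -
      have "order z p \<noteq> 0" using that assms(1) by (simp add: order_root)
      moreover have "order z p = 0 \<or> order z p = 1" using sf by (simp add: rsquarefree_def)
      ultimately show ?thesis using assms(1) by simp
    qed
  qed
  finally show ?thesis by simp
qed

text \<open>A generic parameter together with a supposed nontrivial factorization; the aim is to
  derive \<open>False\<close> in this context.\<close>

locale generic_factorization = entire_data +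
  fixes a :: complex and f g :: "complex \<Rightarrow> complex"
  assumes a0: "a \<noteq> 0"
    and simple: "\<And>z. deriv (H h a) z = 0 \<Longrightarrow> deriv (deriv (H h a)) z \<noteq> 0"
    and same: "\<And>z w. \<lbrakk>deriv (H h a) z = 0; deriv (H h a) w = 0; H h a z = H h a w\<rbrakk> \<Longrightarrow> sin z = sin w \<and> cos z = cos w"
    and inf_critical: "infinite (orbit2pi ` {z. deriv (H h a) z = 0})"
    and inf_value: "\<And>B. infinite (orbit2pi ` {z. H h a z = B})"
    and holf: "f holomorphic_on UNIV" and holg: "g holomorphic_on UNIV"
    and fg: "\<And>z. H h a z = f (g z)"
    and notlin_f: "\<not> linear_fun f" and notlin_g: "\<not> linear_fun g"
begin

lemma df: "(f has_field_derivative deriv f w) (at w)"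
  using holf by (intro holomorphic_derivI) auto

lemma dg: "(g has_field_derivative deriv g z) (at z)"
  using holg by (intro holomorphic_derivI) auto

lemma holdf: "deriv f holomorphic_on UNIV" by (intro holomorphic_deriv holf) auto

lemma holdg: "deriv g holomorphic_on UNIV" by (intro holomorphic_deriv holg) auto

lemma ddf: "(deriv f has_field_derivative deriv (deriv f) w) (at w)"
  using holdf by (intro holomorphic_derivI) auto

lemma ddg: "(deriv g has_field_derivative deriv (deriv g) z) (at z)"
  using holdg by (intro holomorphic_derivI) auto

lemma Hfg: "H h a = (\<lambda>z. f (g z))" using fg by blast

lemma dH: "deriv (H h a) z = deriv f (g z) * deriv g z"
  unfolding Hfg by (rule DERIV_imp_deriv[OF DERIV_chain2[OF df dg]])

lemma d2H: "deriv (deriv (H h a)) z = deriv (deriv f) (g z) * deriv g z * deriv g z + deriv f (g z) * deriv (deriv g) z"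
proof -
  have "deriv (H h a) = (\<lambda>z. deriv f (g z) * deriv g z)" using dH by blast
  moreover have "((\<lambda>z. deriv f (g z) * deriv g z) has_field_derivative
      deriv (deriv f) (g z) * deriv g z * deriv g z + deriv (deriv g) z * deriv f (g z)) (at z)"
    using DERIV_mult[OF DERIV_chain2[OF ddf dg] ddg] by simp
  ultimately show ?thesis by (metis DERIV_imp_deriv mult.commute)
qed

text \<open>Where \<open>deriv f (g z)\<close> vanishes, the second derivative of the composition
  reduces to \<open>deriv (deriv f) (g z) * (deriv g z)\<^sup>2\<close>, and simplicity makes it
  nonzero.\<close>

lemma critical_f:
  assumes "deriv f (g z) = 0"
  shows "deriv (H h a) z = 0" "deriv g z \<noteq> 0" "deriv (deriv f) (g z) \<noteq> 0"
proof -
  show "deriv (H h a) z = 0" using assms by (simp add: dH)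
  from simple[OF this] show "deriv g z \<noteq> 0" "deriv (deriv f) (g z) \<noteq> 0"
    using assms by (auto simp: d2H)
qed

lemma H_nonconstant: "\<not> H h a constant_on UNIV"
proof
  assume "H h a constant_on UNIV"
  then obtain c where "H h a = (\<lambda>z. c)" by (auto simp: constant_on_def)
  then have "deriv (H h a) = (\<lambda>z. 0)" by simp
  then show False using simple[of 0] by simp
qed

lemma g_nonconstant: "\<not> g constant_on UNIV"
  using H_nonconstant unfolding constant_on_def fg by metis

lemma same_orbit:
  assumes "deriv f (g z) = 0" "g z = g w"
  shows "sin z = sin w" "cos z = cos w"
proof -
  have "deriv (H h a) z = 0" "deriv (H h a) w = 0" using critical_f(1) assms by auto
  then show "sin z = sin w" "cos z = cos w" using same[of z w] assms(2) by (simp_all add: fg)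
qed

lemma H_shift: "H h a (z + 2 * of_real pi * of_int n) = H h a z"
  by (simp add: H_def)

lemma hol_shift: "(\<lambda>z. g (z + c)) holomorphic_on A"
  by (rule holomorphic_on_compose_gen[OF _ holg, unfolded o_def]) (auto intro!: holomorphic_intros)

text \<open>Near a simple critical point \<open>w\<close> of \<open>f\<close> we have \<open>f = f w + \<Theta>\<^sup>2\<close> with \<open>\<Theta>\<close> injective, so at
  most two distinct translates of \<open>g\<close> can pass through \<open>w\<close> at the same point.\<close>

lemma three_translates_imp_periodic:
  assumes w: "deriv f w = 0" and z: "g z = w" "g (z + 2 * of_real pi * of_int n) = w" "g (z + 2 * of_real pi * of_int m) = w"
    and nm: "n \<noteq> 0" "m \<noteq> 0" "n \<noteq> m"
  shows "\<exists>k::int. k \<noteq> 0 \<and> (\<forall>x. g (x + 2 * of_real pi * of_int k) = g x)"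
proof -
  define G where "G = (\<lambda>(j::int) x. g (x + 2 * of_real pi * of_int j))"
  have Gz: "G 0 z = w" "G n z = w" "G m z = w" using z by (auto simp: G_def)
  have fG: "f (G j x) = H h a x" for j x using fg[of "x + 2 * of_real pi * of_int j"] H_shift[of x j] by (simp add: G_def)
  have holG: "G j holomorphic_on A" for j A unfolding G_def by (rule hol_shift)
  have d2: "(deriv ^^ 2) f w \<noteq> 0" using critical_f(3)[of z] w z by (simp add: numeral_2_eq_2)
  obtain \<Phi> r where \<Phi>: "0 < r" "\<Phi> holomorphic_on ball w r"
    "\<And>u. u \<in> ball w r \<Longrightarrow> f u - f w = ((u - w) * \<Phi> u) ^ 2" "\<And>u. u \<in> ball w r \<Longrightarrow> \<Phi> u \<noteq> 0"
  proof (rule holomorphic_factor_order_of_zero_strong[OF holf open_UNIV UNIV_I _ d2])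
    show "(deriv ^^ i) f w = 0" if "0 < i" "i < 2" for i :: nat
    proof -
      have "i = 1" using that by simp
      then show ?thesis using w by simp
    qed
  qed auto
  define \<Theta> where "\<Theta> = (\<lambda>u. (u - w) * \<Phi> u)"
  have hol\<Theta>: "\<Theta> holomorphic_on ball w r" unfolding \<Theta>_def by (intro holomorphic_intros \<Phi>(2))
  have "(\<Theta> has_field_derivative \<Phi> w) (at w)"
  proof -
    have "(\<Phi> has_field_derivative deriv \<Phi> w) (at w)"
      using \<Phi>(1) by (intro holomorphic_derivI[OF \<Phi>(2)]) auto
    then show ?thesis unfolding \<Theta>_def by (auto intro!: derivative_eq_intros)
  qed
  then have "deriv \<Theta> w \<noteq> 0" using \<Phi>(1,4) DERIV_imp_deriv by fastforce
  then obtain r' where r': "r' > 0" "ball w r' \<subseteq> ball w r" "inj_on \<Theta> (ball w r')"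
    using has_complex_derivative_locally_injective[OF hol\<Theta>, of w] \<Phi>(1) by auto
  define V where "V = (G 0) -` ball w r' \<inter> (G n) -` ball w r' \<inter> (G m) -` ball w r'"
  have "open V"
    unfolding V_def by (intro open_Int open_vimage holomorphic_on_imp_continuous_on holG) auto
  moreover have "z \<in> V" using Gz r'(1) by (simp add: V_def)
  ultimately obtain d where d: "0 < d" "ball z d \<subseteq> V" using openE by blast
  have G_in: "G j x \<in> ball w r'" if "x \<in> ball z d" "j \<in> {0, n, m}" for j x
    using that d(2) by (auto simp: V_def)
  have hol\<Theta>G: "(\<lambda>x. \<Theta> (G j x)) holomorphic_on ball z d" if "j \<in> {0, n, m}" for j
    by (rule holomorphic_on_compose_gen[OF holG hol\<Theta>, unfolded o_def]) (use G_in[OF _ that] r'(2) in blast)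
  have sq: "(\<Theta> (G j x))\<^sup>2 = H h a x - f w" if "x \<in> ball z d" "j \<in> {0, n, m}" for j x
    using \<Phi>(3)[of "G j x"] G_in[OF that] r'(2) fG by (auto simp: \<Theta>_def)
  have alt: "(\<forall>x\<in>ball z d. \<Theta> (G i x) = \<Theta> (G j x)) \<or> (\<forall>x\<in>ball z d. \<Theta> (G i x) = - \<Theta> (G j x))"
    if "i \<in> {0, n, m}" "j \<in> {0, n, m}" for i j
    by (rule holomorphic_square_eq[OF hol\<Theta>G[OF that(1)] hol\<Theta>G[OF that(2)]]) (simp only: sq[OF _ that(1)] sq[OF _ that(2)])
  \<comment> \<open>Three functions agreeing up to sign: if the translate by 0 is the negative of
    both others, those two coincide.\<close>
  have "\<exists>i\<in>{0, n, m}. \<exists>j\<in>{0, n, m}. i \<noteq> j \<and> (\<forall>x\<in>ball z d. \<Theta> (G i x) = \<Theta> (G j x))"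
  proof (cases "(\<forall>x\<in>ball z d. \<Theta> (G 0 x) = \<Theta> (G n x)) \<or> (\<forall>x\<in>ball z d. \<Theta> (G 0 x) = \<Theta> (G m x))")
    case True
    then show ?thesis
    proof
      assume "\<forall>x\<in>ball z d. \<Theta> (G 0 x) = \<Theta> (G n x)"
      then show ?thesis using nm(1) by (intro bexI[of _ 0] bexI[of _ n]) auto
    next
      assume "\<forall>x\<in>ball z d. \<Theta> (G 0 x) = \<Theta> (G m x)"
      then show ?thesis using nm(2) by (intro bexI[of _ 0] bexI[of _ m]) auto
    qed
  next
    case False
    have "(\<forall>x\<in>ball z d. \<Theta> (G 0 x) = \<Theta> (G n x)) \<or> (\<forall>x\<in>ball z d. \<Theta> (G 0 x) = - \<Theta> (G n x))"
      "(\<forall>x\<in>ball z d. \<Theta> (G 0 x) = \<Theta> (G m x)) \<or> (\<forall>x\<in>ball z d. \<Theta> (G 0 x) = - \<Theta> (G m x))"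
      by (rule alt; simp)+
    with False have neg: "\<forall>x\<in>ball z d. \<Theta> (G 0 x) = - \<Theta> (G n x)" "\<forall>x\<in>ball z d. \<Theta> (G 0 x) = - \<Theta> (G m x)"
      by argo+
    have "\<forall>x\<in>ball z d. \<Theta> (G n x) = \<Theta> (G m x)"
    proof
      fix x assume x: "x \<in> ball z d"
      show "\<Theta> (G n x) = \<Theta> (G m x)" using bspec[OF neg(1) x] bspec[OF neg(2) x] by simp
    qed
    then show ?thesis using nm(3) by (intro bexI[of _ n] bexI[of _ m]) auto
  qed
  then obtain i j where ij: "i \<in> {0, n, m}" "j \<in> {0, n, m}" "i \<noteq> j" "\<forall>x\<in>ball z d. \<Theta> (G i x) = \<Theta> (G j x)"
    by blast
  have "G i x = G j x" if "x \<in> ball z d" for x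
    using inj_onD[OF r'(3), of "G i x" "G j x"] ij(4) that G_in[OF that ij(1)] G_in[OF that ij(2)] by simp
  then have Gij: "G i x = G j x" for x
    by (intro analytic_continuation_open[of "ball z d" UNIV "G i" "G j" x] holG) (use d(1) in auto)
  have "g (x + 2 * of_real pi * of_int (i - j)) = g x" for x
    using Gij[of "x - 2 * of_real pi * of_int j"] by (simp add: G_def algebra_simps)
  then show ?thesis using ij(3) by (intro exI[of _ "i - j"]) auto
qed

lemma critical_fibre_card:
  assumes np: "\<And>k::int. k \<noteq> 0 \<Longrightarrow> \<exists>x. g (x + 2 * of_real pi * of_int k) \<noteq> g x" and w: "deriv f w = 0"
  shows "finite {z. g z = w} \<and> card {z. g z = w} \<le> 2"
proof (rule ccontr)
  assume "\<not> ?thesis"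
  then obtain x y z where xyz: "g x = w" "g y = w" "g z = w" "x \<noteq> y" "x \<noteq> z" "y \<noteq> z"
    by (rule not_card_le_2) (simp only: mem_Collect_eq that)
  have sc: "sin y = sin x" "cos y = cos x" "sin z = sin x" "cos z = cos x"
    using same_orbit[of y x] same_orbit[of z x] w xyz by simp_all
  obtain n :: int where n: "y = x + 2 * of_real pi * of_int n" using sin_cos_eq_imp_orbit[OF sc(1,2)] .
  obtain m :: int where m: "z = x + 2 * of_real pi * of_int m" using sin_cos_eq_imp_orbit[OF sc(3,4)] .
  have "\<exists>k::int. k \<noteq> 0 \<and> (\<forall>x. g (x + 2 * of_real pi * of_int k) = g x)"
    by (rule three_translates_imp_periodic[OF w, of x n m]) (use xyz n m in auto)
  then show False using np by blast
qed

lemma hol_dH: "deriv (H h a) holomorphic_on UNIV" by (intro holomorphic_deriv holH) auto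

lemma finite_critical_strip: "finite (orbit2pi ` {z. deriv (H h a) z = 0 \<and> \<bar>Im z\<bar> \<le> K})"
proof -
  have "\<exists>\<beta>. deriv (H h a) \<beta> \<noteq> 0"
  proof (rule ccontr)
    assume "\<not> (\<exists>\<beta>. deriv (H h a) \<beta> \<noteq> 0)"
    then have "deriv (H h a) z = 0" for z by simp
    then have "deriv (H h a) = (\<lambda>z. 0)" by (rule ext)
    then show False using simple[of 0] by simp
  qed
  then obtain \<beta> where "deriv (H h a) \<beta> \<noteq> 0" ..
  then show ?thesis
    by (rule finite_zeros_imp_finite_orbits[OF hol_dH]) (simp add: deriv_H N_def)
qed

text \<open>Over a critical point of \<open>f\<close> a polynomial \<open>g\<close> has only simple
  preimages, and at most two of them, so its degree is at most 2. Degree 1 is linear, and degree 2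
  has a reflection symmetry that leaves room for only two critical orbits.\<close>

lemma g_not_poly: "\<not> (\<exists>q. \<forall>z. g z = poly q z)"
proof
  assume "\<exists>q. \<forall>z. g z = poly q z"
  then obtain q where "\<forall>z. g z = poly q z" ..
  then have q: "g z = poly q z" for z by simp
  have gq: "g = poly q" using q by (rule ext)
  have dgq: "deriv g z = poly (pderiv q) z" for z
    unfolding gq by (rule DERIV_imp_deriv[OF poly_DERIV])
  have deg0: "degree q \<noteq> 0"
  proof
    assume "degree q = 0"
    then obtain c where "q = [:c:]" by (rule degree_eq_zeroE)
    then show False using g_nonconstant by (auto simp: constant_on_def q)
  qed
  have deg1: "degree q \<noteq> 1"
  proof
    assume "degree q = 1"
    then obtain c0 c1 where c: "q = [:c0, c1:]" "c1 \<noteq> 0" by (rule degree1_coeffs)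
    then have "linear_fun g" unfolding linear_fun_def q by (intro exI[of _ c1] exI[of _ c0]) (simp add: mult.commute)
    then show False using notlin_g by simp
  qed
  have np: "\<exists>x. g (x + 2 * of_real pi * of_int k) \<noteq> g x" if k: "k \<noteq> 0" for k :: int
  proof (rule ccontr)
    assume "\<not> ?thesis"
    then have per: "\<And>x. g (x + 2 * of_real pi * of_int k) = g x" by blast
    have "poly (q - [:g 0:]) (of_nat n * (2 * of_real pi * of_int k)) = 0" for n :: nat
      using periodic_int_multiple[of g, OF per, of 0 "int n"] by (simp flip: q)
    then have "range (\<lambda>n::nat. of_nat n * (2 * of_real pi * of_int k)) \<subseteq> {z. poly (q - [:g 0:]) z = 0}" by blast
    moreover have "infinite (range (\<lambda>n::nat. of_nat n * (2 * of_real pi * of_int k) :: complex))"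
      by (rule range_inj_infinite) (use k in \<open>auto simp: inj_on_def\<close>)
    ultimately have "infinite {z. poly (q - [:g 0:]) z = 0}" using finite_subset by blast
    then have "q - [:g 0:] = 0" using poly_roots_finite by blast
    then have "q = [:g 0:]" by simp
    then show False using deg0 by (metis degree_pCons_0)
  qed
  have "\<exists>z0. deriv f (g z0) = 0"
  proof (rule ccontr)
    assume "\<not> ?thesis"
    then have "{z. deriv (H h a) z = 0} \<subseteq> {z. poly (pderiv q) z = 0}" by (auto simp: dH dgq)
    moreover have "finite {z. poly (pderiv q) z = 0}"
      using deg0 by (intro poly_roots_finite) (simp add: pderiv_eq_0_iff)
    ultimately show False using inf_critical finite_subset by blast
  qed
  then obtain z0 where z0: "deriv f (g z0) = 0" by blast
  define p where "p = q - [:g z0:]"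
  have pz: "poly p z = 0 \<longleftrightarrow> g z = g z0" for z by (simp add: p_def q)
  have degp: "degree p = degree q"
    unfolding p_def diff_conv_add_uminus using deg0 by (intro degree_add_eq_left) simp
  have "card {z. poly p z = 0} = degree p"
  proof (rule card_roots_simple)
    show "p \<noteq> 0" using degp deg0 by auto
    show "poly (pderiv p) z \<noteq> 0" if "poly p z = 0" for z
    proof -
      have "deriv f (g z) = 0" using that z0 by (simp only: pz)
      then show ?thesis using critical_f(2)[of z] by (simp add: p_def pderiv_diff dgq pderiv_pCons)
    qed
  qed
  moreover have "card {z. g z = g z0} \<le> 2" using critical_fibre_card[OF np z0] by blast
  ultimately have "degree q = 2" using degp deg0 deg1 by (simp add: pz)
  then obtain c0 c1 c2 where c: "q = [:c0, c1, c2:]" "c2 \<noteq> 0" by (rule degree2_coeffs)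
  define b where "b = - c1 / (2 * c2)"
  have sym: "g (2 * b - z) = g z" for z
    using c(2) by (simp add: q c(1) b_def field_simps)
  have "{z. deriv (H h a) z = 0} \<subseteq> {z. sin z = sin b \<and> cos z = cos b \<or> sin z = - sin b \<and> cos z = - cos b}"
  proof
    fix z assume "z \<in> {z. deriv (H h a) z = 0}"
    then have z: "deriv (H h a) z = 0" by simp
    have "((\<lambda>z. g (2 * b - z)) has_field_derivative deriv g (2 * b - z) * (- 1)) (at z)"
      by (rule DERIV_chain2[OF dg]) (auto intro!: derivative_eq_intros)
    then have "(g has_field_derivative - deriv g (2 * b - z)) (at z)" by (simp add: sym)
    then have "deriv g (2 * b - z) = - deriv g z" using DERIV_unique[OF dg] by (metis minus_minus)
    \<comment> \<open>The reflection in the vertex \<open>b\<close> preserves critical points and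
      their values, so \<open>z\<close> and \<open>2 * b - z\<close> share an orbit. Thus
      \<open>z - b\<close> is a multiple of \<open>pi\<close>.\<close>
    then have "deriv (H h a) (2 * b - z) = 0" using z by (auto simp: dH sym)
    then have "sin z = sin (2 * b - z)" "cos z = cos (2 * b - z)" using same[of z "2 * b - z"] z by (auto simp: fg sym)
    then obtain n :: int where n: "z = (2 * b - z) + 2 * of_real pi * of_int n" by (rule sin_cos_eq_imp_orbit)
    then have "2 * z = 2 * (b + of_real pi * of_int n)" by (simp add: algebra_simps)
    then have zb: "z = b + of_real pi * of_int n" by (metis mult_cancel_left zero_neq_numeral)
    show "z \<in> {z. sin z = sin b \<and> cos z = cos b \<or> sin z = - sin b \<and> cos z = - cos b}"
    proof (cases "even n")
      case True
      then obtain m where "n = 2 * m" by (elim evenE)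
      then have "z = b + 2 * of_real pi * of_int m" by (simp add: zb)
      then show ?thesis by simp
    next
      case False
      then obtain m where "n = 2 * m + 1" by (elim oddE)
      then have zm: "z = (b + of_real pi) + 2 * of_real pi * of_int m" by (simp add: zb algebra_simps)
      have "sin z = sin (b + of_real pi)" "cos z = cos (b + of_real pi)"
        unfolding zm by (rule sin_cos_plus_orbit)+
      then show ?thesis by (simp add: sin_add cos_add)
    qed
  qed
  note crit_sub = this
  have "orbit2pi ` {z. deriv (H h a) z = 0} \<subseteq> {orbit2pi b, orbit2pi (b + of_real pi)}"
  proof (intro image_subsetI)
    fix z assume "z \<in> {z. deriv (H h a) z = 0}"
    then have "z \<in> {z. sin z = sin b \<and> cos z = cos b \<or> sin z = - sin b \<and> cos z = - cos b}"
      using crit_sub by (rule rev_subsetD)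
    then have "sin z = sin b \<and> cos z = cos b \<or> sin z = sin (b + of_real pi) \<and> cos z = cos (b + of_real pi)"
      by (simp add: sin_add cos_add)
    then have "orbit2pi z = orbit2pi b \<or> orbit2pi z = orbit2pi (b + of_real pi)"
      using orbit2pi_eqI[of z b] orbit2pi_eqI[of z "b + of_real pi"] by argo
    then show "orbit2pi z \<in> {orbit2pi b, orbit2pi (b + of_real pi)}" by simp
  qed
  then have "finite (orbit2pi ` {z. deriv (H h a) z = 0})" by (rule finite_subset) simp
  then show False using inf_critical by simp
qed

end

lemma filterlim_at_infinity_power_root:
  fixes e :: "'a \<Rightarrow> complex"
  assumes "filterlim (\<lambda>s. e s ^ N) at_infinity F" and N: "0 < N"
  shows "filterlim e at_infinity F"
  unfolding filterlim_at_infinity[OF order_refl]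
proof (intro allI impI)
  fix r :: real assume r: "0 < r"
  then have "eventually (\<lambda>s. r ^ N \<le> norm (e s ^ N)) F"
    using assms(1) unfolding filterlim_at_infinity[OF order_refl] by simp
  then show "eventually (\<lambda>s. r \<le> norm (e s)) F"
  proof (rule eventually_mono)
    fix s assume "r ^ N \<le> norm (e s ^ N)"
    then show "r \<le> norm (e s)" using r N by (simp add: norm_power power_mono_iff)
  qed
qed

section \<open>Excluding two critical points of the outer function\<close>

context generic_factorization
begin

lemma same_orbit_Im:
  assumes "deriv f (g z) = 0" "g z = g w"
  shows "Im z = Im w"
proof -
  obtain n :: int where "z = w + 2 * of_real pi * of_int n" using sin_cos_eq_imp_orbit[OF same_orbit[OF assms]] .
  then show ?thesis by simp
qed

lemma critical_fibre_Im_bounded: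
  assumes "deriv f w = 0"
  shows "\<exists>K\<ge>0. \<forall>z. g z = w \<longrightarrow> \<bar>Im z\<bar> \<le> K"
proof (cases "\<exists>z0. g z0 = w")
  case True
  then obtain z0 where "g z0 = w" ..
  then have "Im z = Im z0" if "g z = w" for z using same_orbit_Im[of z z0] assms that by simp
  then show ?thesis by (intro exI[of _ "\<bar>Im z0\<bar>"]) auto
qed auto

text \<open>Near the end selected by \<open>\<sigma>\<close>, \<open>g\<close> omits
  \<open>w0\<close> and \<open>w1\<close>, because critical fibres have bounded imaginary part. A
  finite limit there would pass to \<open>H h a\<close>, against \<open>H_no_limit\<close>, so
  \<open>g\<close> has a pole at that end.\<close>

lemma end_behaviour:
  fixes N :: nat and \<sigma> :: real
  assumes N: "0 < N" and per: "\<And>x. g (x + 2 * of_real pi * of_nat N) = g x"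
    and \<sigma>: "\<sigma> = 1 \<or> \<sigma> = - 1"
    and w: "w0 \<noteq> w1" "deriv f w0 = 0" "deriv f w1 = 0"
  shows "\<exists>M. \<forall>w. M \<le> norm w \<longrightarrow> (\<exists>z. g z = w \<and> 0 < \<sigma> * Im z)"
    and "\<exists>K. \<forall>z. K < \<sigma> * Im z \<longrightarrow> M \<le> norm (g z) \<and> deriv g z \<noteq> 0"
proof -
  \<comment> \<open>Chosen so that \<open>exp (z / \<omega>)\<close> has modulus
    \<open>exp (\<sigma> * Im z / N)\<close> and its period is \<open>2 * pi * N\<close> up to
    sign.\<close>
  define \<omega> where "\<omega> = of_real \<sigma> * \<i> * of_nat N"
  have \<omega>0: "\<omega> \<noteq> 0" using N \<sigma> by (auto simp: \<omega>_def)
  have per_neg: "g (z + 2 * of_real pi * \<i> * \<omega>) = g z" for z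
  proof (rule disjE[OF \<sigma>])
    assume "\<sigma> = 1"
    then have "2 * of_real pi * \<i> * \<omega> = - (2 * of_real pi * of_nat N)" by (simp add: \<omega>_def)
    then have "z + 2 * of_real pi * \<i> * \<omega> + 2 * of_real pi * of_nat N = z" by (simp only: minus_add_cancel) simp
    from per[of "z + 2 * of_real pi * \<i> * \<omega>", unfolded this] show ?thesis by (rule sym)
  next
    assume "\<sigma> = - 1"
    then have "2 * of_real pi * \<i> * \<omega> = 2 * of_real pi * of_nat N" by (simp add: \<omega>_def)
    then show ?thesis using per[of z] by (simp only:)
  qed
  define G where "G = (\<lambda>v. g (\<omega> * Ln v))"
  have holG: "G holomorphic_on - {0}" unfolding G_def by (rule holomorphic_periodic_lift(1)[OF holg per_neg])
  have Gg: "G (exp (z / \<omega>)) = g z" for z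
    unfolding G_def by (rule holomorphic_periodic_lift(2)[OF holg per_neg \<omega>0])
  have z_div: "z / \<omega> = of_real (\<sigma> / N) * (- \<i> * z)" for z
  proof -
    have "\<sigma> / N * \<sigma> * N = 1" using \<sigma> N by auto
    then have 1: "(of_real (\<sigma> / N) * of_real \<sigma> * of_nat N :: complex) = 1"
      by (metis of_real_1 of_real_mult of_real_of_nat_eq)
    have 2: "- \<i> * z * \<i> = z" by (simp add: complex_eq_iff)
    have "of_real (\<sigma> / N) * (- \<i> * z) * \<omega> = (of_real (\<sigma> / N) * of_real \<sigma> * of_nat N) * (- \<i> * z * \<i>)"
      unfolding \<omega>_def by (simp only: mult_ac)
    also have "\<dots> = z" unfolding 1 2 by simp
    finally show ?thesis unfolding nonzero_divide_eq_eq[OF \<omega>0] by (rule sym)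
  qed
  have re_im: "Re (of_real c * x) = c * Re x" "Im (of_real c * x) = c * Im x" for c x by simp_all
  have norm_exp: "norm (exp (z / \<omega>)) = exp (\<sigma> * Im z / N)" for z
  proof -
    have "Re (z / \<omega>) = \<sigma> / N * Im z" unfolding z_div re_im by simp
    then show ?thesis by simp
  qed
  have Im_Ln: "\<sigma> * Im (\<omega> * Ln v) = N * ln (norm v)" if "v \<noteq> 0" for v
  proof -
    have "\<omega> * Ln v = of_real (\<sigma> * N) * (\<i> * Ln v)" by (simp add: \<omega>_def)
    then have "Im (\<omega> * Ln v) = \<sigma> * N * Re (Ln v)" by (simp only: re_im) simp
    then show ?thesis using \<sigma> that by auto
  qed
  obtain K0 where K0: "0 \<le> K0" "\<And>z. g z = w0 \<Longrightarrow> \<bar>Im z\<bar> \<le> K0" using critical_fibre_Im_bounded[OF w(2)] by blast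
  obtain K1 where K1: "0 \<le> K1" "\<And>z. g z = w1 \<Longrightarrow> \<bar>Im z\<bar> \<le> K1" using critical_fibre_Im_bounded[OF w(3)] by blast
  define R where "R = exp (K0 + K1)"
  have "(\<exists>l. (G \<longlongrightarrow> l) at_infinity) \<or> filterlim G at_infinity at_infinity"
  proof (rule picard_at_infinity[OF _ w(1)])
    show "G holomorphic_on {v. R < norm v}"
      by (rule holomorphic_on_subset[OF holG]) (auto simp: R_def)
    fix v :: complex assume v: "R < norm v"
    then have v0: "v \<noteq> 0" by (auto simp: R_def)
    have "K0 + K1 < ln (norm v)" using v v0 by (metis R_def exp_less_cancel_iff exp_ln zero_less_norm_iff)
    moreover have "ln (norm v) * 1 \<le> ln (norm v) * N"
      using N \<open>K0 + K1 < ln (norm v)\<close> K0(1) K1(1) by (intro mult_left_mono) auto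
    ultimately have "K0 + K1 < \<sigma> * Im (\<omega> * Ln v)" using Im_Ln[OF v0] by (simp add: mult.commute)
    also have "\<dots> \<le> \<bar>Im (\<omega> * Ln v)\<bar>" using \<sigma> by auto
    finally show "G v \<noteq> w0 \<and> G v \<noteq> w1" 
      unfolding G_def using K0(2)[of "\<omega> * Ln v"] K1(2)[of "\<omega> * Ln v"] K0(1) K1(1) by auto
  qed
  moreover have "\<not> (G \<longlongrightarrow> l) at_infinity" for l
  proof
    assume lim: "(G \<longlongrightarrow> l) at_infinity"
    have "\<exists>zs. (\<forall>s. sin (zs s) = s) \<and> filterlim (\<lambda>s. exp (zs s / \<omega>)) at_infinity at_infinity"
    proof (rule disjE[OF \<sigma>])
      assume s: "\<sigma> = 1"
      obtain zs :: "complex \<Rightarrow> complex" where zs: "\<And>s. sin (zs s) = s" "\<And>s. 0 \<le> Im (zs s)"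
          "filterlim (\<lambda>s. exp (- \<i> * zs s)) at_infinity at_infinity"
        using sin_section by blast
      have eqN: "exp (zs s / \<omega>) ^ N = exp (- \<i> * zs s)" for s
        using N unfolding exp_of_nat_mult[symmetric] z_div by (simp add: s)
      have "filterlim (\<lambda>s. exp (zs s / \<omega>)) at_infinity at_infinity"
        by (rule filterlim_at_infinity_power_root[OF _ N], unfold eqN) (rule zs(3))
      then show ?thesis using zs(1) by blast
    next
      assume s: "\<sigma> = - 1"
      obtain zs :: "complex \<Rightarrow> complex" where zs: "\<And>s. sin (zs s) = s" "\<And>s. Im (zs s) \<le> 0"
          "filterlim (\<lambda>s. exp (\<i> * zs s)) at_infinity at_infinity"
        using sin_section_lower by blast
      have eqN: "exp (zs s / \<omega>) ^ N = exp (\<i> * zs s)" for s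
        using N unfolding exp_of_nat_mult[symmetric] z_div by (simp add: s)
      have "filterlim (\<lambda>s. exp (zs s / \<omega>)) at_infinity at_infinity"
        by (rule filterlim_at_infinity_power_root[OF _ N], unfold eqN) (rule zs(3))
      then show ?thesis using zs(1) by blast
    qed
    then obtain zs where zs: "\<And>s. sin (zs s) = s" "filterlim (\<lambda>s. exp (zs s / \<omega>)) at_infinity at_infinity"
      by blast
    have "((\<lambda>s. g (zs s)) \<longlongrightarrow> l) at_infinity"
      using filterlim_compose[OF lim zs(2)] by (simp add: Gg)
    moreover have "isCont f l" using df DERIV_isCont by blast
    ultimately have "((\<lambda>s. f (g (zs s))) \<longlongrightarrow> f l) at_infinity" by (rule isCont_tendsto_compose[rotated])
    then show False using H_no_limit[OF zs(1), of a "f l"] by (simp add: fg)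
  qed
  ultimately have inf: "filterlim G at_infinity at_infinity" by blast
  have holG0: "G holomorphic_on {v. 0 < norm v}" by (rule holomorphic_on_subset[OF holG]) auto
  obtain M0 where M0: "\<forall>w. M0 \<le> norm w \<longrightarrow> (\<exists>v. 1 < norm v \<and> G v = w)"
    using pole_at_infinity_local(1)[OF holG0 inf, of 1] ..
  have "\<exists>z. g z = w \<and> 0 < \<sigma> * Im z" if w: "M0 \<le> norm w" for w
  proof -
    obtain v where v: "1 < norm v" "G v = w" using M0 w by blast
    have "v \<noteq> 0" using v(1) by auto
    have "0 < N * ln (norm v)" using v(1) N by (intro mult_pos_pos ln_gt_zero) simp_all
    then have "0 < \<sigma> * Im (\<omega> * Ln v)" unfolding Im_Ln[OF \<open>v \<noteq> 0\<close>] .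
    then show ?thesis using v(2) unfolding G_def by blast
  qed
  then show "\<exists>M. \<forall>w. M \<le> norm w \<longrightarrow> (\<exists>z. g z = w \<and> 0 < \<sigma> * Im z)" by blast
  obtain Q where Q: "\<forall>v. Q < norm v \<longrightarrow> deriv G v \<noteq> 0"
    using pole_at_infinity_local(2)[OF holG0 inf] ..
  have "eventually (\<lambda>v. M \<le> norm (G v)) at_infinity"
  proof (rule eventually_mono)
    show "eventually (\<lambda>v. \<bar>M\<bar> + 1 \<le> norm (G v)) at_infinity"
      using inf unfolding filterlim_at_infinity[OF order_refl] by simp
  qed simp
  then obtain b where b: "\<And>v. b \<le> norm v \<Longrightarrow> M \<le> norm (G v)" by (auto simp: eventually_at_infinity)
  have "M \<le> norm (g z) \<and> deriv g z \<noteq> 0" if z: "N * (\<bar>b\<bar> + \<bar>Q\<bar>) < \<sigma> * Im z" for z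
  proof -
    have "\<bar>b\<bar> + \<bar>Q\<bar> < \<sigma> * Im z / N" using z N by (simp add: less_divide_eq mult.commute)
    then have e: "\<bar>b\<bar> + \<bar>Q\<bar> < norm (exp (z / \<omega>))"
      unfolding norm_exp using exp_ge_add_one_self[of "\<sigma> * Im z / N"] by linarith
    have "M \<le> norm (g z)" using b[of "exp (z / \<omega>)"] e unfolding Gg by linarith
    moreover have "deriv G (exp (z / \<omega>)) \<noteq> 0" using Q e by auto
    moreover have "deriv g z = deriv G (exp (z / \<omega>)) * (exp (z / \<omega>) / \<omega>)"
    proof -
      have "(G has_field_derivative deriv G (exp (z / \<omega>))) (at (exp (z / \<omega>)))"
        by (rule holomorphic_derivI[OF holG]) auto
      moreover have "((\<lambda>z. exp (z / \<omega>)) has_field_derivative exp (z / \<omega>) / \<omega>) (at z)"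
        using \<omega>0 by (auto intro!: derivative_eq_intros)
      ultimately have "((\<lambda>z. G (exp (z / \<omega>))) has_field_derivative deriv G (exp (z / \<omega>)) * (exp (z / \<omega>) / \<omega>)) (at z)"
        by (rule DERIV_chain2)
      then show ?thesis unfolding Gg by (rule DERIV_imp_deriv)
    qed
    ultimately show ?thesis using \<omega>0 by simp
  qed
  then show "\<exists>K. \<forall>z. K < \<sigma> * Im z \<longrightarrow> M \<le> norm (g z) \<and> deriv g z \<noteq> 0" by blast
qed

lemma at_most_one_critical_point:
  assumes w: "w0 \<noteq> w1" "deriv f w0 = 0" "deriv f w1 = 0"
  shows False
proof (cases "\<exists>k::int. k \<noteq> 0 \<and> (\<forall>x. g (x + 2 * of_real pi * of_int k) = g x)")
  case False
  then have np: "\<exists>x. g (x + 2 * of_real pi * of_int k) \<noteq> g x" if "k \<noteq> 0" for k :: int using that by blast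
  have "\<exists>p. \<forall>z. g z = poly p z"
    by (rule entire_two_values_finite_imp_poly[OF holg w(1)])
      (use critical_fibre_card[OF np] w in blast)+
  then show ?thesis using g_not_poly by blast
next
  case True
  then obtain k :: int where k: "k \<noteq> 0" "\<And>x. g (x + 2 * of_real pi * of_int k) = g x" by blast
  define N where "N = nat \<bar>k\<bar>"
  have N: "0 < N" using k(1) by (simp add: N_def)
  have per: "g (x + 2 * of_real pi * of_nat N) = g x" for x
  proof (cases "0 \<le> k")
    case True
    then have "of_nat N = (of_int k :: complex)" by (simp add: N_def)
    then show ?thesis using k(2) by simp
  next
    case False
    then have "of_nat N = (- of_int k :: complex)" by (simp add: N_def)
    then show ?thesis using k(2)[of "x + 2 * of_real pi * of_nat N"] by simp
  qed
  note ends = end_behaviour[OF N per _ w]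
  obtain M1 where M1: "\<And>w. M1 \<le> norm w \<Longrightarrow> \<exists>z. g z = w \<and> 0 < 1 * Im z" using ends(1)[of 1] by blast
  obtain M2 where M2: "\<And>w. M2 \<le> norm w \<Longrightarrow> \<exists>z. g z = w \<and> 0 < - 1 * Im z" using ends(1)[of "- 1"] by blast
  define M where "M = max M1 M2"
  obtain L1 where L1: "\<And>z. L1 < 1 * Im z \<Longrightarrow> M \<le> norm (g z) \<and> deriv g z \<noteq> 0" using ends(2)[of 1 M] by blast
  obtain L2 where L2: "\<And>z. L2 < - 1 * Im z \<Longrightarrow> M \<le> norm (g z) \<and> deriv g z \<noteq> 0" using ends(2)[of "- 1" M] by blast
  define K where "K = \<bar>L1\<bar> + \<bar>L2\<bar>"
  \<comment> \<open>Each strip holds finitely many critical orbits, so some critical point lies far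
    out, where \<open>deriv g\<close> is nonzero; it must come from \<open>f\<close>. Its large
    value \<open>g z\<close> is taken in both half-planes, although a critical fibre has a single
    imaginary part.\<close>
  have "\<not> {z. deriv (H h a) z = 0} \<subseteq> {z. deriv (H h a) z = 0 \<and> \<bar>Im z\<bar> \<le> K}"
  proof
    assume "{z. deriv (H h a) z = 0} \<subseteq> {z. deriv (H h a) z = 0 \<and> \<bar>Im z\<bar> \<le> K}"
    then have "finite (orbit2pi ` {z. deriv (H h a) z = 0})"
      using finite_critical_strip[of K] by (meson finite_subset image_mono)
    then show False using inf_critical by simp
  qed
  then obtain z where z: "deriv (H h a) z = 0" "K < \<bar>Im z\<bar>" by force
  have "M \<le> norm (g z) \<and> deriv g z \<noteq> 0"
    using L1[of z] L2[of z] z(2) unfolding K_def by (cases "0 \<le> Im z") auto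
  then have gz: "M1 \<le> norm (g z)" "M2 \<le> norm (g z)" "deriv f (g z) = 0"
    using z(1) by (auto simp: dH M_def)
  obtain x where x: "g x = g z" "0 < Im x" using M1[OF gz(1)] by auto
  obtain y where y: "g y = g z" "Im y < 0" using M2[OF gz(2)] by auto
  have "Im z = Im x" "Im z = Im y" 
    using same_orbit_Im[OF gz(3), of x] same_orbit_Im[OF gz(3), of y] x(1) y(1) by simp_all
  then show False using x(2) y(2) by simp
qed

lemma factorization_absurd: False
proof -
  have unique: "w = w'" if "deriv f w = 0" "deriv f w' = 0" for w w'
    using at_most_one_critical_point that by blast
  have "\<exists>\<beta>. deriv f \<beta> \<noteq> 0"
  proof (rule ccontr)
    assume "\<not> (\<exists>\<beta>. deriv f \<beta> \<noteq> 0)"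
    then have "deriv f 0 = 0" "deriv f 1 = 0" by auto
    then show False using unique[of 0 1] by simp
  qed
  then obtain \<beta> where \<beta>: "deriv f \<beta> \<noteq> 0" ..
  \<comment> \<open>If \<open>deriv f\<close> has no zero, the default 0 serves and
    \<open>\<kappa>\<close> will be 0.\<close>
  define w0 where "w0 = (if \<exists>w. deriv f w = 0 then SOME w. deriv f w = 0 else 0)"
  have w0: "deriv f w = 0 \<Longrightarrow> w = w0" for w
    using unique[of w w0] someI[of "\<lambda>w. deriv f w = 0" w] by (auto simp: w0_def)
  obtain \<kappa> P where P: "P holomorphic_on UNIV" "P w0 \<noteq> 0" "\<And>w. deriv f w = (w - w0) ^ \<kappa> * P w"
    using entire_factor_zero[OF holdf \<beta>, of w0] by metis
  have "P w \<noteq> 0" for w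
  proof
    assume "P w = 0"
    then have "w = w0" using P(3)[of w] w0 by simp
    then show False using P(2) \<open>P w = 0\<close> by simp
  qed
  then obtain \<alpha> where \<alpha>: "\<alpha> holomorphic_on UNIV" "\<And>w. P w = exp (\<alpha> w)"
    using contractible_imp_holomorphic_log[OF P(1) convex_imp_contractible[OF convex_UNIV]] by (metis UNIV_I)
  have df_eq: "deriv f w = (w - w0) ^ \<kappa> * exp (\<alpha> w)" for w by (simp add: P(3) \<alpha>(2))
  have "\<alpha> constant_on UNIV"
  proof (rule ccontr)
    assume nc: "\<not> \<alpha> constant_on UNIV"
    \<comment> \<open>The shift turns the reflection \<open>pi - z\<close> into \<open>- z\<close>.
      The part \<open>N\<close> of the derivative becomes even and cancels, leaving
      \<open>- 2 * a * sin z\<close>.\<close>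
    define G where "G = (\<lambda>z. g (z + of_real (pi / 2)))"
    have holG: "G holomorphic_on UNIV" unfolding G_def by (rule hol_shift)
    have dG: "deriv G z = deriv g (z + of_real (pi / 2))" for z
    proof -
      have "((\<lambda>z. g (z + of_real (pi / 2))) has_field_derivative deriv g (z + of_real (pi / 2)) * 1) (at z)"
        by (rule DERIV_chain2[OF dg]) (auto intro!: derivative_eq_intros)
      then show ?thesis unfolding G_def by (simp add: DERIV_imp_deriv)
    qed
    have kH: "(G z - w0) ^ \<kappa> * deriv G z * exp (\<alpha> (G z)) = deriv (H h a) (z + of_real (pi / 2))" for z
      unfolding dH df_eq dG by (simp add: G_def mult_ac)
    have sc: "sin (of_real (pi / 2)) = (1::complex)" "cos (of_real (pi / 2)) = (0::complex)"
      using sin_of_real[of "pi / 2"] cos_of_real[of "pi / 2"] by simp_all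
    have sc_shift: "sin (z + of_real (pi / 2)) = cos z" "cos (z + of_real (pi / 2)) = - sin z" for z :: complex
      unfolding sin_add cos_add sc by simp_all
    have N_shift: "N (- z + of_real (pi / 2)) = N (z + of_real (pi / 2))" for z
      unfolding N_def sc_shift by simp
    have "(G z - w0) ^ \<kappa> * deriv G z * exp (\<alpha> (G z)) -
        (G (- z) - w0) ^ \<kappa> * deriv G (- z) * exp (\<alpha> (G (- z))) = (- 2 * a) * sin z" for z
      unfolding kH deriv_H N_shift sc_shift by simp
    \<comment> \<open>At 0 the left side is \<open>- N (pi / 2)\<close>, which is nonzero, while
      \<open>sin\<close> vanishes.\<close>
    moreover have "\<not> (\<exists>c. \<forall>z. (G z - w0) ^ \<kappa> * deriv G z * exp (\<alpha> (G z)) = c * sin z)"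
    proof
      assume "\<exists>c. \<forall>z. (G z - w0) ^ \<kappa> * deriv G z * exp (\<alpha> (G z)) = c * sin z"
      then obtain c where "\<And>z. deriv (H h a) (z + of_real (pi / 2)) = c * sin z" unfolding kH by blast
      from this[of 0] have "N (of_real (pi / 2)) = 0" unfolding deriv_H using sc by simp
      then show False using N_nonzero_if_cos_zero sc(2) by blast
    qed
    moreover have "- 2 * a \<noteq> 0" using a0 by simp
    ultimately obtain p where p: "\<And>z. \<alpha> (G z) = poly p z"
      using polynomial_of_exponential_equation[OF holG \<alpha>(1) nc, of "- 2 * a" w0 \<kappa>] by blast
    have "\<exists>q. \<forall>z. G z = poly q z" by (rule entire_composition_poly[OF \<alpha>(1) holG nc p])
    then obtain q where q: "\<forall>z. G z = poly q z" ..
    have "g z = poly (pcompose q [:- of_real (pi / 2), 1:]) z" for z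
      using q[rule_format, of "z - of_real (pi / 2)"] by (simp add: G_def poly_pcompose)
    then show False using g_not_poly by blast
  qed
  then obtain c where c: "\<And>w. \<alpha> w = c" by (auto simp: constant_on_def)
  define C where "C = exp c / of_nat (Suc \<kappa>)"
  have C0: "C \<noteq> 0" by (simp add: C_def del: of_nat_Suc)
  have "((\<lambda>w. f w - C * (w - w0) ^ Suc \<kappa>) has_field_derivative 0) (at w within UNIV)" for w
  proof -
    have "((\<lambda>w. f w - C * (w - w0) ^ Suc \<kappa>) has_field_derivative
        (w - w0) ^ \<kappa> * exp c - C * (of_nat (Suc \<kappa>) * (w - w0) ^ \<kappa>)) (at w)"
      using df[of w] unfolding df_eq c by (auto intro!: derivative_eq_intros simp del: of_nat_Suc power_Suc)
    then show ?thesis by (simp add: C_def del: of_nat_Suc)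
  qed
  then have "\<exists>B. \<forall>w\<in>UNIV. f w - C * (w - w0) ^ Suc \<kappa> = B"
    by (intro has_field_derivative_zero_constant convex_UNIV)
  then obtain B where B: "\<forall>w\<in>UNIV. f w - C * (w - w0) ^ Suc \<kappa> = B" ..
  have f_eq: "f w = B + C * (w - w0) ^ Suc \<kappa>" for w
    using bspec[OF B UNIV_I, of w] unfolding diff_eq_eq .
  have "\<kappa> \<noteq> 0"
  proof
    assume "\<kappa> = 0"
    then have "f w = C * w + (B - C * w0)" for w by (simp add: f_eq algebra_simps)
    then have "linear_fun f" unfolding linear_fun_def using C0 by blast
    then show False using notlin_f by simp
  qed
  then have dw0: "deriv f w0 = 0" by (simp add: df_eq)
  \<comment> \<open>For a shifted power the value \<open>B\<close> is taken exactly on the fibre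
    over \<open>w0\<close>; as \<open>w0\<close> is critical, that fibre is a single orbit, against
    \<open>inf_value\<close>.\<close>
  have HB: "H h a z = B \<longleftrightarrow> g z = w0" for z using C0 by (auto simp: fg f_eq)
  have "infinite {z. H h a z = B}" using inf_value[of B] by blast
  then have "{z. H h a z = B} \<noteq> {}" by (metis finite.emptyI)
  then obtain z0 where z0: "g z0 = w0" using HB by auto
  have "orbit2pi z = orbit2pi z0" if "H h a z = B" for z
  proof (rule orbit2pi_eqI)
    have "g z = w0" using that HB by simp
    then show "sin z = sin z0" "cos z = cos z0" using same_orbit[of z z0] z0 dw0 by simp_all
  qed
  then have "orbit2pi ` {z. H h a z = B} \<subseteq> {orbit2pi z0}" by blast
  then have "finite (orbit2pi ` {z. H h a z = B})" by (rule finite_subset) simp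
  then show False using inf_value by simp
qed

end

theorem theorem2p5:
  fixes h :: "complex \<Rightarrow> complex"
  assumes "transcendental_entire h" and "h 1 \<noteq> 0" and "h (-1) \<noteq> 0"
  shows "\<exists>E :: complex set. countable E \<and>
    (\<forall>a. a \<notin> E \<longrightarrow>
       prime_entire (H h a) \<and>
       infinite (orbit2pi ` {z. deriv (H h a) z = 0}) \<and>
       (\<forall>c z1 z2. H h a z1 = c \<and> deriv (H h a) z1 = 0 \<and>
                  H h a z2 = c \<and> deriv (H h a) z2 = 0 \<longrightarrow>
                  cos z1 = cos z2 \<and> sin z1 = sin z2) \<and>
       (\<forall>z. deriv (H h a) z = 0 \<longrightarrow> deriv (deriv (H h a)) z \<noteq> 0))"
proof -
  have h: "h holomorphic_on UNIV \<and> \<not> (\<exists>p. \<forall>z. h z = poly p z)"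
    using assms(1) unfolding transcendental_entire_def entire_def .
  interpret entire_data h
    by (rule entire_data.intro[OF conjunct1[OF h] conjunct2[OF h] assms(2,3)])
  define E3 where "E3 = {a. finite (orbit2pi ` {z. deriv (H h a) z = 0})}"
  define E4 where "E4 = {a. \<exists>B. finite (orbit2pi ` {z. H h a z = B})}"
  have "countable E3"
  proof (cases "E3 = {}")
    case False
    then obtain b where "b \<in> E3" by blast
    then have "E3 \<subseteq> {b}" using unique_finite_critical_orbits unfolding E3_def by blast
    then show ?thesis by (rule countable_subset) simp
  qed simp
  moreover have "countable E4"
  proof (cases "E4 = {}")
    case False
    then obtain b where b: "b \<in> E4" by blast
    have "E4 \<subseteq> {b, - b}"
    proof
      fix a assume "a \<in> E4"
      then have "a\<^sup>2 = b\<^sup>2" using b finite_value_orbits_parameters unfolding E4_def by blast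
      then show "a \<in> {b, - b}" by (simp add: power2_eq_iff)
    qed
    then show ?thesis by (rule countable_subset) simp
  qed simp
  \<comment> \<open>The parameter 0 is removed because Borel's trick needs the right-hand side
    \<open>- 2 * a * sin z\<close> to be nontrivial.\<close>
  ultimately have "countable (E1 \<union> E2 \<union> E3 \<union> E4 \<union> {0})" using countable_E1 countable_E2 by simp
  moreover have "prime_entire (H h a) \<and>
       infinite (orbit2pi ` {z. deriv (H h a) z = 0}) \<and>
       (\<forall>c z1 z2. H h a z1 = c \<and> deriv (H h a) z1 = 0 \<and>
                  H h a z2 = c \<and> deriv (H h a) z2 = 0 \<longrightarrow>
                  cos z1 = cos z2 \<and> sin z1 = sin z2) \<and>
       (\<forall>z. deriv (H h a) z = 0 \<longrightarrow> deriv (deriv (H h a)) z \<noteq> 0)"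
    if "a \<notin> E1 \<union> E2 \<union> E3 \<union> E4 \<union> {0}" for a
  proof -
    have a: "a \<notin> E1" "a \<notin> E2" "a \<notin> E3" "a \<notin> E4" "a \<noteq> 0" using that by auto
    have inf: "infinite (orbit2pi ` {z. deriv (H h a) z = 0})" using a(3) by (simp add: E3_def)
    have val: "infinite (orbit2pi ` {z. H h a z = B})" for B using a(4) by (auto simp: E4_def)
    have simple: "deriv (deriv (H h a)) z \<noteq> 0" if "deriv (H h a) z = 0" for z
      by (rule simple_critical(1)[OF a(1) that])
    have same: "sin z = sin w \<and> cos z = cos w"
      if "deriv (H h a) z = 0" "deriv (H h a) w = 0" "H h a z = H h a w" for z w
      using critical_points_same_value[OF a(1,2) that] by simp
    have "prime_entire (H h a)"
      unfolding prime_entire_def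
    proof (intro allI impI)
      fix f g assume fg: "entire f \<and> entire g \<and> H h a = f \<circ> g"
      show "linear_fun f \<or> linear_fun g"
      proof (rule ccontr)
        assume "\<not> (linear_fun f \<or> linear_fun g)"
        then have "\<not> linear_fun f" "\<not> linear_fun g" by simp_all
        moreover have "f holomorphic_on UNIV" "g holomorphic_on UNIV" using fg by (simp_all add: entire_def)
        moreover have "H h a z = f (g z)" for z using fg by simp
        ultimately have "generic_factorization h a f g"
          by (intro generic_factorization.intro entire_data_axioms generic_factorization_axioms.intro a(5) inf val simple same)
        then show False by (rule generic_factorization.factorization_absurd)
      qed
    qed
    moreover have "\<forall>c z1 z2. H h a z1 = c \<and> deriv (H h a) z1 = 0 \<and>
                  H h a z2 = c \<and> deriv (H h a) z2 = 0 \<longrightarrow>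
                  cos z1 = cos z2 \<and> sin z1 = sin z2"
      using same by metis
    ultimately show ?thesis using inf simple by blast
  qed
  ultimately show ?thesis by blast
qed

end
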